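(* Let $r \geq 2$ and $p,q \geq 1$ be integers and assume that the radii $R_1,R_2>0$ satisfy $R_1^2+R_2^2=1$. Then the generalized Clifford torus $i : \mathbb{S}^{p}(R_1) \times \mathbb{S}^{q}(R_2) \hookrightarrow \mathbb{S}^{p+q+1}$ is: (a) minimal if and only if $$R_1^2= \frac{p}{p+q} \quad\text{and}\quad R_2^2 =\frac{q}{p+q};\qquad ( * )$$ (b) a proper $ES$-$r$-harmonic submanifold of $\mathbb{S}^{p+q+1}$ if and only if $( * )$ does not hold and either $$r=2,\quad p \neq q \quad\text{and}\quad R_1^2=R_2^2= \frac12,$$ or $r \geq 3$ and $t=R_1^2$ is a root of the polynomial $$P(t)=r(p+q)\,t^3+[q-p-r(q+2p)]\,t^2+(2p+rp)\,t -p .$$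
   Context: $\mathbb{S}^{n}(R)$ denotes the Euclidean $n$-sphere of radius $R$, $\mathbb{S}^n=\mathbb{S}^n(1)$. The generalized Clifford torus is the isometric embedding $i(x,y)=(x,y)\in\mathbb{R}^{p+1}\times\mathbb{R}^{q+1}$, with $|x|=R_1$, $|y|=R_2$, and the domain carries the product metric. For a smooth map $\varphi:(M,g)\to(N,h)$ between Riemannian manifolds, let $\nabla^\varphi$ be the pull-back connection on $\varphi^{-1}TN$, let $A^k(\varphi^{-1}TN)$ be the space of $k$-forms on $M$ with values in $\varphi^{-1}TN$, let $d:A^k(\varphi^{-1}TN)\to A^{k+1}(\varphi^{-1}TN)$ be the exterior differential determined by $\nabla^\varphi$ (and the Levi-Civita connection of $M$), and let $d^*$ be its formal adjoint. The tension field is $\tau(\varphi)=-d^*d\varphi=\operatorname{trace}\nabla d\varphi$; $\varphi$ is harmonic if $\tau(\varphi)=0$. The $ES$-$r$-energy is $$E^{ES}_r(\varphi)=\frac12\int_M|(d^*+d)^r(\varphi)|^2\,dV .$$ Here $d$ applied to $\varphi$ is $d\varphi\in A^1(\varphi^{-1}TN)$, $d^*\varphi=0$ and $d^2\varphi=0$, so for $r\ge2$ one has $(d^*+d)^r(\varphi)=-(d^*+d)^{r-2}\tau(\varphi)$, a sum of forms of various degrees; components of different degree are orthogonal, and $|\omega|^2=\sum_{i_1<\dots<i_k}|\omega(e_{i_1},\dots,e_{i_k})|^2$ for a $k$-form $\omega$ and a local orthonormal frame $\{e_i\}$. A map is $ES$-$r$-harmonic if it is a critical point of $E^{ES}_r$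 with respect to all smooth variations. It is proper if it is not harmonic. An isometric immersion which is a (proper) $ES$-$r$-harmonic map is called a (proper) $ES$-$r$-harmonic submanifold (for isometric immersions, proper means not minimal). *)

theory Defs
  imports "HOL-Analysis.Analysis" "HOL-Computational_Algebra.Polynomial"
begin

text \<open>
  Manifolds are submanifolds \<open>M\<close> of a Euclidean space, given as point sets and carrying the
  induced metric. Consequently the Levi-Civita connection of \<open>M\<close> and the pull-back connection of a
  map into \<open>N\<close> are tangential projections of the derivative in the ambient space. The Riemannian
  volume measure of \<open>M\<close> is an explicit parameter \<open>vol\<close>.
\<close>

section \<open>Smooth maps and tangent spaces\<close>

primrec C_k :: "nat \<Rightarrow> ('a::euclidean_space \<Rightarrow> 'b::euclidean_space) \<Rightarrow> 'a set \<Rightarrow> bool" where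
  "C_k 0 f U \<longleftrightarrow> continuous_on U f"
| "C_k (Suc k) f U \<longleftrightarrow>
     (\<forall>x\<in>U. f differentiable (at x)) \<and> (\<forall>v. C_k k (\<lambda>x. frechet_derivative f (at x) v) U)"

definition smooth_on_set :: "'a::euclidean_space set \<Rightarrow> ('a \<Rightarrow> 'b::euclidean_space) \<Rightarrow> bool" where
  "smooth_on_set S f \<longleftrightarrow>
     (\<exists>U g. open U \<and> S \<subseteq> U \<and> (\<forall>k. C_k k g U) \<and> (\<forall>x\<in>S. g x = f x))"

definition smooth_map ::
  "'a::euclidean_space set \<Rightarrow> 'b::euclidean_space set \<Rightarrow> ('a \<Rightarrow> 'b) \<Rightarrow> bool" where
  "smooth_map M N \<phi> \<longleftrightarrow> smooth_on_set M \<phi> \<and> \<phi> ` M \<subseteq> N"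

definition tangent_space :: "'a::euclidean_space set \<Rightarrow> 'a \<Rightarrow> 'a set" where
  "tangent_space M x =
     {v. \<exists>\<epsilon>>0. \<exists>\<gamma>. smooth_on_set {-\<epsilon><..<\<epsilon>} \<gamma> \<and> \<gamma> ` {-\<epsilon><..<\<epsilon>} \<subseteq> M \<and>
           \<gamma> (0::real) = x \<and> (\<gamma> has_vector_derivative v) (at 0)}"

definition orth_proj :: "'a::euclidean_space set \<Rightarrow> 'a \<Rightarrow> 'a" where
  "orth_proj V v = (THE w. w \<in> V \<and> (\<forall>u\<in>V. (v - w) \<bullet> u = 0))"

definition tangent_field :: "'a::euclidean_space set \<Rightarrow> ('a \<Rightarrow> 'a) \<Rightarrow> bool" where
  "tangent_field M X \<longleftrightarrow> smooth_on_set M X \<and> (\<forall>x\<in>M. X x \<in> tangent_space M x)"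

definition orthonormal_frame :: "'a::euclidean_space set \<Rightarrow> 'a \<Rightarrow> 'a list" where
  "orthonormal_frame M x =
     (SOME es. distinct es \<and> pairwise orthogonal (set es) \<and> (\<forall>e\<in>set es. norm e = 1) \<and>
               span (set es) = tangent_space M x)"

text \<open>
  The derivative within \<open>M\<close> is only determined on tangent vectors of \<open>M\<close>; it is never evaluated
  on other vectors below.
\<close>

definition dir_deriv ::
  "'a::euclidean_space set \<Rightarrow> ('a \<Rightarrow> 'b::euclidean_space) \<Rightarrow> 'a \<Rightarrow> 'a \<Rightarrow> 'b" where
  "dir_deriv M f x v = frechet_derivative f (at x within M) v"

section \<open>Connections\<close>

definition levi_civita ::
  "'a::euclidean_space set \<Rightarrow> ('a \<Rightarrow> 'a) \<Rightarrow> 'a \<Rightarrow> 'a \<Rightarrow> 'a" where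
  "levi_civita M X x v = orth_proj (tangent_space M x) (dir_deriv M X x v)"

definition pullback_connection ::
  "'a::euclidean_space set \<Rightarrow> 'b::euclidean_space set \<Rightarrow> ('a \<Rightarrow> 'b) \<Rightarrow> ('a \<Rightarrow> 'b) \<Rightarrow> 'a \<Rightarrow> 'a \<Rightarrow> 'b" where
  "pullback_connection M N \<phi> \<sigma> x v = orth_proj (tangent_space N (\<phi> x)) (dir_deriv M \<sigma> x v)"

section \<open>Forms with values in the pull-back bundle\<close>

text \<open>
  An element \<open>\<omega>\<close> of the direct sum over all \<open>k\<close> of the spaces of \<open>k\<close>-forms with values in the
  pull-back bundle is a function of a point and a list of tangent vectors; its component of degree
  \<open>k\<close> is its restriction to lists of length \<open>k\<close>. Values at points outside \<open>M\<close> or at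
  non-tangent vectors are irrelevant.
\<close>

type_synonym ('a, 'b) form = "'a \<Rightarrow> 'a list \<Rightarrow> 'b"

definition smooth_forms ::
  "'a::euclidean_space set \<Rightarrow> 'b::euclidean_space set \<Rightarrow> ('a \<Rightarrow> 'b) \<Rightarrow> ('a, 'b) form set" where
  "smooth_forms M N \<phi> =
     {\<omega>. (\<forall>x\<in>M. \<forall>vs. set vs \<subseteq> tangent_space M x \<longrightarrow> \<omega> x vs \<in> tangent_space N (\<phi> x)) \<and>
          (\<forall>x\<in>M. \<forall>us ws u v. \<forall>a b::real.
             set us \<union> set ws \<union> {u, v} \<subseteq> tangent_space M x \<longrightarrow>
             \<omega> x (us @ (a *\<^sub>R u + b *\<^sub>R v) # ws) =
               a *\<^sub>R \<omega> x (us @ u # ws) + b *\<^sub>R \<omega> x (us @ v # ws)) \<and>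
          (\<forall>x\<in>M. \<forall>vs. set vs \<subseteq> tangent_space M x \<and> \<not> distinct vs \<longrightarrow> \<omega> x vs = 0) \<and>
          (\<forall>Xs. (\<forall>X\<in>set Xs. tangent_field M X) \<longrightarrow>
             smooth_on_set M (\<lambda>x. \<omega> x (map (\<lambda>X. X x) Xs)))}"

text \<open>
  The covariant derivative of \<open>\<omega>\<close> in direction \<open>v\<close>, evaluated on tangent vectors \<open>ws\<close> at \<open>x\<close>.
  As usual the vectors \<open>ws\<close> are extended to tangent vector fields; the extension used is the
  tangential projection of the constant field, and the value does not depend on this choice.
\<close>

definition cov_deriv ::
  "'a::euclidean_space set \<Rightarrow> 'b::euclidean_space set \<Rightarrow> ('a \<Rightarrow> 'b) \<Rightarrow> ('a, 'b) form \<Rightarrow>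
     'a \<Rightarrow> 'a \<Rightarrow> 'a list \<Rightarrow> 'b" where
  "cov_deriv M N \<phi> \<omega> x v ws =
     pullback_connection M N \<phi> (\<lambda>y. \<omega> y (map (orth_proj (tangent_space M y)) ws)) x v
     - (\<Sum>j<length ws.
          \<omega> x (ws[j := levi_civita M (\<lambda>y. orth_proj (tangent_space M y) (ws ! j)) x v]))"

definition ext_deriv ::
  "'a::euclidean_space set \<Rightarrow> 'b::euclidean_space set \<Rightarrow> ('a \<Rightarrow> 'b) \<Rightarrow> ('a, 'b) form \<Rightarrow> ('a, 'b) form" where
  "ext_deriv M N \<phi> \<omega> x vs =
     (\<Sum>i<length vs. (-1) ^ i *\<^sub>R cov_deriv M N \<phi> \<omega> x (vs ! i) (take i vs @ drop (Suc i) vs))"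

text \<open>
  The sum over all increasing multi-indices, of every length, is the sum over all subsequences of
  the frame; components of different degree are therefore orthogonal.
\<close>

definition form_inner ::
  "'a::euclidean_space set \<Rightarrow> ('a, 'b::euclidean_space) form \<Rightarrow> ('a, 'b) form \<Rightarrow> 'a \<Rightarrow> real" where
  "form_inner M \<omega> \<theta> x = (\<Sum>vs\<leftarrow>subseqs (orthonormal_frame M x). \<omega> x vs \<bullet> \<theta> x vs)"

text \<open>
  The formal adjoint of the exterior derivative on a compact manifold without boundary, where all
  smooth forms are admissible test forms. The result is unique at points of \<open>M\<close> and on tangent
  vectors.
\<close>

definition codiff ::
  "'a::euclidean_space set \<Rightarrow> 'a measure \<Rightarrow> 'b::euclidean_space set \<Rightarrow> ('a \<Rightarrow> 'b) \<Rightarrow>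
     ('a, 'b) form \<Rightarrow> ('a, 'b) form" where
  "codiff M vol N \<phi> \<omega> =
     (SOME \<eta>. \<eta> \<in> smooth_forms M N \<phi> \<and>
        (\<forall>\<theta>\<in>smooth_forms M N \<phi>.
           (\<integral>x. form_inner M (ext_deriv M N \<phi> \<theta>) \<omega> x \<partial>vol) = (\<integral>x. form_inner M \<theta> \<eta> x \<partial>vol)))"

definition map_differential ::
  "'a::euclidean_space set \<Rightarrow> ('a \<Rightarrow> 'b::euclidean_space) \<Rightarrow> ('a, 'b) form" where
  "map_differential M \<phi> x vs = (case vs of [v] \<Rightarrow> dir_deriv M \<phi> x v | _ \<Rightarrow> 0)"

section \<open>Harmonic and ES-harmonic maps\<close>

definition tension ::
  "'a::euclidean_space set \<Rightarrow> 'a measure \<Rightarrow> 'b::euclidean_space set \<Rightarrow> ('a \<Rightarrow> 'b) \<Rightarrow> 'a \<Rightarrow> 'b" where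
  "tension M vol N \<phi> x = - codiff M vol N \<phi> (map_differential M \<phi>) x []"

definition harmonic_map ::
  "'a::euclidean_space set \<Rightarrow> 'a measure \<Rightarrow> 'b::euclidean_space set \<Rightarrow> ('a \<Rightarrow> 'b) \<Rightarrow> bool" where
  "harmonic_map M vol N \<phi> \<longleftrightarrow> smooth_map M N \<phi> \<and> (\<forall>x\<in>M. tension M vol N \<phi> x = 0)"

text \<open>
  For \<open>r \<ge> 2\<close> this is the \<open>r\<close>-th power of \<open>d\<^sup>* + d\<close> applied to the map \<open>\<phi>\<close>: by
  \<open>d\<^sup>* \<phi> = 0\<close> and \<open>d d \<phi> = 0\<close> its second power is minus the tension field, a form of degree 0.
  It is meaningless for \<open>r < 2\<close>.
\<close>

definition ES_form ::
  "'a::euclidean_space set \<Rightarrow> 'a measure \<Rightarrow> 'b::euclidean_space set \<Rightarrow> nat \<Rightarrow> ('a \<Rightarrow> 'b) \<Rightarrow> ('a, 'b) form" where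
  "ES_form M vol N r \<phi> =
     ((\<lambda>\<omega> x vs. codiff M vol N \<phi> \<omega> x vs + ext_deriv M N \<phi> \<omega> x vs) ^^ (r - 2))
       (\<lambda>x vs. if vs = [] then - tension M vol N \<phi> x else 0)"

definition ES_energy ::
  "'a::euclidean_space set \<Rightarrow> 'a measure \<Rightarrow> 'b::euclidean_space set \<Rightarrow> nat \<Rightarrow> ('a \<Rightarrow> 'b) \<Rightarrow> real" where
  "ES_energy M vol N r \<phi> =
     1 / 2 * (\<integral>x. form_inner M (ES_form M vol N r \<phi>) (ES_form M vol N r \<phi>) x \<partial>vol)"

definition smooth_variation ::
  "'a::euclidean_space set \<Rightarrow> 'b::euclidean_space set \<Rightarrow> ('a \<Rightarrow> 'b) \<Rightarrow> real \<Rightarrow> (real \<Rightarrow> 'a \<Rightarrow> 'b) \<Rightarrow> bool" where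
  "smooth_variation M N \<phi> \<epsilon> \<Phi> \<longleftrightarrow>
     smooth_map ({-\<epsilon><..<\<epsilon>} \<times> M) N (\<lambda>(s, x). \<Phi> s x) \<and> (\<forall>x\<in>M. \<Phi> 0 x = \<phi> x)"

definition ES_harmonic_map ::
  "'a::euclidean_space set \<Rightarrow> 'a measure \<Rightarrow> 'b::euclidean_space set \<Rightarrow> nat \<Rightarrow> ('a \<Rightarrow> 'b) \<Rightarrow> bool" where
  "ES_harmonic_map M vol N r \<phi> \<longleftrightarrow>
     smooth_map M N \<phi> \<and>
     (\<forall>\<epsilon>>0. \<forall>\<Phi>. smooth_variation M N \<phi> \<epsilon> \<Phi> \<longrightarrow>
        ((\<lambda>s. ES_energy M vol N r (\<Phi> s)) has_real_derivative 0) (at 0))"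

definition proper_ES_harmonic_map ::
  "'a::euclidean_space set \<Rightarrow> 'a measure \<Rightarrow> 'b::euclidean_space set \<Rightarrow> nat \<Rightarrow> ('a \<Rightarrow> 'b) \<Rightarrow> bool" where
  "proper_ES_harmonic_map M vol N r \<phi> \<longleftrightarrow>
     ES_harmonic_map M vol N r \<phi> \<and> \<not> harmonic_map M vol N \<phi>"

section \<open>Isometric immersions\<close>

definition isometric_immersion ::
  "'a::euclidean_space set \<Rightarrow> 'b::euclidean_space set \<Rightarrow> ('a \<Rightarrow> 'b) \<Rightarrow> bool" where
  "isometric_immersion M N \<phi> \<longleftrightarrow>
     smooth_map M N \<phi> \<and>
     (\<forall>x\<in>M. \<forall>v\<in>tangent_space M x. \<forall>w\<in>tangent_space M x.
        dir_deriv M \<phi> x v \<bullet> dir_deriv M \<phi> x w = v \<bullet> w)"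

definition second_fundamental_form ::
  "'a::euclidean_space set \<Rightarrow> 'b::euclidean_space set \<Rightarrow> ('a \<Rightarrow> 'b) \<Rightarrow> 'a \<Rightarrow> 'a \<Rightarrow> 'a \<Rightarrow> 'b" where
  "second_fundamental_form M N \<phi> x v w = cov_deriv M N \<phi> (map_differential M \<phi>) x v [w]"

definition mean_curvature ::
  "'a::euclidean_space set \<Rightarrow> 'b::euclidean_space set \<Rightarrow> ('a \<Rightarrow> 'b) \<Rightarrow> 'a \<Rightarrow> 'b" where
  "mean_curvature M N \<phi> x =
     (1 / real (length (orthonormal_frame M x))) *\<^sub>R
       (\<Sum>e\<leftarrow>orthonormal_frame M x. second_fundamental_form M N \<phi> x e e)"

definition minimal_submanifold ::
  "'a::euclidean_space set \<Rightarrow> 'b::euclidean_space set \<Rightarrow> ('a \<Rightarrow> 'b) \<Rightarrow> bool" where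
  "minimal_submanifold M N \<phi> \<longleftrightarrow>
     isometric_immersion M N \<phi> \<and> (\<forall>x\<in>M. mean_curvature M N \<phi> x = 0)"

definition proper_ES_harmonic_submanifold ::
  "'a::euclidean_space set \<Rightarrow> 'a measure \<Rightarrow> 'b::euclidean_space set \<Rightarrow> nat \<Rightarrow> ('a \<Rightarrow> 'b) \<Rightarrow> bool" where
  "proper_ES_harmonic_submanifold M vol N r \<phi> \<longleftrightarrow>
     isometric_immersion M N \<phi> \<and> proper_ES_harmonic_map M vol N r \<phi>"

section \<open>The generalized Clifford torus\<close>

text \<open>
  The Riemannian volume measure of the sphere of radius \<open>R\<close> in an \<open>n\<close>-dimensional space: by polar
  coordinates, the set of all \<open>t a\<close> with \<open>0 < t \<le> 1\<close> and \<open>a \<in> A\<close> has Lebesgue measure \<open>R / n\<close>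
  times the volume of \<open>A\<close>.
\<close>

definition sphere_volume :: "real \<Rightarrow> 'a::euclidean_space measure" where
  "sphere_volume R =
     scale_measure (ennreal (real DIM('a) / R))
       (distr (restrict_space lborel (cball 0 R - {0})) (restrict_space borel (sphere 0 R))
          (\<lambda>x. (R / norm x) *\<^sub>R x))"

text \<open>
  The product metric on the torus is the metric induced from the ambient product space, and its
  volume measure is the product measure.
\<close>

definition clifford_torus :: "real \<Rightarrow> real \<Rightarrow> ('a::euclidean_space \<times> 'b::euclidean_space) set" where
  "clifford_torus R1 R2 = sphere 0 R1 \<times> sphere 0 R2"

definition clifford_volume :: "real \<Rightarrow> real \<Rightarrow> ('a::euclidean_space \<times> 'b::euclidean_space) measure" where
  "clifford_volume R1 R2 = sphere_volume R1 \<Otimes>\<^sub>M sphere_volume R2"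

definition clifford_embedding :: "'a \<times> 'b \<Rightarrow> 'a \<times> 'b" where
  "clifford_embedding = (\<lambda>(x, y). (x, y))"

end

theory Submission
  imports Defs "HOL-Combinatorics.Multiset_Permutations"
begin

text \<open>
  For a map \<open>\<phi>\<close> into the unit sphere the pull-back connection is the flat derivative followed by the
  projection \<open>\<Pi>\<close> onto the complement of \<open>\<phi>\<close>. Hence \<open>d\<^sup>* + d = \<Pi> D\<close>, where the flat operator \<open>D\<close> on
  vector-valued forms does not depend on \<open>\<phi>\<close> and is self-adjoint, and the \<open>ES\<close>-\<open>r\<close>-energy is half
  the squared norm of \<open>(\<Pi> D)\<^bsup>r - 2\<^esup> \<Pi> \<Delta> \<phi>\<close>. In a variation only \<open>\<Pi>\<close> moves, so moving one factor
  \<open>\<Pi> D\<close> after the other to the fixed side of the inner product gives the first variation without any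
  curvature term or commutation of derivatives.

  On the Clifford torus all forms that occur lie in the span of \<open>\<nu>\<close>, \<open>d\<nu>\<close> and \<open>\<phi>\<close> for a normal
  field \<open>\<nu>\<close>: one has \<open>\<Delta>\<phi> = \<kappa>\<nu> + c\<phi>\<close> and \<open>\<Delta>\<nu> = \<mu>\<nu> + \<kappa>\<rho>\<phi>\<close> with \<open>\<Delta> = d\<^sup>* d\<close> and \<open>c = p + q\<close>. The
  first variation along \<open>V\<close> becomes \<open>\<kappa> (\<mu>\<^bsup>k + 1\<^esup> - c \<mu>\<^bsup>k\<^esup> - k \<mu>\<^bsup>k - 1\<^esup> \<kappa>\<^sup>2 \<rho>)\<close> times the integral of \<open>\<nu> \<bullet> V\<close>, where \<open>k = r - 2\<close>;
  for \<open>\<kappa> \<noteq> 0\<close> and \<open>k > 0\<close> this vanishes for all \<open>V\<close> exactly at the roots of \<open>P\<close>.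
\<close>

section \<open>Smooth maps\<close>

text \<open>The codifferential is specified only as some form adjoint to \<open>ext_deriv\<close>
  under the integral. Nothing can be computed before the projected flat codifferential is known to
  qualify and to be the only candidate on tangent vectors. Existence needs a divergence theorem on
  the torus; it is drawn from the invariance of the volume under coordinate rotations, without
  charts. Uniqueness tests the difference of two candidates against itself, for which the volume
  must charge every open set that meets the manifold. The term with \<kappa>^2 \<rho> arises because
  \<Delta>\<nu> has the component \<kappa>\<rho> along \<phi>, which a moving projection detects.
  Each \<Delta>\<nu>, on either side of a projection, gives one such term, and k of them occur in
  all. As the variation enters only through the integral of \<nu> \<bullet> V, a single normal
  variation decides necessity. After clearing denominators the resulting equation in t splits into
  the numerator of \<kappa> and P(t), so that excluding the minimal torus leaves exactly P(t) =
  0.\<close>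

lemma frechet_derivative_eqI:
  assumes "(f has_derivative f') (at x)"
  shows "frechet_derivative f (at x) = f'"
  using frechet_derivative_at[OF assms] by simp

lemma frechet_derivative_cong_open:
  assumes "open U" "x \<in> U" "\<And>y. y \<in> U \<Longrightarrow> f y = g y"
  shows "frechet_derivative f (at x) = frechet_derivative g (at x)"
proof -
  have "(f has_derivative D) (at x) \<longleftrightarrow> (g has_derivative D) (at x)" for D
    using assms by (metis has_derivative_transform_within_open)
  then show ?thesis unfolding frechet_derivative_def by simp
qed

lemma C_k_SucD: "C_k (Suc k) f U \<Longrightarrow> C_k k f U"
proof (induction k arbitrary: f)
  case 0
  then have "f differentiable (at x within U)" if "x \<in> U" for x
    using that by (simp add: differentiable_at_withinI)
  then have "continuous_on U f"
    by (simp add: continuous_on_eq_continuous_within differentiable_imp_continuous_within)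
  then show ?case by simp
next
  case (Suc k)
  then have 1: "\<forall>x\<in>U. f differentiable (at x)" and
    "C_k (Suc k) (\<lambda>x. frechet_derivative f (at x) v) U" for v
    unfolding C_k.simps(2)[of "Suc k"] by blast+
  then have "C_k k (\<lambda>x. frechet_derivative f (at x) v) U" for v
    using Suc.IH by blast
  with 1 show ?case by simp
qed

lemma C_k_subset: "C_k k f U \<Longrightarrow> V \<subseteq> U \<Longrightarrow> C_k k f V"
proof (induction k arbitrary: f)
  case 0
  then show ?case using continuous_on_subset[of U f V] by simp
next
  case (Suc k)
  then show ?case unfolding C_k.simps by blast
qed

lemma C_k_cong:
  assumes "open U" "\<And>x. x \<in> U \<Longrightarrow> f x = g x" "C_k k f U"
  shows "C_k k g U"
  using assms(2,3)
proof (induction k arbitrary: f g)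
  case 0
  then show ?case by (metis C_k.simps(1) continuous_on_cong)
next
  case (Suc k)
  have "g differentiable (at x)" if "x \<in> U" for x
    using Suc.prems that assms(1) by (meson C_k.simps(2) differentiable_def has_derivative_transform_within_open)
  moreover have "C_k k (\<lambda>x. frechet_derivative g (at x) v) U" for v
    using Suc.IH[of "\<lambda>x. frechet_derivative f (at x) v" "\<lambda>x. frechet_derivative g (at x) v"]
      Suc.prems frechet_derivative_cong_open[OF assms(1)] by (metis C_k.simps(2))
  ultimately show ?case by simp
qed

lemma C_k_SucI:
  assumes "open U" "\<And>x. x \<in> U \<Longrightarrow> (f has_derivative f' x) (at x)"
    and "\<And>v. C_k k (\<lambda>x. f' x v) U"
  shows "C_k (Suc k) f U"
proof -
  have "C_k k (\<lambda>x. frechet_derivative f (at x) v) U" for v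
    by (rule C_k_cong[OF assms(1) _ assms(3)[of v]]) (simp add: frechet_derivative_eqI[OF assms(2)])
  then show ?thesis using assms(2) by (auto simp: differentiable_def)
qed

lemma C_k_SucE:
  assumes "C_k (Suc k) f U" "x \<in> U"
  shows "(f has_derivative frechet_derivative f (at x)) (at x)"
  using assms by (simp add: frechet_derivative_works)

lemma C_k_const: "open U \<Longrightarrow> C_k k (\<lambda>x. c) U"
proof (induction k arbitrary: c)
  case (Suc k)
  then show ?case by (intro C_k_SucI[where f' = "\<lambda>_ _. 0"]) auto
qed auto

lemma C_k_bounded_linear: "bounded_linear f \<Longrightarrow> open U \<Longrightarrow> C_k k f U"
proof (cases k)
  case 0
  then show "bounded_linear f \<Longrightarrow> ?thesis" by (simp add: linear_continuous_on)
next
  case (Suc j)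
  assume "bounded_linear f" "open U"
  then show ?thesis unfolding Suc
    by (intro C_k_SucI[where f' = "\<lambda>_ v. f v"]) (auto intro: bounded_linear_imp_has_derivative C_k_const)
qed

lemma C_k_add: "open U \<Longrightarrow> C_k k f U \<Longrightarrow> C_k k g U \<Longrightarrow> C_k k (\<lambda>x. f x + g x) U"
proof (induction k arbitrary: f g)
  case 0
  then show ?case by (simp add: continuous_on_add)
next
  case (Suc k)
  show ?case
  proof (rule C_k_SucI)
    show "((\<lambda>x. f x + g x) has_derivative (\<lambda>v. frechet_derivative f (at x) v + frechet_derivative g (at x) v)) (at x)"
      if "x \<in> U" for x
      by (rule has_derivative_add[OF C_k_SucE[OF Suc.prems(2) that] C_k_SucE[OF Suc.prems(3) that]])
    show "C_k k (\<lambda>x. frechet_derivative f (at x) v + frechet_derivative g (at x) v) U" for v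
      using Suc.prems by (intro Suc.IH) auto
  qed (rule Suc.prems)
qed

lemma C_k_sum:
  "open U \<Longrightarrow> (\<And>i. i \<in> A \<Longrightarrow> C_k k (f i) U) \<Longrightarrow> C_k k (\<lambda>x. \<Sum>i\<in>A. f i x) U"
  by (induction A rule: infinite_finite_induct) (auto simp: C_k_const C_k_add)

lemma C_k_bilinear:
  assumes "bounded_bilinear pr" "open U"
  shows "C_k k f U \<Longrightarrow> C_k k g U \<Longrightarrow> C_k k (\<lambda>x. pr (f x) (g x)) U"
proof (induction k arbitrary: f g)
  case 0
  then show ?case using bounded_bilinear.continuous_on[OF assms(1)] by simp
next
  case (Suc k)
  let ?D = "\<lambda>f x. frechet_derivative f (at x)"
  note d = Suc.prems[THEN C_k_SucD]
  have d': "C_k k (\<lambda>x. ?D f x v) U" "C_k k (\<lambda>x. ?D g x v) U" for v using Suc.prems by auto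
  show ?case
  proof (rule C_k_SucI[where f' = "\<lambda>x v. pr (f x) (?D g x v) + pr (?D f x v) (g x)"])
    show "((\<lambda>x. pr (f x) (g x)) has_derivative (\<lambda>v. pr (f x) (?D g x v) + pr (?D f x v) (g x))) (at x)"
      if "x \<in> U" for x
      by (rule bounded_bilinear.FDERIV[OF assms(1) C_k_SucE[OF Suc.prems(1) that] C_k_SucE[OF Suc.prems(2) that]])
    show "C_k k (\<lambda>x. pr (f x) (?D g x v) + pr (?D f x v) (g x)) U" for v
      by (rule C_k_add[OF assms(2) Suc.IH[OF d(1) d'(2)] Suc.IH[OF d'(1) d(2)]])
  qed (rule assms(2))
qed

text \<open>\<open>C_k\<close> differentiates in constant directions only, while the chain rule
  differentiates \<open>f\<close> in the varying direction supplied by the derivative of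
  \<open>g\<close>. Expanding that direction in the basis leaves constant directions with varying
  coefficients.\<close>

lemma C_k_compose:
  fixes g :: "'a::euclidean_space \<Rightarrow> 'b::euclidean_space" and f :: "'b \<Rightarrow> 'c::euclidean_space"
  assumes "open U" "open V"
  shows "C_k k f V \<Longrightarrow> C_k k g U \<Longrightarrow> g ` U \<subseteq> V \<Longrightarrow> C_k k (\<lambda>x. f (g x)) U"
proof (induction k arbitrary: f)
  case 0
  then show ?case using continuous_on_compose2[of V f U g] by simp
next
  case (Suc k)
  let ?D = "\<lambda>f x. frechet_derivative f (at x)"
  show ?case
  proof (rule C_k_SucI[where f' = "\<lambda>x v. ?D f (g x) (?D g x v)"])
    fix x assume x: "x \<in> U"
    then have "g x \<in> V" using Suc.prems by auto
    then show "((\<lambda>x. f (g x)) has_derivative (\<lambda>v. ?D f (g x) (?D g x v))) (at x)"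
      by (rule has_derivative_compose[OF C_k_SucE[OF Suc.prems(2) x] C_k_SucE[OF Suc.prems(1)]])
  next
    fix v
    have lin: "linear (?D f (g x))" if "x \<in> U" for x
      using C_k_SucE[OF Suc.prems(1), of "g x"] Suc.prems that has_derivative_linear by blast
    have eq: "?D f (g x) (?D g x v) = (\<Sum>b\<in>Basis. (?D g x v \<bullet> b) *\<^sub>R ?D f (g x) b)" if "x \<in> U" for x
      by (subst (1) euclidean_representation[of "?D g x v", symmetric])
        (simp add: linear_sum[OF lin[OF that]] linear_scale[OF lin[OF that]])
    have 1: "C_k k (\<lambda>x. ?D f (g x) b) U" for b
      by (rule Suc.IH[of "\<lambda>y. ?D f y b"]) (simp_all add: C_k_SucD[OF Suc.prems(2)] Suc.prems(3) Suc.prems(1)[unfolded C_k.simps] del: C_k.simps)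
    have 2: "C_k k (\<lambda>x. ?D g x v \<bullet> b) U" for b
      by (rule C_k_bilinear[OF bounded_bilinear_inner assms(1)])
        (use Suc.prems in \<open>auto intro!: C_k_const assms\<close>)
    have "C_k k (\<lambda>x. \<Sum>b\<in>Basis. (?D g x v \<bullet> b) *\<^sub>R ?D f (g x) b) U"
      by (intro C_k_sum assms C_k_bilinear[OF bounded_bilinear_scaleR] 1 2)
    then show "C_k k (\<lambda>x. ?D f (g x) (?D g x v)) U"
      by (rule C_k_cong[OF assms(1), rotated]) (simp add: eq)
  qed (rule assms(1))
qed

text \<open>Any linear combination of sine and cosine differentiates to one of the same shape.\<close>

lemma C_k_cos_sin:
  fixes a b :: "'a::euclidean_space"
  shows "open U \<Longrightarrow> C_k k (\<lambda>t::real. cos (c * t) *\<^sub>R a + sin (c * t) *\<^sub>R b) U"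
proof (induction k arbitrary: a b)
  case 0
  then show ?case by (auto intro!: continuous_intros)
next
  case (Suc k)
  show ?case
  proof (rule C_k_SucI[where f' = "\<lambda>t v. v *\<^sub>R (cos (c * t) *\<^sub>R (c *\<^sub>R b) + sin (c * t) *\<^sub>R (- c *\<^sub>R a))"])
    show "((\<lambda>t. cos (c * t) *\<^sub>R a + sin (c * t) *\<^sub>R b) has_derivative
        (\<lambda>v. v *\<^sub>R (cos (c * t) *\<^sub>R (c *\<^sub>R b) + sin (c * t) *\<^sub>R (- c *\<^sub>R a)))) (at t)" for t
      by (auto intro!: derivative_eq_intros simp: algebra_simps)
    show "C_k k (\<lambda>t. v *\<^sub>R (cos (c * t) *\<^sub>R (c *\<^sub>R b) + sin (c * t) *\<^sub>R (- c *\<^sub>R a))) U" for v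
      by (intro C_k_bilinear[OF bounded_bilinear_scaleR] C_k_const Suc)
  qed (rule Suc.prems)
qed

definition C_inf :: "('a::euclidean_space \<Rightarrow> 'b::euclidean_space) \<Rightarrow> 'a set \<Rightarrow> bool" where
  "C_inf f U \<longleftrightarrow> (\<forall>k. C_k k f U)"

lemma C_inf_has_derivative: "C_inf f U \<Longrightarrow> x \<in> U \<Longrightarrow> (f has_derivative frechet_derivative f (at x)) (at x)"
  unfolding C_inf_def using C_k_SucE by blast

lemma C_inf_continuous_on: "C_inf f U \<Longrightarrow> continuous_on U f"
  unfolding C_inf_def using C_k.simps(1) by blast

text \<open>Needed to differentiate along tangential fields. As for compositions, the varying
  direction is expanded in the basis.\<close>

lemma C_inf_frechet_derivative:
  fixes f :: "'a::euclidean_space \<Rightarrow> 'b::euclidean_space"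
  assumes "open U" "C_inf f U" "C_inf X U"
  shows "C_inf (\<lambda>x. frechet_derivative f (at x) (X x)) U"
  unfolding C_inf_def
proof
  fix k
  let ?D = "\<lambda>x. frechet_derivative f (at x)"
  have lin: "linear (?D x)" if "x \<in> U" for x
    using C_inf_has_derivative[OF assms(2) that] has_derivative_linear by blast
  have eq: "?D x (X x) = (\<Sum>b\<in>Basis. (X x \<bullet> b) *\<^sub>R ?D x b)" if "x \<in> U" for x
    by (subst (1) euclidean_representation[of "X x", symmetric])
      (simp add: linear_sum[OF lin[OF that]] linear_scale[OF lin[OF that]])
  have "C_k (Suc k) f U" and X: "C_k k X U" using assms unfolding C_inf_def by blast+
  then have "C_k k (\<lambda>x. \<Sum>b\<in>Basis. (X x \<bullet> b) *\<^sub>R ?D x b) U"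
    by (intro C_k_sum assms C_k_bilinear[OF bounded_bilinear_scaleR]
        C_k_bilinear[OF bounded_bilinear_inner] C_k_const) auto
  then show "C_k k (\<lambda>x. ?D x (X x)) U"
    by (rule C_k_cong[OF assms(1), rotated]) (simp add: eq)
qed

subsection \<open>Smooth maps on arbitrary sets\<close>

lemma smooth_on_set_C_inf:
  "smooth_on_set S f \<longleftrightarrow> (\<exists>U g. open U \<and> S \<subseteq> U \<and> C_inf g U \<and> (\<forall>x\<in>S. g x = f x))"
  by (simp add: smooth_on_set_def C_inf_def)

lemma smooth_on_setE:
  assumes "smooth_on_set S f"
  obtains U g where "open U" "S \<subseteq> U" "C_inf g U" "\<And>x. x \<in> S \<Longrightarrow> g x = f x"
  using assms unfolding smooth_on_set_C_inf by auto

lemma smooth_on_setI: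
  "open U \<Longrightarrow> S \<subseteq> U \<Longrightarrow> C_inf g U \<Longrightarrow> (\<And>x. x \<in> S \<Longrightarrow> g x = f x) \<Longrightarrow> smooth_on_set S f"
  unfolding smooth_on_set_C_inf by blast

lemma smooth_on_set_cong: "smooth_on_set S f \<Longrightarrow> (\<And>x. x \<in> S \<Longrightarrow> f x = g x) \<Longrightarrow> smooth_on_set S g"
  unfolding smooth_on_set_def by metis

lemma smooth_on_set_continuous_on: "smooth_on_set S f \<Longrightarrow> continuous_on S f"
proof -
  assume "smooth_on_set S f"
  then obtain U g where "open U" "S \<subseteq> U" "C_inf g U" "\<And>x. x \<in> S \<Longrightarrow> g x = f x"
    by (rule smooth_on_setE) (rule that)
  then show ?thesis using continuous_on_subset[OF C_inf_continuous_on, of g U S] continuous_on_cong[of S S g f] by simp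
qed

lemma smooth_on_set_const: "smooth_on_set S (\<lambda>x. c)"
  by (rule smooth_on_setI[of UNIV]) (auto simp: C_inf_def C_k_const)

lemma smooth_on_set_bounded_linear: "bounded_linear f \<Longrightarrow> smooth_on_set S f"
  by (rule smooth_on_setI[of UNIV]) (auto simp: C_inf_def C_k_bounded_linear)

lemma smooth_on_set_id: "smooth_on_set S (\<lambda>x. x)"
  by (rule smooth_on_set_bounded_linear) (rule bounded_linear_ident)

lemma smooth_on_set_bilinear:
  assumes "bounded_bilinear pr" "smooth_on_set S f" "smooth_on_set S g"
  shows "smooth_on_set S (\<lambda>x. pr (f x) (g x))"
proof -
  obtain U f' where U: "open U" "S \<subseteq> U" "C_inf f' U" "\<And>x. x \<in> S \<Longrightarrow> f' x = f x"
    by (rule smooth_on_setE[OF assms(2)]) (rule that)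
  obtain V g' where V: "open V" "S \<subseteq> V" "C_inf g' V" "\<And>x. x \<in> S \<Longrightarrow> g' x = g x"
    by (rule smooth_on_setE[OF assms(3)]) (rule that)
  show ?thesis
  proof (rule smooth_on_setI[of "U \<inter> V" _ "\<lambda>x. pr (f' x) (g' x)"])
    show "C_inf (\<lambda>x. pr (f' x) (g' x)) (U \<inter> V)"
      unfolding C_inf_def
      by (intro allI C_k_bilinear[OF assms(1) open_Int[OF U(1) V(1)]])
        (use U(3) V(3) in \<open>auto simp: C_inf_def intro: C_k_subset\<close>)
  qed (use U V in auto)
qed

lemmas smooth_on_set_scaleR = smooth_on_set_bilinear[OF bounded_bilinear_scaleR]
lemmas smooth_on_set_inner = smooth_on_set_bilinear[OF bounded_bilinear_inner]
lemmas smooth_on_set_mult = smooth_on_set_bilinear[OF bounded_bilinear_mult]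

lemma smooth_on_set_add:
  assumes "smooth_on_set S f" "smooth_on_set S g"
  shows "smooth_on_set S (\<lambda>x. f x + g x)"
proof -
  obtain U f' where U: "open U" "S \<subseteq> U" "C_inf f' U" "\<And>x. x \<in> S \<Longrightarrow> f' x = f x"
    by (rule smooth_on_setE[OF assms(1)]) (rule that)
  obtain V g' where V: "open V" "S \<subseteq> V" "C_inf g' V" "\<And>x. x \<in> S \<Longrightarrow> g' x = g x"
    by (rule smooth_on_setE[OF assms(2)]) (rule that)
  show ?thesis
  proof (rule smooth_on_setI[of "U \<inter> V" _ "\<lambda>x. f' x + g' x"])
    show "C_inf (\<lambda>x. f' x + g' x) (U \<inter> V)"
      unfolding C_inf_def
      by (intro allI C_k_add[OF open_Int[OF U(1) V(1)]])
        (use U(3) V(3) in \<open>auto simp: C_inf_def intro: C_k_subset\<close>)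
  qed (use U V in auto)
qed

lemma smooth_on_set_minus: "smooth_on_set S f \<Longrightarrow> smooth_on_set S (\<lambda>x. - f x)"
  using smooth_on_set_scaleR[OF smooth_on_set_const, of S f "-1"] by simp

lemma smooth_on_set_diff:
  "smooth_on_set S f \<Longrightarrow> smooth_on_set S g \<Longrightarrow> smooth_on_set S (\<lambda>x. f x - g x)"
  using smooth_on_set_add[OF _ smooth_on_set_minus, of S f g] by simp

lemma smooth_on_set_sum:
  "(\<And>i. i \<in> A \<Longrightarrow> smooth_on_set S (f i)) \<Longrightarrow> smooth_on_set S (\<lambda>x. \<Sum>i\<in>A. f i x)"
  by (induction A rule: infinite_finite_induct) (auto simp: smooth_on_set_const smooth_on_set_add)

lemma smooth_on_set_compose:
  assumes "smooth_on_set T f" "smooth_on_set S g" "g ` S \<subseteq> T"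
  shows "smooth_on_set S (\<lambda>x. f (g x))"
proof -
  obtain V f' where V: "open V" "T \<subseteq> V" "C_inf f' V" "\<And>x. x \<in> T \<Longrightarrow> f' x = f x"
    by (rule smooth_on_setE[OF assms(1)]) (rule that)
  obtain U g' where U: "open U" "S \<subseteq> U" "C_inf g' U" "\<And>x. x \<in> S \<Longrightarrow> g' x = g x"
    by (rule smooth_on_setE[OF assms(2)]) (rule that)
  let ?W = "U \<inter> g' -` V"
  have op: "open ?W"
    using continuous_open_preimage[OF C_inf_continuous_on[OF U(3)] U(1) V(1)] by simp
  show ?thesis
  proof (rule smooth_on_setI[OF op, of _ "\<lambda>x. f' (g' x)"])
    show "C_inf (\<lambda>x. f' (g' x)) ?W"
      unfolding C_inf_def
    proof
      fix k
      show "C_k k (\<lambda>x. f' (g' x)) ?W"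
        by (rule C_k_compose[OF op V(1)]) (use U(3) V(3) in \<open>auto simp: C_inf_def intro: C_k_subset\<close>)
    qed
  qed (use U V assms(3) in \<open>auto simp: image_subset_iff subset_iff\<close>)
qed

lemma smooth_on_set_linear_image:
  "bounded_linear h \<Longrightarrow> smooth_on_set S f \<Longrightarrow> smooth_on_set S (\<lambda>x. h (f x))"
  by (rule smooth_on_set_compose[OF smooth_on_set_bounded_linear[of h UNIV]]) auto

lemma smooth_on_set_Pair:
  assumes "smooth_on_set S f" "smooth_on_set S g"
  shows "smooth_on_set S (\<lambda>x. (f x, g x))"
proof -
  have "smooth_on_set S (\<lambda>x. (f x, 0) + (0, g x))"
    by (intro smooth_on_set_add smooth_on_set_linear_image[OF _ assms(1)] smooth_on_set_linear_image[OF _ assms(2)]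
        bounded_linear_Pair bounded_linear_ident bounded_linear_zero)
  then show ?thesis by simp
qed

lemmas smooth_on_set_fst = smooth_on_set_linear_image[OF bounded_linear_fst]
  and smooth_on_set_snd = smooth_on_set_linear_image[OF bounded_linear_snd]

lemma smooth_on_set_cos_sin:
  "smooth_on_set S (\<lambda>t::real. cos (c * t) *\<^sub>R a + sin (c * t) *\<^sub>R (b::'a::euclidean_space))"
  by (rule smooth_on_setI[of UNIV]) (auto simp: C_inf_def C_k_cos_sin)

section \<open>Alternating multilinear functions of lists\<close>

text \<open>One function on lists of every length treats all degrees at once, as
  \<open>smooth_forms\<close> does. Alternation is stated as vanishing on repeated entries; the sign
  rule follows by polarization.\<close>

definition altform :: "('e::real_vector list \<Rightarrow> 'f::real_vector) \<Rightarrow> bool" where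
  "altform f \<longleftrightarrow>
     (\<forall>us ws u v a b. f (us @ (a *\<^sub>R u + b *\<^sub>R v) # ws) = a *\<^sub>R f (us @ u # ws) + b *\<^sub>R f (us @ v # ws)) \<and>
     (\<forall>vs. \<not> distinct vs \<longrightarrow> f vs = 0)"

lemma altform_not_distinct: "altform f \<Longrightarrow> \<not> distinct vs \<Longrightarrow> f vs = 0"
  unfolding altform_def by blast

lemma altform_combination:
  "altform f \<Longrightarrow> f (us @ (a *\<^sub>R u + b *\<^sub>R v) # ws) = a *\<^sub>R f (us @ u # ws) + b *\<^sub>R f (us @ v # ws)"
  unfolding altform_def by blast

lemma altform_linear: "altform f \<Longrightarrow> linear (\<lambda>v. f (us @ v # ws))"
  using altform_combination[of f us 1 _ 1 _ ws] altform_combination[of f us _ _ 0 _ ws]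
  by (intro linearI) auto

lemma altform_linear_hd: "altform f \<Longrightarrow> linear (\<lambda>v. f (v # ws))"
  using altform_linear[of f "[]"] by simp

lemma altform_zero: "altform f \<Longrightarrow> f (us @ 0 # ws) = 0"
  using linear_0[OF altform_linear] by fastforce

lemma altform_Cons: "altform f \<Longrightarrow> altform (\<lambda>vs. f (v # vs))"
  unfolding altform_def by (metis append_Cons distinct.simps(2))

text \<open>Polarization: the value with the repeated entry \<open>a + b\<close> is zero and is
  expanded in both slots.\<close>

lemma altform_swap:
  assumes "altform f"
  shows "f (us @ a # b # ws) = - f (us @ b # a # ws)"
proof -
  have l: "f (us @ (a + b) # c # ws) = f (us @ a # c # ws) + f (us @ b # c # ws)" for c
    using altform_combination[OF assms, of us 1 a 1 b] by simp
  have r: "f (us @ c # (a + b) # ws) = f (us @ c # a # ws) + f (us @ c # b # ws)" for c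
    using altform_combination[OF assms, of "us @ [c]" 1 a 1 b] by simp
  have z: "f (us @ c # c # ws) = 0" for c
    using altform_not_distinct[OF assms] by simp
  have "f (us @ a # b # ws) + f (us @ b # a # ws) = 0"
    using l[of "a + b"] r[of a] r[of b] z[of a] z[of b] z[of "a + b"] by simp
  then show ?thesis by (simp add: eq_neg_iff_add_eq_0)
qed

lemma altform_basis_zero:
  fixes f :: "'e::euclidean_space list \<Rightarrow> 'f::real_vector"
  assumes "altform f" "\<And>bs. set bs \<subseteq> Basis \<Longrightarrow> f bs = 0"
  shows "f vs = 0"
proof -
  \<comment> \<open>The prefix \<open>us\<close> collects the arguments that have already been
    replaced by basis vectors.\<close>
  have "set us \<subseteq> Basis \<Longrightarrow> f (us @ vs) = 0" for us
  proof (induction vs arbitrary: us)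
    case Nil
    then show ?case using assms(2) by simp
  next
    case (Cons v vs)
    have "f (us @ v # vs) = f (us @ (\<Sum>b\<in>Basis. (v \<bullet> b) *\<^sub>R b) # vs)"
      by (simp add: euclidean_representation)
    also have "\<dots> = (\<Sum>b\<in>Basis. (v \<bullet> b) *\<^sub>R f (us @ b # vs))"
      by (simp add: linear_sum[OF altform_linear[OF assms(1)]] linear_scale[OF altform_linear[OF assms(1)]])
    also have "\<dots> = 0"
      using Cons.IH[of "us @ [_]"] Cons.prems by (intro sum.neutral) auto
    finally show ?case .
  qed
  from this[of "[]"] show ?thesis by simp
qed

lemma altform_0: "altform (\<lambda>vs. 0)" by (simp add: altform_def)

lemma altform_add: "altform f \<Longrightarrow> altform g \<Longrightarrow> altform (\<lambda>vs. f vs + g vs)"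
  unfolding altform_def by (auto simp: algebra_simps)

lemma altform_linear_image:
  assumes "linear h" "altform f" shows "altform (\<lambda>vs. h (f vs))"
  using assms(2) unfolding altform_def
  by (auto simp: linear_add[OF assms(1)] linear_scale[OF assms(1)] linear_0[OF assms(1)])

lemma altform_minus: "altform f \<Longrightarrow> altform (\<lambda>vs. - f vs)"
  by (rule altform_linear_image[of uminus]) (simp_all add: linear_iff)

lemma altform_sum: "(\<And>i. i \<in> A \<Longrightarrow> altform (f i)) \<Longrightarrow> altform (\<lambda>vs. \<Sum>i\<in>A. f i vs)"
  by (induction A rule: infinite_finite_induct) (auto intro: altform_0 altform_add)

lemma altform_map:
  assumes "linear P" "altform f" shows "altform (\<lambda>vs. f (map P vs))"
  using assms(2) unfolding altform_def
  by (auto simp: linear_add[OF assms(1)] linear_scale[OF assms(1)] distinct_map)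

subsection \<open>Alternating sums over omitted entries\<close>

text \<open>The alternating sum in the exterior derivative, over all ways of pulling one entry out
  of a list. Every omission behind the head keeps the head and has its position raised by one, hence
  the minus sign.\<close>

primrec asum :: "'e list \<Rightarrow> ('e \<Rightarrow> 'e list \<Rightarrow> 'f::real_vector) \<Rightarrow> 'f" where
  "asum [] G = 0"
| "asum (v # vs) G = G v vs - asum vs (\<lambda>u ws. G u (v # ws))"

lemma asum_eq_sum:
  "asum vs G = (\<Sum>i<length vs. (-1) ^ i *\<^sub>R G (vs ! i) (take i vs @ drop (Suc i) vs))"
proof (induction vs arbitrary: G)
  case (Cons v vs)
  show ?case
    unfolding length_Cons sum.lessThan_Suc_shift asum.simps Cons.IH
    by (simp add: sum_negf)
qed simp

lemma asum_cong:
  "(\<And>u ws. set (u # ws) \<subseteq> set vs \<Longrightarrow> G u ws = H u ws) \<Longrightarrow> asum vs G = asum vs H"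
proof (induction vs arbitrary: G H)
  case (Cons v vs)
  have "G v vs = H v vs" by (rule Cons.prems) auto
  moreover have "asum vs (\<lambda>u ws. G u (v # ws)) = asum vs (\<lambda>u ws. H u (v # ws))"
    by (rule Cons.IH) (rule Cons.prems, auto)
  ultimately show ?case by simp
qed simp

lemma asum_combination:
  "asum vs (\<lambda>u ws. a *\<^sub>R G u ws + b *\<^sub>R H u ws) = a *\<^sub>R asum vs G + b *\<^sub>R asum vs H"
  by (induction vs arbitrary: G H) (auto simp: algebra_simps)

lemma asum_map: "asum (map P vs) G = asum vs (\<lambda>u ws. G (P u) (map P ws))"
  by (induction vs arbitrary: G) auto

lemma asum_single:
  "(\<And>u zs. v \<in> set zs \<Longrightarrow> G u zs = 0) \<Longrightarrow> asum (us @ v # ws) G = (-1) ^ length us *\<^sub>R G v (us @ ws)"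
proof (induction us arbitrary: G)
  case Nil
  have "asum ws (\<lambda>u zs. G u (v # zs)) = asum ws (\<lambda>u zs. 0)"
    using Nil by (intro asum_cong) auto
  also have "\<dots> = 0" by (induction ws) auto
  finally show ?case by simp
next
  case (Cons u us)
  then show ?case by simp
qed

lemma altform_move:
  assumes "altform f" shows "f (us @ v # ws) = (-1) ^ length us *\<^sub>R f (v # us @ ws)"
proof -
  have "f (zs @ us @ v # ws) = (-1) ^ length us *\<^sub>R f (zs @ v # us @ ws)" for zs
  proof (induction us arbitrary: zs)
    case (Cons u us)
    have "f (zs @ (u # us) @ v # ws) = (-1) ^ length us *\<^sub>R f (zs @ u # v # us @ ws)"
      using Cons.IH[of "zs @ [u]"] by simp
    then show ?case using altform_swap[OF assms, of zs u v] by simp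
  qed simp
  from this[of "[]"] show ?thesis by simp
qed

text \<open>If an entry \<open>v\<close> is repeated, only the omission of one of its two copies can
  give a nonzero term. The remaining list of one term differs from that of the other by moving
  \<open>v\<close> past the entries in between, and the two terms cancel.\<close>

lemma altform_asum:
  assumes "\<And>u. altform (G u)" "\<And>ws. linear (\<lambda>u. G u ws)"
  shows "altform (\<lambda>vs. asum vs G)"
proof -
  have 1: "asum (us @ (a *\<^sub>R u + b *\<^sub>R v) # ws) G = a *\<^sub>R asum (us @ u # ws) G + b *\<^sub>R asum (us @ v # ws) G"
    for us ws u v a b
    using assms
  proof (induction us arbitrary: G)
    case Nil
    have "asum ws (\<lambda>z zs. G z ((a *\<^sub>R u + b *\<^sub>R v) # zs)) =
        a *\<^sub>R asum ws (\<lambda>z zs. G z (u # zs)) + b *\<^sub>R asum ws (\<lambda>z zs. G z (v # zs))"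
      using altform_combination[OF Nil(1), of _ "[]" a u b v]
      by (simp flip: asum_combination)
    then show ?case
      by (simp add: linear_add[OF Nil(2)] linear_scale[OF Nil(2)] algebra_simps)
  next
    case (Cons w us)
    have "asum (us @ (a *\<^sub>R u + b *\<^sub>R v) # ws) (\<lambda>z zs. G z (w # zs)) =
       a *\<^sub>R asum (us @ u # ws) (\<lambda>z zs. G z (w # zs)) + b *\<^sub>R asum (us @ v # ws) (\<lambda>z zs. G z (w # zs))"
      by (rule Cons.IH) (simp_all add: Cons.prems altform_Cons)
    then show ?case using altform_combination[OF Cons.prems(1)[of w]] by (simp add: algebra_simps)
  qed
  have 2: "asum vs G = 0" if "\<not> distinct vs" for vs
    using assms that
  proof (induction vs arbitrary: G)
    case (Cons v vs)
    show ?case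
    proof (cases "distinct vs")
      case False
      have "asum vs (\<lambda>z zs. G z (v # zs)) = 0"
        by (rule Cons.IH) (simp_all add: Cons.prems altform_Cons False)
      then show ?thesis using altform_not_distinct[OF Cons.prems(1) False] by simp
    next
      case True
      then obtain us ws where vs: "vs = us @ v # ws"
        using Cons.prems(3) by (auto dest: split_list)
      have "asum (us @ v # ws) (\<lambda>z zs. G z (v # zs)) = (-1) ^ length us *\<^sub>R G v (v # us @ ws)"
        by (rule asum_single) (simp add: altform_not_distinct[OF Cons.prems(1)])
      also have "\<dots> = G v vs" unfolding vs using altform_move[OF Cons.prems(1)] by simp
      finally show ?thesis by (simp add: vs)
    qed
  qed simp
  show ?thesis unfolding altform_def using 1 2 by blast
qed

section \<open>The inner product of forms\<close>

definition tuples :: "nat \<Rightarrow> 'e set \<Rightarrow> 'e list set" where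
  "tuples k B = {vs. set vs \<subseteq> B \<and> length vs = k}"

lemma tuples_0 [simp]: "tuples 0 B = {[]}"
  by (auto simp: tuples_def)

lemma finite_tuples: "finite B \<Longrightarrow> finite (tuples k B)"
  unfolding tuples_def by (rule finite_lists_length_eq)

lemma sum_tuples_Suc:
  "(\<Sum>vs\<in>tuples (Suc k) B. F vs) = (\<Sum>b\<in>B. \<Sum>bs\<in>tuples k B. F (b # bs))"
proof -
  have "tuples (Suc k) B = (\<lambda>(b, bs). b # bs) ` (B \<times> tuples k B)"
    by (auto simp: tuples_def length_Suc_conv image_iff)
  moreover have "inj_on (\<lambda>(b, bs). b # bs) (B \<times> tuples k B)" by (auto simp: inj_on_def)
  ultimately show ?thesis
    by (simp add: sum.reindex sum.cartesian_product case_prod_unfold)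
qed

lemma tuples_Basis_not_distinct:
  assumes "vs \<in> tuples k (Basis :: 'e::euclidean_space set)" "k > DIM('e)"
  shows "\<not> distinct vs"
  using assms card_mono[of Basis "set vs"] distinct_card[of vs] by (auto simp: tuples_def)

text \<open>On alternating forms each increasing multi-index occurs k! times among all tuples, so
  this is the usual inner product of forms. It runs over the fixed ambient basis, so that no
  orthonormal frame has to be differentiated.\<close>

definition form_ip :: "('e::euclidean_space list \<Rightarrow> 'f::real_inner) \<Rightarrow> ('e list \<Rightarrow> 'f) \<Rightarrow> real" where
  "form_ip f g = (\<Sum>k\<le>DIM('e). (\<Sum>bs\<in>tuples k Basis. f bs \<bullet> g bs) / fact k)"

text \<open>Bringing the omitted entry to the front of \<open>g\<close> produces exactly the sign
  carried by the alternating sum, so all \<open>Suc k\<close> omissions contribute equally.\<close>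

lemma sum_asum_tuples:
  fixes G :: "'e::real_vector \<Rightarrow> 'e list \<Rightarrow> 'f::real_inner"
  assumes "altform g"
  shows "(\<Sum>bs\<in>tuples (Suc k) B. asum bs G \<bullet> g bs) =
    real (Suc k) * (\<Sum>b\<in>B. \<Sum>bs\<in>tuples k B. G b bs \<bullet> g (b # bs))"
  using assms
proof (induction k arbitrary: G g)
  case 0
  then show ?case by (simp add: sum_tuples_Suc)
next
  case (Suc k)
  have sw: "g (b # c # cs) = - g (c # b # cs)" for b c cs
    using altform_swap[OF Suc.prems, of "[]" b c cs] by simp
  have "(\<Sum>bs\<in>tuples (Suc k) B. asum bs (\<lambda>u ws. G u (b # ws)) \<bullet> g (b # bs)) =
      - (real (Suc k) * (\<Sum>c\<in>B. \<Sum>cs\<in>tuples k B. G c (b # cs) \<bullet> g (c # b # cs)))" for b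
  proof -
    have "(\<Sum>c\<in>B. \<Sum>cs\<in>tuples k B. G c (b # cs) \<bullet> g (b # c # cs)) =
        (\<Sum>c\<in>B. \<Sum>cs\<in>tuples k B. - (G c (b # cs) \<bullet> g (c # b # cs)))"
      by (intro sum.cong refl) (simp only: sw[of b] inner_minus_right)
    then show ?thesis
      unfolding Suc.IH[OF altform_Cons[OF Suc.prems]] by (simp only: sum_negf mult_minus_right)
  qed
  then have "(\<Sum>bs\<in>tuples (Suc (Suc k)) B. asum bs G \<bullet> g bs) =
     (\<Sum>b\<in>B. \<Sum>bs\<in>tuples (Suc k) B. G b bs \<bullet> g (b # bs)) +
     real (Suc k) * (\<Sum>b\<in>B. \<Sum>c\<in>B. \<Sum>cs\<in>tuples k B. G c (b # cs) \<bullet> g (c # b # cs))"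
    unfolding sum_tuples_Suc[where k = "Suc k"] asum.simps inner_diff_left sum_subtractf
    by (simp add: sum_negf sum_distrib_left)
  also have "(\<Sum>b\<in>B. \<Sum>c\<in>B. \<Sum>cs\<in>tuples k B. G c (b # cs) \<bullet> g (c # b # cs)) =
      (\<Sum>b\<in>B. \<Sum>bs\<in>tuples (Suc k) B. G b bs \<bullet> g (b # bs))"
    by (subst sum.swap) (simp add: sum_tuples_Suc)
  finally show ?case by (simp add: algebra_simps)
qed

text \<open>The factor \<open>Suc k\<close> lowers the factorial by one degree. Letting the degree
  on the right run up to the full dimension adds only a zero term, because a tuple of basis vectors
  longer than the dimension repeats an entry.\<close>

lemma form_ip_asum:
  fixes g :: "'e::euclidean_space list \<Rightarrow> 'f::real_inner"
  assumes "altform g"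
  shows "form_ip (\<lambda>vs. asum vs G) g =
    (\<Sum>k\<le>DIM('e). (\<Sum>b\<in>Basis. \<Sum>bs\<in>tuples k Basis. G b bs \<bullet> g (b # bs)) / fact k)"
proof -
  let ?s = "\<lambda>k. (\<Sum>b\<in>Basis. \<Sum>bs\<in>tuples k Basis. G b bs \<bullet> g (b # bs)) / fact k"
  obtain n where n: "DIM('e) = Suc n" using DIM_positive[where 'a='e] by (cases "DIM('e)") auto
  have "form_ip (\<lambda>vs. asum vs G) g = (\<Sum>k\<le>n. ?s k)"
    unfolding form_ip_def n sum.atMost_Suc_shift sum_asum_tuples[OF assms] by simp
  moreover have "?s (Suc n) = 0"
  proof -
    have "g (b # bs) = 0" if "b \<in> Basis" "bs \<in> tuples (Suc n) Basis" for b bs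
      using tuples_Basis_not_distinct[of "b # bs" "Suc (Suc n)"] that n
      by (intro altform_not_distinct[OF assms]) (auto simp: tuples_def)
    then show ?thesis by simp
  qed
  ultimately show ?thesis by (simp add: n)
qed

text \<open>Both sides are the trace of \<open>\<beta>\<close> against the matrix of
  \<open>P\<close>, which is symmetric by the last assumption.\<close>

lemma sum_Basis_transfer_bilinear:
  fixes \<beta> :: "'e::euclidean_space \<Rightarrow> 'e \<Rightarrow> 'f::real_vector"
  assumes "\<And>v. linear (\<lambda>u. \<beta> u v)" "\<And>u. linear (\<beta> u)" "\<And>x y. P x \<bullet> y = x \<bullet> P y"
  shows "(\<Sum>b\<in>Basis. \<beta> (P b) b) = (\<Sum>b\<in>Basis. \<beta> b (P b))"
proof -
  have "\<beta> (P b) v = (\<Sum>c\<in>Basis. (P b \<bullet> c) *\<^sub>R \<beta> c v)" for b v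
    by (subst euclidean_representation[of "P b", symmetric])
      (simp only: linear_sum[OF assms(1)] linear_scale[OF assms(1)])
  then have "(\<Sum>b\<in>Basis. \<beta> (P b) b) = (\<Sum>b\<in>Basis. \<Sum>c\<in>Basis. (P b \<bullet> c) *\<^sub>R \<beta> c b)" by simp
  also have "\<dots> = (\<Sum>b\<in>Basis. \<Sum>c\<in>Basis. (P b \<bullet> c) *\<^sub>R \<beta> b c)"
    by (subst sum.swap, intro sum.cong refl) (metis assms(3) inner_commute)
  also have "\<dots> = (\<Sum>b\<in>Basis. \<beta> b (P b))"
  proof (intro sum.cong refl)
    fix b :: 'e
    show "(\<Sum>c\<in>Basis. (P b \<bullet> c) *\<^sub>R \<beta> b c) = \<beta> b (P b)"
      by (subst (2) euclidean_representation[of "P b", symmetric])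
        (simp only: linear_sum[OF assms(2)] linear_scale[OF assms(2)])
  qed
  finally show ?thesis .
qed

lemma sum_Basis_transfer:
  fixes F G :: "'e::euclidean_space \<Rightarrow> 'f::real_inner"
  assumes "linear F" "linear G" "\<And>x y. P x \<bullet> y = x \<bullet> P y"
  shows "(\<Sum>b\<in>Basis. F (P b) \<bullet> G b) = (\<Sum>b\<in>Basis. F b \<bullet> G (P b))"
proof (rule sum_Basis_transfer_bilinear[OF _ _ assms(3)])
  show "linear (\<lambda>u. F u \<bullet> G v)" for v
    by (rule linearI) (simp_all add: linear_add[OF assms(1)] linear_scale[OF assms(1)] inner_add_left)
  show "linear (\<lambda>v. F u \<bullet> G v)" for u
    by (rule linearI) (simp_all add: linear_add[OF assms(2)] linear_scale[OF assms(2)] inner_add_right)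
qed

text \<open>Moves a projection from the arguments of one form to those of the other, where it is
  absorbed if that form is already tangential.\<close>

lemma sum_tuples_transfer:
  fixes f g :: "'e::euclidean_space list \<Rightarrow> 'f::real_inner"
  assumes "altform f" "altform g" "\<And>x y. P x \<bullet> y = x \<bullet> P y"
  shows "(\<Sum>bs\<in>tuples k Basis. f (map P bs) \<bullet> g bs) = (\<Sum>bs\<in>tuples k Basis. f bs \<bullet> g (map P bs))"
  using assms(1,2)
proof (induction k arbitrary: f g)
  case (Suc k)
  have "(\<Sum>bs\<in>tuples (Suc k) Basis. f (map P bs) \<bullet> g bs) =
      (\<Sum>b\<in>Basis. \<Sum>bs\<in>tuples k Basis. f (P b # bs) \<bullet> g (b # map P bs))"
    using Suc.IH[OF altform_Cons[OF Suc.prems(1)] altform_Cons[OF Suc.prems(2)]]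
    by (simp add: sum_tuples_Suc)
  also have "\<dots> = (\<Sum>bs\<in>tuples k Basis. \<Sum>b\<in>Basis. f (P b # bs) \<bullet> g (b # map P bs))"
    by (rule sum.swap)
  also have "\<dots> = (\<Sum>bs\<in>tuples k Basis. \<Sum>b\<in>Basis. f (b # bs) \<bullet> g (P b # map P bs))"
    by (intro sum.cong sum_Basis_transfer altform_linear_hd Suc.prems assms(3)) simp
  also have "\<dots> = (\<Sum>b\<in>Basis. \<Sum>bs\<in>tuples k Basis. f (b # bs) \<bullet> g (P b # map P bs))"
    by (rule sum.swap)
  finally show ?case by (simp add: sum_tuples_Suc)
qed simp

text \<open>\<open>P\<close> is the orthogonal projection onto the span of \<open>E\<close>. This
  trades an orthonormal frame, known only through a choice at each point, for the ambient
  basis.\<close>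

lemma sum_orthonormal_Basis:
  fixes F G :: "'e::euclidean_space \<Rightarrow> 'f::real_inner"
  assumes "linear F" "linear G" "finite E" "pairwise orthogonal E" "\<And>e. e \<in> E \<Longrightarrow> norm e = 1"
    and P: "\<And>b. P b = (\<Sum>e\<in>E. (b \<bullet> e) *\<^sub>R e)"
  shows "(\<Sum>e\<in>E. F e \<bullet> G e) = (\<Sum>b\<in>Basis. F (P b) \<bullet> G (P b))"
proof -
  have on: "e \<bullet> e' = (if e = e' then 1 else 0)" if "e \<in> E" "e' \<in> E" for e e'
    using assms(4,5) that by (auto simp: pairwise_def orthogonal_def dot_square_norm)
  have key: "(\<Sum>b\<in>Basis. (e \<bullet> b) * (e' \<bullet> b) * c) = (e \<bullet> e') * c" for e e' :: 'e and c
    unfolding euclidean_inner[of e e'] sum_distrib_right ..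
  have "F (P b) \<bullet> G (P b) = (\<Sum>e\<in>E. \<Sum>e'\<in>E. (e \<bullet> b) * (e' \<bullet> b) * (F e \<bullet> G e'))" for b
    by (simp add: P linear_sum[OF assms(1)] linear_scale[OF assms(1)] linear_sum[OF assms(2)]
        linear_scale[OF assms(2)] inner_sum_left inner_sum_right sum_distrib_left inner_commute[of b] mult_ac)
      (subst sum.swap, simp add: mult_ac)
  then have "(\<Sum>b\<in>Basis. F (P b) \<bullet> G (P b)) =
      (\<Sum>e\<in>E. \<Sum>e'\<in>E. \<Sum>b\<in>Basis. (e \<bullet> b) * (e' \<bullet> b) * (F e \<bullet> G e'))"
    by (simp add: sum.swap[of _ _ Basis])
  also have "\<dots> = (\<Sum>e\<in>E. \<Sum>e'\<in>E. (e \<bullet> e') * (F e \<bullet> G e'))"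
    by (simp only: key)
  also have "\<dots> = (\<Sum>e\<in>E. \<Sum>e'\<in>E. if e = e' then F e \<bullet> G e' else 0)"
    by (intro sum.cong) (auto simp: on)
  also have "\<dots> = (\<Sum>e\<in>E. F e \<bullet> G e)" by (simp add: assms(3))
  finally show ?thesis by simp
qed

lemma sum_tuples_orthonormal_Basis:
  fixes f g :: "'e::euclidean_space list \<Rightarrow> 'f::real_inner"
  assumes "altform f" "altform g" "finite E" "pairwise orthogonal E" "\<And>e. e \<in> E \<Longrightarrow> norm e = 1"
    and P: "\<And>b. P b = (\<Sum>e\<in>E. (b \<bullet> e) *\<^sub>R e)"
  shows "(\<Sum>vs\<in>tuples k E. f vs \<bullet> g vs) = (\<Sum>bs\<in>tuples k Basis. f (map P bs) \<bullet> g (map P bs))"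
  using assms(1,2)
proof (induction k arbitrary: f g)
  case (Suc k)
  have "(\<Sum>bs\<in>tuples (Suc k) E. f bs \<bullet> g bs) =
      (\<Sum>e\<in>E. \<Sum>bs\<in>tuples k Basis. f (e # map P bs) \<bullet> g (e # map P bs))"
    using Suc.IH[OF altform_Cons[OF Suc.prems(1)] altform_Cons[OF Suc.prems(2)]]
    by (simp add: sum_tuples_Suc)
  also have "\<dots> = (\<Sum>bs\<in>tuples k Basis. \<Sum>e\<in>E. f (e # map P bs) \<bullet> g (e # map P bs))"
    by (rule sum.swap)
  also have "\<dots> = (\<Sum>bs\<in>tuples k Basis. \<Sum>b\<in>Basis. f (P b # map P bs) \<bullet> g (P b # map P bs))"
    by (intro sum.cong sum_orthonormal_Basis altform_linear_hd Suc.prems assms(3-6)) auto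
  also have "\<dots> = (\<Sum>b\<in>Basis. \<Sum>bs\<in>tuples k Basis. f (P b # map P bs) \<bullet> g (P b # map P bs))"
    by (rule sum.swap)
  finally show ?case by (simp add: sum_tuples_Suc)
qed simp

text \<open>Adjacent transpositions generate all permutations; the prefix \<open>us\<close> is the
  part already matched.\<close>

lemma swap_invariant_mset:
  assumes sw: "\<And>us a b ws. F (us @ a # b # ws) = F (us @ b # a # ws)" and "mset vs = mset ws"
  shows "F (us @ vs) = F (us @ ws)"
  using assms(2)
proof (induction vs arbitrary: us ws)
  case (Cons a vs)
  have mv: "F (zs @ xs @ a # ys) = F (zs @ a # xs @ ys)" for zs xs ys
  proof (induction xs arbitrary: zs)
    case (Cons x xs)
    show ?case using Cons.IH[of "zs @ [x]"] sw[of zs x a] by simp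
  qed simp
  obtain xs ys where ws: "ws = xs @ a # ys"
    using Cons.prems by (metis list.set_intros(1) mset_eq_setD split_list)
  then have "mset vs = mset (xs @ ys)" using Cons.prems by simp
  from Cons.IH[OF this, of "us @ [a]"] show ?case by (simp add: ws mv)
qed simp

text \<open>Tuples are grouped by their set of entries. A set of size k has k! distinct listings,
  all with the same value of \<open>F\<close>, and tuples with repetitions contribute
  nothing.\<close>

lemma sum_subseqs_tuples:
  fixes F :: "'e list \<Rightarrow> real"
  assumes sw: "\<And>us a b ws. F (us @ a # b # ws) = F (us @ b # a # ws)"
    and nd: "\<And>vs. \<not> distinct vs \<Longrightarrow> F vs = 0"
    and es: "distinct es" "length es \<le> K"
  shows "(\<Sum>vs\<leftarrow>subseqs es. F vs) = (\<Sum>k\<le>K. (\<Sum>vs\<in>tuples k (set es). F vs) / fact k)"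
proof -
  let ?E = "set es"
  \<comment> \<open>On distinct lists \<open>F\<close> depends only on the set of entries, so any
    chosen listing turns it into a function of sets.\<close>
  define h where "h A = F (SOME vs. set vs = A \<and> distinct vs)" for A
  have h: "F vs = h (set vs)" if "distinct vs" for vs
  proof -
    have "\<exists>ws. set ws = set vs \<and> distinct ws" using that by blast
    from someI_ex[OF this] have "mset vs = mset (SOME ws. set ws = set vs \<and> distinct ws)"
      using that set_eq_iff_mset_eq_distinct by metis
    from swap_invariant_mset[of F, OF sw this, of "[]"] show ?thesis by (simp add: h_def)
  qed
  have dm: "distinct (map set (subseqs es))" by (rule distinct_set_subseqs[OF es(1)])
  then have ds: "distinct (subseqs es)" and inj: "inj_on set (set (subseqs es))"
    by (auto simp: distinct_map)
  have "(\<Sum>vs\<leftarrow>subseqs es. F vs) = (\<Sum>vs\<in>set (subseqs es). F vs)"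
    by (rule sum_list_distinct_conv_sum_set[OF ds])
  also have "\<dots> = (\<Sum>vs\<in>set (subseqs es). h (set vs))"
    using subseqs_distinctD[OF _ es(1)] by (intro sum.cong h) auto
  also have "\<dots> = (\<Sum>A\<in>set ` set (subseqs es). h A)"
    by (simp add: sum.reindex[OF inj])
  also have "\<dots> = (\<Sum>A\<in>Pow ?E. h A)" by (simp add: subseqs_powset)
  also have "\<dots> = (\<Sum>k\<le>K. \<Sum>A\<in>{A \<in> Pow ?E. card A = k}. h A)"
  proof (rule sum.group[symmetric])
    have "card A \<le> K" if "A \<subseteq> ?E" for A
      using card_mono[OF finite_set that] es(2) distinct_card[OF es(1)] by linarith
    then show "card ` Pow ?E \<subseteq> {..K}" by blast
  qed simp_all
  also have "\<dots> = (\<Sum>k\<le>K. (\<Sum>vs\<in>tuples k ?E. F vs) / fact k)"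
  proof (intro sum.cong refl)
    fix k
    let ?D = "{vs \<in> tuples k ?E. distinct vs}" and ?C = "{A \<in> Pow ?E. card A = k}"
    have fin: "finite (tuples k ?E)" by (simp add: finite_tuples)
    have "(\<Sum>vs\<in>tuples k ?E. F vs) = (\<Sum>vs\<in>?D. F vs)"
      by (rule sum.mono_neutral_right) (use fin nd in auto)
    also have "\<dots> = (\<Sum>A\<in>?C. \<Sum>vs\<in>{vs \<in> ?D. set vs = A}. F vs)"
    proof (rule sum.group[symmetric])
      show "finite ?D" using fin by simp
      show "set ` ?D \<subseteq> ?C" by (auto simp: tuples_def distinct_card)
    qed simp
    also have "\<dots> = (\<Sum>A\<in>?C. fact k * h A)"
    proof (intro sum.cong refl)
      fix A assume A: "A \<in> ?C"
      then have "{vs \<in> ?D. set vs = A} = permutations_of_set A"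
        by (auto simp: tuples_def permutations_of_set_def distinct_card)
      moreover have "card (permutations_of_set A) = fact k"
        using A finite_subset[of A ?E] by (simp add: card_permutations_of_set)
      moreover have "F vs = h A" if "vs \<in> permutations_of_set A" for vs
        using that h by (auto simp: permutations_of_set_def)
      ultimately show "(\<Sum>vs\<in>{vs \<in> ?D. set vs = A}. F vs) = fact k * h A" by simp
    qed
    finally show "(\<Sum>A\<in>?C. h A) = (\<Sum>vs\<in>tuples k ?E. F vs) / fact k"
      by (simp flip: sum_distrib_left)
  qed
  finally show ?thesis .
qed

lemma form_ip_orthonormal:
  fixes f g :: "'e::euclidean_space list \<Rightarrow> 'f::real_inner"
  assumes "altform f" "altform g" "distinct es" "pairwise orthogonal (set es)" "\<And>e. e \<in> set es \<Longrightarrow> norm e = 1"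
    and P: "\<And>b. P b = (\<Sum>e\<in>set es. (b \<bullet> e) *\<^sub>R e)"
  shows "(\<Sum>vs\<leftarrow>subseqs es. f vs \<bullet> g vs) = form_ip (\<lambda>vs. f (map P vs)) (\<lambda>vs. g (map P vs))"
proof -
  have "0 \<notin> set es" using assms(5) by fastforce
  then have "independent (set es)" using pairwise_orthogonal_independent assms(4) by blast
  then have "length es \<le> DIM('e)" using assms(3) by (metis distinct_card independent_bound)
  then have "(\<Sum>vs\<leftarrow>subseqs es. f vs \<bullet> g vs) =
      (\<Sum>k\<le>DIM('e). (\<Sum>vs\<in>tuples k (set es). f vs \<bullet> g vs) / fact k)"
  proof (intro sum_subseqs_tuples assms(3))
    show "f (us @ a # b # ws) \<bullet> g (us @ a # b # ws) = f (us @ b # a # ws) \<bullet> g (us @ b # a # ws)" for us a b ws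
      using altform_swap[OF assms(1), of us a b ws] altform_swap[OF assms(2), of us a b ws] by simp
  qed (simp_all add: altform_not_distinct[OF assms(1)])
  then show ?thesis
    unfolding form_ip_def
    by (simp add: sum_tuples_orthonormal_Basis[OF assms(1,2) finite_set assms(4,5) P])
qed

lemma form_ip_commute: "form_ip f g = form_ip g f"
  by (simp add: form_ip_def inner_commute)

lemma form_ip_add_left: "form_ip (\<lambda>vs. f vs + g vs) h = form_ip f h + form_ip g h"
  by (simp add: form_ip_def inner_add_left sum.distrib add_divide_distrib)

lemma form_ip_scaleR_left: "form_ip (\<lambda>vs. c *\<^sub>R f vs) h = c * form_ip f h"
  by (simp add: form_ip_def sum_distrib_left)

lemma form_ip_diff_left: "form_ip (\<lambda>vs. f vs - g vs) h = form_ip f h - form_ip g h"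
  by (simp add: form_ip_def inner_diff_left sum_subtractf diff_divide_distrib)

lemma form_ip_add_right: "form_ip h (\<lambda>vs. f vs + g vs) = form_ip h f + form_ip h g"
  by (simp add: form_ip_commute[of h] form_ip_add_left)

lemma form_ip_nonneg: "form_ip f f \<ge> 0"
  unfolding form_ip_def by (intro sum_nonneg divide_nonneg_nonneg) auto

lemma form_ip_eq_0:
  fixes f :: "'e::euclidean_space list \<Rightarrow> 'f::real_inner"
  assumes "altform f" "form_ip f f = 0"
  shows "f vs = 0"
proof (rule altform_basis_zero[OF assms(1)])
  fix bs :: "'e list" assume bs: "set bs \<subseteq> Basis"
  show "f bs = 0"
  proof (cases "length bs \<le> DIM('e)")
    case True
    have "(\<Sum>bs\<in>tuples (length bs) Basis. f bs \<bullet> f bs) / fact (length bs) = 0"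
      using assms(2) True unfolding form_ip_def
      by (subst (asm) sum_nonneg_eq_0_iff) (auto intro!: sum_nonneg divide_nonneg_nonneg)
    then have "(\<Sum>bs\<in>tuples (length bs) Basis. f bs \<bullet> f bs) = 0" by simp
    then have "\<forall>cs\<in>tuples (length bs) Basis. f cs \<bullet> f cs = 0"
      by (subst (asm) sum_nonneg_eq_0_iff) (simp_all add: finite_tuples)
    moreover have "bs \<in> tuples (length bs) Basis" using bs by (simp add: tuples_def)
    ultimately show ?thesis by simp
  next
    case False
    \<comment> \<open>Degrees above the dimension are invisible to \<open>form_ip\<close>; there
      alternation alone forces the value zero.\<close>
    then show ?thesis
      using bs tuples_Basis_not_distinct[of bs "length bs"]
      by (intro altform_not_distinct[OF assms(1)]) (auto simp: tuples_def)
  qed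
qed

section \<open>Submanifolds given by a smooth field of projections\<close>

text \<open>Smoothness on constant arguments suffices, since multilinearity expands one varying
  argument after the other in the basis.\<close>

lemma smooth_on_set_altform_args:
  fixes \<Gamma> :: "'c::euclidean_space \<Rightarrow> 'e::euclidean_space list \<Rightarrow> 'f::euclidean_space"
  assumes alt: "\<And>z. z \<in> S \<Longrightarrow> altform (\<Gamma> z)" and sm: "\<And>vs. smooth_on_set S (\<lambda>z. \<Gamma> z vs)"
    and Xs: "\<And>X. X \<in> set Xs \<Longrightarrow> smooth_on_set S X"
  shows "smooth_on_set S (\<lambda>z. \<Gamma> z (map (\<lambda>X. X z) Xs))"
proof -
  have "smooth_on_set S (\<lambda>z. \<Gamma> z (us @ map (\<lambda>X. X z) Xs))" for us
    using Xs
  proof (induction Xs arbitrary: us)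
    case (Cons X Xs)
    have "smooth_on_set S (\<lambda>z. \<Sum>b\<in>Basis. (X z \<bullet> b) *\<^sub>R \<Gamma> z (us @ b # map (\<lambda>X. X z) Xs))"
    proof (intro smooth_on_set_sum smooth_on_set_scaleR smooth_on_set_inner smooth_on_set_const)
      show "smooth_on_set S X" using Cons.prems by simp
      show "smooth_on_set S (\<lambda>z. \<Gamma> z (us @ b # map (\<lambda>X. X z) Xs))" for b
        using Cons.IH[of "us @ [b]"] Cons.prems by simp
    qed
    then show ?case
    proof (rule smooth_on_set_cong)
      fix z assume z: "z \<in> S"
      have lin: "linear (\<lambda>v. \<Gamma> z (us @ v # map (\<lambda>X. X z) Xs))" by (rule altform_linear[OF alt[OF z]])
      have "\<Gamma> z (us @ X z # map (\<lambda>X. X z) Xs) =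
          \<Gamma> z (us @ (\<Sum>b\<in>Basis. (X z \<bullet> b) *\<^sub>R b) # map (\<lambda>X. X z) Xs)"
        by (simp only: euclidean_representation)
      also have "\<dots> = (\<Sum>b\<in>Basis. (X z \<bullet> b) *\<^sub>R \<Gamma> z (us @ b # map (\<lambda>X. X z) Xs))"
        by (simp only: linear_sum[OF lin] linear_scale[OF lin])
      finally show "(\<Sum>b\<in>Basis. (X z \<bullet> b) *\<^sub>R \<Gamma> z (us @ b # map (\<lambda>X. X z) Xs)) =
          \<Gamma> z (us @ map (\<lambda>X. X z) (X # Xs))" by simp
    qed
  qed (simp add: sm)
  from this[of "[]"] show ?thesis by simp
qed

lemma smooth_on_set_linear_arg:
  fixes \<Gamma> :: "'c::euclidean_space \<Rightarrow> 'e::euclidean_space \<Rightarrow> 'f::euclidean_space"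
  assumes lin: "\<And>z. z \<in> S \<Longrightarrow> linear (\<Gamma> z)" and sm: "\<And>v. smooth_on_set S (\<lambda>z. \<Gamma> z v)"
    and X: "smooth_on_set S X"
  shows "smooth_on_set S (\<lambda>z. \<Gamma> z (X z))"
proof -
  have "smooth_on_set S (\<lambda>z. \<Sum>b\<in>Basis. (X z \<bullet> b) *\<^sub>R \<Gamma> z b)"
    by (intro smooth_on_set_sum smooth_on_set_scaleR smooth_on_set_inner smooth_on_set_const sm X)
  then show ?thesis
  proof (rule smooth_on_set_cong)
    fix z assume z: "z \<in> S"
    have "\<Gamma> z (X z) = \<Gamma> z (\<Sum>b\<in>Basis. (X z \<bullet> b) *\<^sub>R b)" by (simp only: euclidean_representation)
    also have "\<dots> = (\<Sum>b\<in>Basis. (X z \<bullet> b) *\<^sub>R \<Gamma> z b)"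
      by (simp only: linear_sum[OF lin[OF z]] linear_scale[OF lin[OF z]])
    finally show "(\<Sum>b\<in>Basis. (X z \<bullet> b) *\<^sub>R \<Gamma> z b) = \<Gamma> z (X z)" by simp
  qed
qed

lemma smooth_on_set_asum:
  assumes "\<And>u ws. smooth_on_set S (\<lambda>z. H z u ws)"
  shows "smooth_on_set S (\<lambda>z. asum vs (H z))"
  using assms
proof (induction vs arbitrary: H)
  case (Cons v vs)
  show ?case unfolding asum.simps
    by (intro smooth_on_set_diff Cons.IH Cons.prems)
qed (simp add: smooth_on_set_const)

section \<open>Derivatives within a manifold and their values on tangent vectors\<close>

lemma dir_deriv_cong:
  assumes "x \<in> M" "\<And>y. y \<in> M \<Longrightarrow> f y = g y"
  shows "dir_deriv M f x = dir_deriv M g x"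
proof -
  have "(f has_derivative D) (at x within M) \<longleftrightarrow> (g has_derivative D) (at x within M)" for D
    using has_derivative_transform[of x M f g D] has_derivative_transform[of x M g f D] assms by auto
  then show ?thesis unfolding dir_deriv_def frechet_derivative_def by simp
qed

lemma smooth_has_derivative:
  assumes "smooth_on_set M f" "x \<in> M"
  shows "(f has_derivative dir_deriv M f x) (at x within M)"
proof -
  obtain U g where g: "open U" "M \<subseteq> U" "C_inf g U" "\<And>x. x \<in> M \<Longrightarrow> g x = f x"
    by (rule smooth_on_setE[OF assms(1)]) (rule that)
  then have "(g has_derivative frechet_derivative g (at x)) (at x)"
    using assms(2) by (intro C_inf_has_derivative[of g U]) auto
  then have "(f has_derivative frechet_derivative g (at x)) (at x within M)"
    using has_derivative_transform[of x M f g] has_derivative_at_withinI assms(2) g(4) by metis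
  then show ?thesis
    unfolding dir_deriv_def using frechet_derivative_works differentiable_def by blast
qed

lemma linear_dir_deriv: "smooth_on_set M f \<Longrightarrow> x \<in> M \<Longrightarrow> linear (dir_deriv M f x)"
  by (rule has_derivative_linear[OF smooth_has_derivative])

text \<open>A derivative within \<open>M\<close> need not be unique, but the chain rule along a
  curve in \<open>M\<close> with velocity \<open>v\<close> determines its value on
  \<open>v\<close>.\<close>

lemma dir_deriv_eq:
  assumes f': "(f has_derivative f') (at x within M)" and v: "v \<in> tangent_space M x"
  shows "dir_deriv M f x v = f' v"
proof -
  have D: "(f has_derivative dir_deriv M f x) (at x within M)"
    unfolding dir_deriv_def using frechet_derivative_works differentiable_def f' by blast
  obtain \<epsilon> \<gamma> where \<gamma>: "\<epsilon> > 0" "\<gamma> ` {-\<epsilon><..<\<epsilon>} \<subseteq> M" "\<gamma> (0::real) = x" "(\<gamma> has_vector_derivative v) (at 0)"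
    using v unfolding tangent_space_def by blast
  let ?I = "{-\<epsilon><..<\<epsilon>}"
  have at: "at 0 within ?I = at 0" using \<gamma>(1) by (intro at_within_open) auto
  have chain: "((\<lambda>t. f (\<gamma> t)) has_derivative (\<lambda>t. D' (t *\<^sub>R v))) (at 0)"
    if "(f has_derivative D') (at x within M)" for D'
  proof -
    have "(\<gamma> has_derivative (\<lambda>t. t *\<^sub>R v)) (at 0 within ?I)"
      using \<gamma>(4) by (simp add: at has_vector_derivative_def)
    moreover have "(f has_derivative D') (at (\<gamma> 0) within \<gamma> ` ?I)"
      using has_derivative_subset[OF that \<gamma>(2)] \<gamma>(3) by simp
    ultimately have "((\<lambda>t. f (\<gamma> t)) has_derivative (\<lambda>t. D' (t *\<^sub>R v))) (at 0 within ?I)"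
      by (rule has_derivative_in_compose)
    then show ?thesis by (simp only: at)
  qed
  have "(\<lambda>t. dir_deriv M f x (t *\<^sub>R v)) = (\<lambda>t. f' (t *\<^sub>R v))"
    by (rule has_derivative_unique[OF chain[OF D] chain[OF f']])
  from fun_cong[OF this, of 1] show ?thesis by simp
qed

text \<open>A smooth field of orthogonal projections takes the place of charts: every ambient vector
  yields a tangent field by projection, and all tensor calculus is carried out in the ambient
  space.\<close>

locale submanifold =
  fixes M :: "'e::euclidean_space set" and P :: "'e \<Rightarrow> 'e \<Rightarrow> 'e"
  assumes tangent_space_eq: "x \<in> M \<Longrightarrow> tangent_space M x = range (P x)"
    and linear_P: "x \<in> M \<Longrightarrow> linear (P x)"
    and P_sym: "x \<in> M \<Longrightarrow> P x u \<bullet> v = u \<bullet> P x v"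
    and P_idem: "x \<in> M \<Longrightarrow> P x (P x v) = P x v"
    and smooth_P: "smooth_on_set M (\<lambda>x. P x v)"
begin

lemma P_tangent: "x \<in> M \<Longrightarrow> P x v \<in> tangent_space M x"
  by (simp add: tangent_space_eq)

lemma P_eq: "x \<in> M \<Longrightarrow> v \<in> tangent_space M x \<Longrightarrow> P x v = v"
  by (auto simp: tangent_space_eq P_idem)

lemma map_P_eq: "x \<in> M \<Longrightarrow> set vs \<subseteq> tangent_space M x \<Longrightarrow> map (P x) vs = vs"
  by (induction vs) (auto simp: P_eq)

lemma map_P_tangent: "x \<in> M \<Longrightarrow> set (map (P x) vs) \<subseteq> tangent_space M x"
  by (auto simp: P_tangent)

lemma map_P_idem: "x \<in> M \<Longrightarrow> map (P x) (map (P x) vs) = map (P x) vs"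
  by (simp add: P_idem)

lemma subspace_tangent_space: "x \<in> M \<Longrightarrow> subspace (tangent_space M x)"
  unfolding tangent_space_eq by (metis linear_P linear_subspace_image subspace_UNIV)

lemma orth_proj_tangent:
  assumes "x \<in> M" shows "orth_proj (tangent_space M x) v = P x v"
  unfolding orth_proj_def
proof (rule the_equality)
  show "P x v \<in> tangent_space M x \<and> (\<forall>u\<in>tangent_space M x. (v - P x v) \<bullet> u = 0)"
    by (auto simp: tangent_space_eq[OF assms] inner_diff_left P_sym[OF assms] P_idem[OF assms])
next
  fix w assume w: "w \<in> tangent_space M x \<and> (\<forall>u\<in>tangent_space M x. (v - w) \<bullet> u = 0)"
  then have "(v - w) \<bullet> P x z = 0" for z using P_tangent[OF assms] by blast
  then have "P x (v - w) \<bullet> z = 0" for z by (simp add: P_sym[OF assms])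
  then have "P x (v - w) = 0" by (metis inner_eq_zero_iff)
  then show "w = P x v" using w P_eq[OF assms] linear_diff[OF linear_P[OF assms]] by auto
qed

text \<open>The projection gives a meaning to all ambient directions, so that traces over the
  tangent space can be taken over the ambient basis.\<close>

definition pder :: "('e \<Rightarrow> 'f::euclidean_space) \<Rightarrow> 'e \<Rightarrow> 'e \<Rightarrow> 'f" where
  "pder f x u = dir_deriv M f x (P x u)"

lemma pder_eq: "(f has_derivative f') (at x within M) \<Longrightarrow> x \<in> M \<Longrightarrow> pder f x u = f' (P x u)"
  unfolding pder_def by (intro dir_deriv_eq P_tangent)

lemma pder_cong: "x \<in> M \<Longrightarrow> (\<And>y. y \<in> M \<Longrightarrow> f y = g y) \<Longrightarrow> pder f x u = pder g x u"
  unfolding pder_def using dir_deriv_cong[of x M f g] by simp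

lemma pder_const: "x \<in> M \<Longrightarrow> pder (\<lambda>y. c) x u = 0"
  by (subst pder_eq[of _ "\<lambda>_. 0"]) auto

lemma linear_pder: "smooth_on_set M f \<Longrightarrow> x \<in> M \<Longrightarrow> linear (pder f x)"
  unfolding pder_def using linear_compose[OF linear_P linear_dir_deriv] by (simp add: o_def)

lemma pder_P: "x \<in> M \<Longrightarrow> pder f x (P x u) = pder f x u"
  unfolding pder_def by (simp add: P_idem)

lemma pder_bilinear:
  assumes "bounded_bilinear pr" "smooth_on_set M f" "smooth_on_set M g" "x \<in> M"
  shows "pder (\<lambda>y. pr (f y) (g y)) x u = pr (f x) (pder g x u) + pr (pder f x u) (g x)"
  unfolding pder_def[of f] pder_def[of g]
  by (rule pder_eq[OF bounded_bilinear.FDERIV[OF assms(1) smooth_has_derivative[OF assms(2,4)]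
        smooth_has_derivative[OF assms(3,4)]] assms(4)])

lemma pder_linear_image:
  assumes "bounded_linear h" "smooth_on_set M f" "x \<in> M"
  shows "pder (\<lambda>y. h (f y)) x u = h (pder f x u)"
  unfolding pder_def[of f]
  by (rule pder_eq[OF bounded_linear.has_derivative[OF assms(1) smooth_has_derivative[OF assms(2,3)]] assms(3)])

lemma pder_add:
  assumes "smooth_on_set M f" "smooth_on_set M g" "x \<in> M"
  shows "pder (\<lambda>y. f y + g y) x u = pder f x u + pder g x u"
  unfolding pder_def[of f] pder_def[of g]
  by (rule pder_eq[OF has_derivative_add[OF smooth_has_derivative[OF assms(1,3)]
        smooth_has_derivative[OF assms(2,3)]] assms(3)])

lemma pder_sum:
  assumes "\<And>i. i \<in> A \<Longrightarrow> smooth_on_set M (f i)" "x \<in> M"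
  shows "pder (\<lambda>y. \<Sum>i\<in>A. f i y) x u = (\<Sum>i\<in>A. pder (f i) x u)"
  unfolding pder_def[of "f _"]
  by (rule pder_eq[OF has_derivative_sum[OF smooth_has_derivative[OF assms(1) assms(2)]] assms(2)])

lemma pder_scaleR:
  assumes "smooth_on_set M f" "x \<in> M"
  shows "pder (\<lambda>y. c *\<^sub>R f y) x u = c *\<^sub>R pder f x u"
  by (rule pder_linear_image[OF bounded_linear_scaleR_right assms])

lemma smooth_P_arg:
  assumes "smooth_on_set S x" "x ` S \<subseteq> M" "smooth_on_set S X"
  shows "smooth_on_set S (\<lambda>z. P (x z) (X z))"
proof (rule smooth_on_set_linear_arg[where \<Gamma> = "\<lambda>z. P (x z)"])
  show "smooth_on_set S (\<lambda>z. P (x z) v)" for v by (rule smooth_on_set_compose[OF smooth_P assms(1,2)])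
qed (use assms linear_P in auto)

text \<open>The derivative of a slice is that of a smooth extension \<open>g\<close> in a direction
  without time component. This direction is tangent to the slice, so the choice of the extension
  does not matter.\<close>

lemma smooth_pder:
  fixes I :: "real set" and f :: "real \<Rightarrow> 'e \<Rightarrow> 'f::euclidean_space"
  assumes f: "smooth_on_set (I \<times> M) (\<lambda>z. f (fst z) (snd z))" and X: "smooth_on_set (I \<times> M) X"
  shows "smooth_on_set (I \<times> M) (\<lambda>z. pder (f (fst z)) (snd z) (X z))"
proof -
  obtain U g where g: "open U" "I \<times> M \<subseteq> U" "C_inf g U" "\<And>z. z \<in> I \<times> M \<Longrightarrow> g z = f (fst z) (snd z)"
    by (rule smooth_on_setE[OF f]) (rule that)
  have sY: "smooth_on_set (I \<times> M) (\<lambda>z. (0::real, P (snd z) (X z)))"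
    by (intro smooth_on_set_Pair smooth_on_set_const smooth_P_arg X smooth_on_set_snd smooth_on_set_id) auto
  obtain V and Y :: "real \<times> 'e \<Rightarrow> real \<times> 'e"
    where Y: "open V" "I \<times> M \<subseteq> V" "C_inf Y V" "\<And>z. z \<in> I \<times> M \<Longrightarrow> Y z = (0, P (snd z) (X z))"
    by (rule smooth_on_setE[OF sY]) (rule that)
  have sub: "C_inf g (U \<inter> V)" "C_inf Y (U \<inter> V)"
    using g(3) Y(3) by (auto simp: C_inf_def intro: C_k_subset)
  show ?thesis
  proof (rule smooth_on_setI)
    show "C_inf (\<lambda>z. frechet_derivative g (at z) (Y z)) (U \<inter> V)"
      using g(1) Y(1) sub by (intro C_inf_frechet_derivative) auto
    fix z assume z: "z \<in> I \<times> M"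
    obtain s x where zz: "z = (s, x)" by force
    have "((\<lambda>y. (s, y)) has_derivative (\<lambda>v. (0, v))) (at x within M)"
      by (auto intro!: derivative_eq_intros)
    moreover have "(g has_derivative frechet_derivative g (at z)) (at (s, x))"
      using C_inf_has_derivative[OF g(3)] g(2) z zz by auto
    ultimately have "((\<lambda>y. g (s, y)) has_derivative (\<lambda>v. frechet_derivative g (at z) (0, v))) (at x within M)"
      by (rule has_derivative_compose)
    then have "(f s has_derivative (\<lambda>v. frechet_derivative g (at z) (0, v))) (at x within M)"
      by (rule has_derivative_transform[rotated 2]) (use z zz g(4) in auto)
    from pder_eq[OF this] show "frechet_derivative g (at z) (Y z) = pder (f (fst z)) (snd z) (X z)"
      using z zz Y(4)[OF z] by simp
  qed (use g Y in auto)
qed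

subsection \<open>Forms\<close>

text \<open>
  Forms are extended to lists of arbitrary vectors of the ambient space through the projection \<open>P\<close>;
  they are then alternating and multilinear on the whole space. The operators \<open>covd\<close>, \<open>fext\<close>, \<open>fco\<close> and
  \<open>fdirac\<close> are the flat counterparts of \<open>\<nabla>\<close>, \<open>d\<close>, \<open>d\<^sup>*\<close> and \<open>d\<^sup>* + d\<close>.
\<close>

definition hform :: "('e \<Rightarrow> 'e list \<Rightarrow> 'f::euclidean_space) \<Rightarrow> bool" where
  "hform \<omega> \<longleftrightarrow> (\<forall>x\<in>M. altform (\<omega> x) \<and> (\<forall>vs. \<omega> x (map (P x) vs) = \<omega> x vs)) \<and>
     (\<forall>vs. smooth_on_set M (\<lambda>x. \<omega> x vs))"

text \<open>Smoothness is joint in the parameter and the point, as differentiation under the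
  integral requires. Single forms are treated as constant families.\<close>

definition hform_family :: "real set \<Rightarrow> (real \<Rightarrow> 'e \<Rightarrow> 'e list \<Rightarrow> 'f::euclidean_space) \<Rightarrow> bool" where
  "hform_family I \<omega> \<longleftrightarrow>
     (\<forall>s\<in>I. \<forall>x\<in>M. altform (\<omega> s x) \<and> (\<forall>vs. \<omega> s x (map (P x) vs) = \<omega> s x vs)) \<and>
     (\<forall>vs. smooth_on_set (I \<times> M) (\<lambda>z. \<omega> (fst z) (snd z) vs))"

lemma hform_altform: "hform \<omega> \<Longrightarrow> x \<in> M \<Longrightarrow> altform (\<omega> x)"
  and hform_map_P: "hform \<omega> \<Longrightarrow> x \<in> M \<Longrightarrow> \<omega> x (map (P x) vs) = \<omega> x vs"
  and hform_smooth: "hform \<omega> \<Longrightarrow> smooth_on_set M (\<lambda>x. \<omega> x vs)"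
  unfolding hform_def by auto

lemma hform_familyI:
  assumes "\<And>s. s \<in> I \<Longrightarrow> hform (\<omega> s)" "\<And>vs. smooth_on_set (I \<times> M) (\<lambda>z. \<omega> (fst z) (snd z) vs)"
  shows "hform_family I \<omega>"
  using assms unfolding hform_family_def hform_def by blast

lemma hform_family_smooth: "hform_family I \<omega> \<Longrightarrow> smooth_on_set (I \<times> M) (\<lambda>z. \<omega> (fst z) (snd z) vs)"
  unfolding hform_family_def by blast

lemma smooth_slice:
  assumes "smooth_on_set (I \<times> M) (\<lambda>z. f (fst z) (snd z))" "s \<in> I"
  shows "smooth_on_set M (f s)"
  using smooth_on_set_compose[OF assms(1) smooth_on_set_Pair[OF smooth_on_set_const[of M s] smooth_on_set_id]] assms(2)
  by auto

lemma smooth_const_family: "smooth_on_set M f \<Longrightarrow> smooth_on_set (I \<times> M) (\<lambda>z. f (snd z))" for I :: "real set"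
  by (rule smooth_on_set_compose[of M f]) (auto intro: smooth_on_set_snd smooth_on_set_id)

lemma hform_family_slice: "hform_family I \<omega> \<Longrightarrow> s \<in> I \<Longrightarrow> hform (\<omega> s)"
  unfolding hform_family_def hform_def using smooth_slice[of I "\<lambda>s x. \<omega> s x _" s] by auto

lemma hform_family_const: "hform \<omega> \<Longrightarrow> hform_family I (\<lambda>_. \<omega>)"
  by (rule hform_familyI) (auto intro!: smooth_const_family hform_smooth)

text \<open>The arguments are frozen at \<open>P x w\<close> while the point \<open>y\<close> moves.
  As \<omega> absorbs \<open>P y\<close>, this amounts to extending \<open>P x w\<close> by the
  field \<open>P y (P x w)\<close>, which has zero covariant derivative at \<open>x\<close> by
  \<open>P_pder_P\<close>; hence no Levi-Civita correction appears.\<close>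

definition covd :: "('e \<Rightarrow> 'e list \<Rightarrow> 'f::euclidean_space) \<Rightarrow> 'e \<Rightarrow> 'e \<Rightarrow> 'e list \<Rightarrow> 'f" where
  "covd \<omega> x u ws = pder (\<lambda>y. \<omega> y (map (P x) ws)) x u"

definition fext :: "('e \<Rightarrow> 'e list \<Rightarrow> 'f::euclidean_space) \<Rightarrow> 'e \<Rightarrow> 'e list \<Rightarrow> 'f" where
  "fext \<omega> x vs = asum vs (covd \<omega> x)"

text \<open>The trace may run over the ambient basis, since \<open>covd\<close> projects both its
  direction and its arguments and thus sees only the tangential part.\<close>

definition fco :: "('e \<Rightarrow> 'e list \<Rightarrow> 'f::euclidean_space) \<Rightarrow> 'e \<Rightarrow> 'e list \<Rightarrow> 'f" where
  "fco \<omega> x ws = - (\<Sum>b\<in>Basis. covd \<omega> x b (b # ws))"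

definition fdirac :: "('e \<Rightarrow> 'e list \<Rightarrow> 'f::euclidean_space) \<Rightarrow> 'e \<Rightarrow> 'e list \<Rightarrow> 'f" where
  "fdirac \<omega> x vs = fco \<omega> x vs + fext \<omega> x vs"

lemma altform_pder:
  assumes "hform \<omega>" "x \<in> M"
  shows "altform (\<lambda>vs. pder (\<lambda>y. \<omega> y vs) x u)"
  unfolding altform_def
proof (intro conjI allI impI)
  fix us ws v w and a b :: real
  have "pder (\<lambda>y. \<omega> y (us @ (a *\<^sub>R v + b *\<^sub>R w) # ws)) x u =
      pder (\<lambda>y. a *\<^sub>R \<omega> y (us @ v # ws) + b *\<^sub>R \<omega> y (us @ w # ws)) x u"
    by (intro pder_cong altform_combination hform_altform assms)
  also have "\<dots> = a *\<^sub>R pder (\<lambda>y. \<omega> y (us @ v # ws)) x u + b *\<^sub>R pder (\<lambda>y. \<omega> y (us @ w # ws)) x u"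
    by (simp add: pder_add pder_scaleR smooth_on_set_scaleR smooth_on_set_const hform_smooth assms)
  finally show "pder (\<lambda>y. \<omega> y (us @ (a *\<^sub>R v + b *\<^sub>R w) # ws)) x u =
      a *\<^sub>R pder (\<lambda>y. \<omega> y (us @ v # ws)) x u + b *\<^sub>R pder (\<lambda>y. \<omega> y (us @ w # ws)) x u" .
next
  fix vs :: "'e list" assume "\<not> distinct vs"
  then have "pder (\<lambda>y. \<omega> y vs) x u = pder (\<lambda>y. 0) x u"
    by (intro pder_cong altform_not_distinct hform_altform assms)
  then show "pder (\<lambda>y. \<omega> y vs) x u = 0" by (simp add: pder_const assms)
qed

lemma altform_covd: "hform \<omega> \<Longrightarrow> x \<in> M \<Longrightarrow> altform (covd \<omega> x u)"
  using altform_map[OF linear_P altform_pder] unfolding covd_def[abs_def] by blast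

lemma linear_covd: "hform \<omega> \<Longrightarrow> x \<in> M \<Longrightarrow> linear (\<lambda>u. covd \<omega> x u ws)"
  unfolding covd_def by (intro linear_pder hform_smooth)

lemma covd_P: "x \<in> M \<Longrightarrow> covd \<omega> x (P x u) ws = covd \<omega> x u ws"
  unfolding covd_def by (rule pder_P)

lemma covd_map_P: "x \<in> M \<Longrightarrow> covd \<omega> x u (map (P x) ws) = covd \<omega> x u ws"
  by (simp only: covd_def map_P_idem)

lemma covd_map_P_hd: "x \<in> M \<Longrightarrow> covd \<omega> x u (v # map (P x) ws) = covd \<omega> x u (v # ws)"
  by (simp only: covd_def list.map map_P_idem)

lemma altform_fext: "hform \<omega> \<Longrightarrow> x \<in> M \<Longrightarrow> altform (fext \<omega> x)"
  unfolding fext_def[abs_def] by (intro altform_asum altform_covd linear_covd)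

lemma altform_fco: "hform \<omega> \<Longrightarrow> x \<in> M \<Longrightarrow> altform (fco \<omega> x)"
  unfolding fco_def[abs_def] by (intro altform_minus altform_sum altform_Cons altform_covd)

lemma fext_map_P: "x \<in> M \<Longrightarrow> fext \<omega> x (map (P x) vs) = fext \<omega> x vs"
  unfolding fext_def asum_map by (simp add: covd_P covd_map_P)

lemma fco_map_P: "x \<in> M \<Longrightarrow> fco \<omega> x (map (P x) vs) = fco \<omega> x vs"
  unfolding fco_def by (simp add: covd_map_P_hd)

lemma smooth_covd:
  assumes "hform_family I \<omega>"
  shows "smooth_on_set (I \<times> M) (\<lambda>z. covd (\<omega> (fst z)) (snd z) u ws)"
proof -
  have "smooth_on_set (I \<times> M) (\<lambda>z. pder (\<lambda>y. \<omega> (fst z) y (map (\<lambda>X. X z) (map (\<lambda>w z. P (snd z) w) ws))) (snd z) u)"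
  proof (rule smooth_on_set_altform_args[where \<Gamma> = "\<lambda>z vs. pder (\<lambda>y. \<omega> (fst z) y vs) (snd z) u"])
    show "altform (\<lambda>vs. pder (\<lambda>y. \<omega> (fst z) y vs) (snd z) u)" if "z \<in> I \<times> M" for z
      using that by (intro altform_pder hform_family_slice[OF assms]) auto
    show "smooth_on_set (I \<times> M) (\<lambda>z. pder (\<lambda>y. \<omega> (fst z) y vs) (snd z) u)" for vs
      by (intro smooth_pder hform_family_smooth[OF assms] smooth_on_set_const)
    show "smooth_on_set (I \<times> M) X" if "X \<in> set (map (\<lambda>w z. P (snd z) w) ws)" for X
      using that by (auto intro!: smooth_P_arg smooth_on_set_snd smooth_on_set_id smooth_on_set_const)
  qed
  then show ?thesis by (simp add: covd_def o_def)
qed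

lemma hform_family_fext:
  assumes "hform_family I \<omega>" shows "hform_family I (\<lambda>s. fext (\<omega> s))"
  unfolding hform_family_def
proof (intro conjI ballI allI)
  show "smooth_on_set (I \<times> M) (\<lambda>z. fext (\<omega> (fst z)) (snd z) vs)" for vs
    unfolding fext_def by (intro smooth_on_set_asum smooth_covd assms)
qed (auto intro!: altform_fext fext_map_P hform_family_slice[OF assms])

lemma hform_family_fco:
  assumes "hform_family I \<omega>" shows "hform_family I (\<lambda>s. fco (\<omega> s))"
  unfolding hform_family_def
proof (intro conjI ballI allI)
  show "smooth_on_set (I \<times> M) (\<lambda>z. fco (\<omega> (fst z)) (snd z) vs)" for vs
    unfolding fco_def by (intro smooth_on_set_minus smooth_on_set_sum smooth_covd assms)
qed (auto intro!: altform_fco fco_map_P hform_family_slice[OF assms])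

lemma hform_family_add:
  assumes "hform_family I \<omega>" "hform_family I \<theta>"
  shows "hform_family I (\<lambda>s x vs. \<omega> s x vs + \<theta> s x vs)"
  using assms unfolding hform_family_def by (auto intro!: altform_add smooth_on_set_add)

lemma hform_family_fdirac: "hform_family I \<omega> \<Longrightarrow> hform_family I (\<lambda>s. fdirac (\<omega> s))"
  unfolding fdirac_def[abs_def] by (intro hform_family_add hform_family_fco hform_family_fext)

text \<open>Closure properties proved for families are specialized to single forms through the
  constant family over one parameter value.\<close>

lemma hform_of_family: "hform_family {0} (\<lambda>_. \<omega>) \<Longrightarrow> hform \<omega>"
  using hform_family_slice[of "{0}" "\<lambda>_. \<omega>" 0] by simp

lemma hform_fext: "hform \<omega> \<Longrightarrow> hform (fext \<omega>)"
  and hform_fco: "hform \<omega> \<Longrightarrow> hform (fco \<omega>)"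
  and hform_fdirac: "hform \<omega> \<Longrightarrow> hform (fdirac \<omega>)"
  by (rule hform_of_family[OF hform_family_fext[OF hform_family_const]], assumption)
    (rule hform_of_family[OF hform_family_fco[OF hform_family_const]], assumption,
     rule hform_of_family[OF hform_family_fdirac[OF hform_family_const]], assumption)

lemma hform_add: "hform \<omega> \<Longrightarrow> hform \<theta> \<Longrightarrow> hform (\<lambda>x vs. \<omega> x vs + \<theta> x vs)"
  unfolding hform_def by (auto intro!: altform_add smooth_on_set_add)

end

section \<open>The projection onto the orthogonal complement of a point of the unit sphere\<close>

definition nproj :: "'f::real_inner \<Rightarrow> 'f \<Rightarrow> 'f" where
  "nproj y v = v - (v \<bullet> y) *\<^sub>R y"

lemma linear_nproj: "linear (nproj y)"
  by (rule linearI) (auto simp: nproj_def algebra_simps inner_add_left)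

lemma nproj_sym: "nproj y u \<bullet> v = u \<bullet> nproj y v"
  by (simp add: nproj_def inner_diff_left inner_diff_right inner_commute mult.commute)

lemma nproj_orthogonal: "norm y = 1 \<Longrightarrow> nproj y v \<bullet> y = 0"
  by (simp add: nproj_def inner_diff_left dot_square_norm)

lemma nproj_eq: "v \<bullet> y = 0 \<Longrightarrow> nproj y v = v"
  by (simp add: nproj_def)

lemma smooth_on_set_nproj:
  "smooth_on_set S \<phi> \<Longrightarrow> smooth_on_set S X \<Longrightarrow> smooth_on_set S (\<lambda>z. nproj (\<phi> z) (X z))"
  unfolding nproj_def by (intro smooth_on_set_diff smooth_on_set_scaleR smooth_on_set_inner)

context submanifold
begin

lemma hform_family_nproj:
  assumes "hform_family I \<omega>" "smooth_on_set (I \<times> M) (\<lambda>z. \<phi> (fst z) (snd z))"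
  shows "hform_family I (\<lambda>s x vs. nproj (\<phi> s x) (\<omega> s x vs))"
  using assms unfolding hform_family_def
  by (auto intro!: altform_linear_image[OF linear_nproj] smooth_on_set_nproj)

lemma hform_nproj:
  assumes "hform \<omega>" "smooth_on_set M \<phi>"
  shows "hform (\<lambda>x vs. nproj (\<phi> x) (\<omega> x vs))"
  using assms unfolding hform_def
  by (auto intro!: altform_linear_image[OF linear_nproj] smooth_on_set_nproj)

end

section \<open>Integration by parts on closed submanifolds\<close>

context submanifold
begin

text \<open>The Leibniz rule for the evaluation of \<Gamma> on \<open>X\<close>. Expanding
  \<open>X\<close> in the basis reduces it to products of a scalar with a vector.\<close>

lemma pder_linear_arg:
  fixes \<Gamma> :: "'e \<Rightarrow> 'a::euclidean_space \<Rightarrow> 'f::euclidean_space"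
  assumes lin: "\<And>y. y \<in> M \<Longrightarrow> linear (\<Gamma> y)" and sm: "\<And>v. smooth_on_set M (\<lambda>y. \<Gamma> y v)"
    and X: "smooth_on_set M X" and x: "x \<in> M"
  shows "pder (\<lambda>y. \<Gamma> y (X y)) x u = \<Gamma> x (pder X x u) + pder (\<lambda>y. \<Gamma> y (X x)) x u"
proof -
  have rep: "\<Gamma> y v = (\<Sum>c\<in>Basis. (v \<bullet> c) *\<^sub>R \<Gamma> y c)" if "y \<in> M" for y v
    by (subst euclidean_representation[of v, symmetric])
      (simp only: linear_sum[OF lin[OF that]] linear_scale[OF lin[OF that]])
  have sXc: "smooth_on_set M (\<lambda>y. X y \<bullet> c)" for c
    by (intro smooth_on_set_inner X smooth_on_set_const)
  have dXc: "pder (\<lambda>y. X y \<bullet> c) x u = pder X x u \<bullet> c" for c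
    by (rule pder_linear_image[OF bounded_linear_inner_left X x])
  have "pder (\<lambda>y. \<Gamma> y (X y)) x u = pder (\<lambda>y. \<Sum>c\<in>Basis. (X y \<bullet> c) *\<^sub>R \<Gamma> y c) x u"
    by (rule pder_cong[OF x rep])
  also have "\<dots> = (\<Sum>c\<in>Basis. pder (\<lambda>y. (X y \<bullet> c) *\<^sub>R \<Gamma> y c) x u)"
    by (intro pder_sum smooth_on_set_scaleR sXc sm x)
  also have "\<dots> = (\<Sum>c\<in>Basis. (X x \<bullet> c) *\<^sub>R pder (\<lambda>y. \<Gamma> y c) x u + (pder X x u \<bullet> c) *\<^sub>R \<Gamma> x c)"
    by (simp only: pder_bilinear[OF bounded_bilinear_scaleR sXc sm x] dXc)
  also have "\<dots> = (\<Sum>c\<in>Basis. (X x \<bullet> c) *\<^sub>R pder (\<lambda>y. \<Gamma> y c) x u) + \<Gamma> x (pder X x u)"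
    by (simp only: sum.distrib flip: rep[OF x])
  also have "(\<Sum>c\<in>Basis. (X x \<bullet> c) *\<^sub>R pder (\<lambda>y. \<Gamma> y c) x u) =
      (\<Sum>c\<in>Basis. pder (\<lambda>y. (X x \<bullet> c) *\<^sub>R \<Gamma> y c) x u)"
    by (simp only: pder_scaleR[OF sm x])
  also have "\<dots> = pder (\<lambda>y. \<Sum>c\<in>Basis. (X x \<bullet> c) *\<^sub>R \<Gamma> y c) x u"
    by (rule pder_sum[symmetric]) (intro smooth_on_set_scaleR smooth_on_set_const sm x)+
  also have "\<dots> = pder (\<lambda>y. \<Gamma> y (X x)) x u"
    by (rule pder_cong[OF x rep[symmetric]])
  finally show ?thesis by (simp only: add.commute)
qed

text \<open>This is the derivative of \<open>P P = P\<close>.\<close>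

lemma P_pder_P:
  assumes x: "x \<in> M" shows "P x (pder (\<lambda>y. P y (P x v)) x u) = 0"
proof -
  have "pder (\<lambda>y. P y v) x u = pder (\<lambda>y. P y (P y v)) x u"
    by (rule pder_cong[OF x]) (simp add: P_idem)
  also have "\<dots> = P x (pder (\<lambda>y. P y v) x u) + pder (\<lambda>y. P y (P x v)) x u"
    by (rule pder_linear_arg[OF linear_P smooth_P smooth_P x])
  finally have "P x (pder (\<lambda>y. P y v) x u) =
      P x (P x (pder (\<lambda>y. P y v) x u) + pder (\<lambda>y. P y (P x v)) x u)" by (rule arg_cong)
  then show ?thesis by (simp add: linear_add[OF linear_P[OF x]] P_idem[OF x])
qed

text \<open>The divergence of \<open>P\<close> is a normal vector. A derivative only sees
  \<open>P x b\<close>, and symmetry of \<open>P\<close> transfers this projection into the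
  differentiated slot, where \<open>P_pder_P\<close> gives zero.\<close>

lemma sum_P_pder_P:
  assumes x: "x \<in> M" shows "(\<Sum>b\<in>Basis. P x (pder (\<lambda>y. P y b) x b)) = 0"
proof -
  let ?B = "\<lambda>u v. P x (pder (\<lambda>y. P y v) x u)"
  have lu: "linear (\<lambda>u. ?B u v)" for v
    using linear_compose[OF linear_pder[OF smooth_P x] linear_P[OF x]] by (simp add: o_def)
  have lv: "linear (?B u)" for u
  proof (rule linear_compose[OF _ linear_P[OF x], unfolded o_def], rule linearI)
    show "pder (\<lambda>y. P y (v + w)) x u = pder (\<lambda>y. P y v) x u + pder (\<lambda>y. P y w) x u" for v w
      by (simp add: pder_cong[OF x linear_add[OF linear_P]] pder_add[OF smooth_P smooth_P x])
    show "pder (\<lambda>y. P y (c *\<^sub>R v)) x u = c *\<^sub>R pder (\<lambda>y. P y v) x u" for c v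
      by (simp add: pder_cong[OF x linear_scale[OF linear_P]] pder_scaleR[OF smooth_P x])
  qed
  have "(\<Sum>b\<in>Basis. ?B b b) = (\<Sum>b\<in>Basis. ?B (P x b) b)" by (simp add: pder_P[OF x])
  also have "\<dots> = (\<Sum>b\<in>Basis. ?B b (P x b))"
    by (rule sum_Basis_transfer_bilinear[OF lu lv P_sym[OF x]])
  also have "\<dots> = 0" by (simp add: P_pder_P[OF x])
  finally show ?thesis .
qed

lemma hform_Cons_P: "hform \<omega> \<Longrightarrow> x \<in> M \<Longrightarrow> \<omega> x (P x v # vs) = \<omega> x (v # vs)"
  using hform_map_P[of \<omega> x "P x v # vs"] hform_map_P[of \<omega> x "v # vs"] by (simp add: P_idem)

lemma hform_Cons_map_P: "hform \<omega> \<Longrightarrow> x \<in> M \<Longrightarrow> \<omega> x (v # map (P x) vs) = \<omega> x (v # vs)"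
  using hform_map_P[of \<omega> x "v # map (P x) vs"] hform_map_P[of \<omega> x "v # vs"]
  by (simp only: list.map map_P_idem)

lemma sum_pder_hform:
  assumes w: "hform \<omega>" and x: "x \<in> M"
  shows "(\<Sum>b\<in>Basis. pder (\<lambda>y. \<omega> y (P x b # bs)) x b) = (\<Sum>b\<in>Basis. pder (\<lambda>y. \<omega> y (b # bs)) x b)"
proof -
  have lin: "linear (\<lambda>v. \<omega> y (v # bs))" if "y \<in> M" for y
    by (rule altform_linear_hd[OF hform_altform[OF w that]])
  have "pder (\<lambda>y. \<omega> y (b # bs)) x b =
      \<omega> x (P x (pder (\<lambda>y. P y b) x b) # bs) + pder (\<lambda>y. \<omega> y (P x b # bs)) x b" for b
  proof -
    have "pder (\<lambda>y. \<omega> y (b # bs)) x b = pder (\<lambda>y. \<omega> y (P y b # bs)) x b"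
      by (rule pder_cong[OF x]) (simp add: hform_Cons_P[OF w])
    also have "\<dots> = \<omega> x (pder (\<lambda>y. P y b) x b # bs) + pder (\<lambda>y. \<omega> y (P x b # bs)) x b"
      by (rule pder_linear_arg[where \<Gamma> = "\<lambda>y v. \<omega> y (v # bs)", OF lin hform_smooth[OF w] smooth_P x])
    finally show ?thesis by (simp add: hform_Cons_P[OF w x])
  qed
  then have "(\<Sum>b\<in>Basis. pder (\<lambda>y. \<omega> y (b # bs)) x b) =
      \<omega> x ((\<Sum>b\<in>Basis. P x (pder (\<lambda>y. P y b) x b)) # bs) + (\<Sum>b\<in>Basis. pder (\<lambda>y. \<omega> y (P x b # bs)) x b)"
    by (simp add: linear_sum[OF lin[OF x]] sum.distrib)
  then show ?thesis by (simp add: sum_P_pder_P[OF x] linear_0[OF lin[OF x]])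
qed

text \<open>The projections are transferred to \<omega>, which absorbs them. What is left here and
  in \<open>form_ip_fco\<close> are derivatives on constant basis vectors, and the two expressions
  combine by the Leibniz rule.\<close>

lemma form_ip_fext:
  assumes t: "hform \<theta>" and w: "hform \<omega>" and x: "x \<in> M"
  shows "form_ip (fext \<theta> x) (\<omega> x) =
    (\<Sum>k\<le>DIM('e). (\<Sum>b\<in>Basis. \<Sum>bs\<in>tuples k Basis. pder (\<lambda>y. \<theta> y bs) x b \<bullet> \<omega> x (b # bs)) / fact k)"
proof -
  have "(\<Sum>bs\<in>tuples k Basis. covd \<theta> x b bs \<bullet> \<omega> x (b # bs)) =
      (\<Sum>bs\<in>tuples k Basis. pder (\<lambda>y. \<theta> y bs) x b \<bullet> \<omega> x (b # bs))" for k b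
  proof -
    have "(\<Sum>bs\<in>tuples k Basis. covd \<theta> x b bs \<bullet> \<omega> x (b # bs)) =
        (\<Sum>bs\<in>tuples k Basis. pder (\<lambda>y. \<theta> y bs) x b \<bullet> \<omega> x (b # map (P x) bs))"
      unfolding covd_def
      by (rule sum_tuples_transfer[OF altform_pder[OF t x] altform_Cons[OF hform_altform[OF w x]] P_sym[OF x]])
    then show ?thesis by (simp add: hform_Cons_map_P[OF w x])
  qed
  then show ?thesis
    unfolding fext_def form_ip_asum[OF hform_altform[OF w x]] by simp
qed

lemma form_ip_fco:
  assumes t: "hform \<theta>" and w: "hform \<omega>" and x: "x \<in> M"
  shows "form_ip (\<theta> x) (fco \<omega> x) =
    - (\<Sum>k\<le>DIM('e). (\<Sum>b\<in>Basis. \<Sum>bs\<in>tuples k Basis. \<theta> x bs \<bullet> pder (\<lambda>y. \<omega> y (b # bs)) x b) / fact k)"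
proof -
  have alt: "altform (\<lambda>vs. pder (\<lambda>y. \<omega> y (P x b # vs)) x b)" for b
    using altform_Cons[OF altform_pder[OF w x]] .
  have "(\<Sum>bs\<in>tuples k Basis. \<theta> x bs \<bullet> fco \<omega> x bs) =
      - (\<Sum>b\<in>Basis. \<Sum>bs\<in>tuples k Basis. \<theta> x bs \<bullet> pder (\<lambda>y. \<omega> y (b # bs)) x b)" for k
  proof -
    have "(\<Sum>bs\<in>tuples k Basis. \<theta> x bs \<bullet> fco \<omega> x bs) =
       - (\<Sum>b\<in>Basis. \<Sum>bs\<in>tuples k Basis. \<theta> x bs \<bullet> pder (\<lambda>y. \<omega> y (P x b # map (P x) bs)) x b)"
      unfolding fco_def covd_def list.map inner_minus_right inner_sum_right sum_negf
      by (subst sum.swap) (rule refl)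
    also have "\<dots> = - (\<Sum>b\<in>Basis. \<Sum>bs\<in>tuples k Basis. \<theta> x bs \<bullet> pder (\<lambda>y. \<omega> y (P x b # bs)) x b)"
      using sum_tuples_transfer[OF hform_altform[OF t x] alt P_sym[OF x], symmetric]
      by (simp add: hform_map_P[OF t x])
    also have "\<dots> = - (\<Sum>bs\<in>tuples k Basis. \<theta> x bs \<bullet> (\<Sum>b\<in>Basis. pder (\<lambda>y. \<omega> y (P x b # bs)) x b))"
      unfolding inner_sum_right by (subst sum.swap) (rule refl)
    also have "\<dots> = - (\<Sum>b\<in>Basis. \<Sum>bs\<in>tuples k Basis. \<theta> x bs \<bullet> pder (\<lambda>y. \<omega> y (b # bs)) x b)"
      unfolding sum_pder_hform[OF w x] inner_sum_right by (subst sum.swap) (rule refl)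
    finally show ?thesis .
  qed
  then show ?thesis unfolding form_ip_def by (simp add: sum_negf)
qed

lemma smooth_form_ip:
  assumes "hform_family I \<omega>" "hform_family I \<theta>"
  shows "smooth_on_set (I \<times> M) (\<lambda>z. form_ip (\<omega> (fst z) (snd z)) (\<theta> (fst z) (snd z)))"
  unfolding form_ip_def divide_inverse
  by (intro smooth_on_set_sum smooth_on_set_mult smooth_on_set_inner smooth_on_set_const
      hform_family_smooth assms)

lemma smooth_form_ip_slice:
  assumes "hform \<omega>" "hform \<theta>" shows "smooth_on_set M (\<lambda>x. form_ip (\<omega> x) (\<theta> x))"
  using smooth_slice[OF smooth_form_ip[OF hform_family_const[OF assms(1)] hform_family_const[OF assms(2)]], of 0 UNIV]
  by simp

end

section \<open>Integration over a compact submanifold\<close>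

locale compact_submanifold = submanifold M P for M :: "'e::euclidean_space set" and P +
  fixes vol :: "'e measure"
  assumes compact_M: "compact M"
    and space_vol: "space vol = M"
    and measurable_vol: "(\<lambda>x. x) \<in> vol \<rightarrow>\<^sub>M borel"
    and finite_vol: "finite_measure vol"
    and support_vol: "open U \<Longrightarrow> U \<inter> M \<noteq> {} \<Longrightarrow> emeasure vol (U \<inter> M) > 0"
begin

lemma borel_measurable_vol:
  fixes f :: "'e \<Rightarrow> real"
  assumes "continuous_on M f" shows "f \<in> borel_measurable vol"
proof -
  have "closed M" using compact_M compact_imp_closed by blast
  then have "(\<lambda>x. if x \<in> M then f x else 0) \<in> borel_measurable borel"
    using assms by (intro borel_measurable_continuous_on_if) auto
  then have "(\<lambda>x. if x \<in> M then f x else 0) \<in> borel_measurable vol"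
    by (rule measurable_compose[OF measurable_vol])
  then show ?thesis by (rule measurable_cong[THEN iffD1, rotated]) (simp add: space_vol)
qed

lemma integrable_vol:
  fixes f :: "'e \<Rightarrow> real"
  assumes "continuous_on M f" shows "integrable vol f"
proof -
  interpret finite_measure vol by (rule finite_vol)
  obtain B where "\<And>x. x \<in> M \<Longrightarrow> norm (f x) \<le> B"
    using compact_imp_bounded[OF compact_continuous_image[OF assms compact_M]] by (auto simp: bounded_iff)
  then show ?thesis
    by (intro integrable_const_bound[of _ B] borel_measurable_vol assms) (auto simp: space_vol intro!: AE_I2)
qed

lemma integrable_smooth: "smooth_on_set M f \<Longrightarrow> integrable vol f" for f :: "'e \<Rightarrow> real"
  by (intro integrable_vol smooth_on_set_continuous_on)

lemma integral_cong_M: "(\<And>x. x \<in> M \<Longrightarrow> f x = g x) \<Longrightarrow> (\<integral>x. f x \<partial>vol) = (\<integral>x. g x \<partial>vol)"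
  by (rule Bochner_Integration.integral_cong) (auto simp: space_vol)

text \<open>The set where \<open>f\<close> is positive is relatively open in \<open>M\<close>, so it
  has positive measure unless it is empty. This definiteness is what makes the codifferential
  unique.\<close>

lemma integral_eq_0_imp:
  fixes f :: "'e \<Rightarrow> real"
  assumes f: "continuous_on M f" "\<And>x. x \<in> M \<Longrightarrow> f x \<ge> 0" "(\<integral>x. f x \<partial>vol) = 0" and x: "x \<in> M"
  shows "f x = 0"
proof (rule ccontr)
  assume "f x \<noteq> 0"
  then have pos: "f x > 0" using f(2)[OF x] by simp
  have "AE x in vol. 0 \<le> f x" using f(2) by (intro AE_I2) (simp add: space_vol)
  then have fz: "AE x in vol. f x = 0"
    using integral_nonneg_eq_0_iff_AE[OF integrable_vol[OF f(1)]] f(3) by simp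
  obtain U where U: "open U" "U \<inter> M = M \<inter> f -` {0<..}"
    using f(1) continuous_on_open_invariant[of M f] open_greaterThan[of "0::real"] by (metis Int_commute)
  have ae: "AE x in vol. x \<notin> U \<inter> M" using fz by eventually_elim (use U(2) in auto)
  have Us: "U \<inter> M \<in> sets vol"
    using measurable_sets[OF measurable_vol, of U] U(1) by (simp add: space_vol vimage_def Int_def)
  have eq: "{x \<in> space vol. \<not> x \<notin> U \<inter> M} = U \<inter> M" by (auto simp: space_vol)
  have "emeasure vol (U \<inter> M) = 0"
    using AE_iff_measurable[OF Us eq] ae by simp
  moreover have "U \<inter> M \<noteq> {}" using x pos U(2) by auto
  ultimately show False using support_vol[OF U(1)] by simp
qed

text \<open>Dominated convergence for the difference quotients. The parameter derivative is bounded
  on the compact product of \<open>M\<close> with the half-size closed interval \<open>?J\<close>,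
  and this bound dominates the quotients.\<close>

lemma has_real_derivative_integral:
  fixes f :: "real \<Rightarrow> 'e \<Rightarrow> real"
  assumes \<epsilon>: "\<epsilon> > 0" and f: "smooth_on_set ({-\<epsilon><..<\<epsilon>} \<times> M) (\<lambda>z. f (fst z) (snd z))"
    and f': "\<And>x. x \<in> M \<Longrightarrow> ((\<lambda>s. f s x) has_real_derivative f' x) (at 0)"
  shows "((\<lambda>s. \<integral>x. f s x \<partial>vol) has_real_derivative (\<integral>x. f' x \<partial>vol)) (at 0)"
proof -
  let ?I = "{-\<epsilon><..<\<epsilon>}" and ?J = "{-(\<epsilon>/2)..\<epsilon>/2}"
  interpret finite_measure vol by (rule finite_vol)
  obtain U g where g: "open U" "?I \<times> M \<subseteq> U" "C_inf g U" "\<And>z. z \<in> ?I \<times> M \<Longrightarrow> g z = f (fst z) (snd z)"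
    by (rule smooth_on_setE[OF f]) (rule that)
  define h where "h z = frechet_derivative g (at z) (1, 0)" for z
  have JI: "?J \<subseteq> ?I" using \<epsilon> by auto
  have "C_inf (\<lambda>z. (1::real, 0::'e)) U"
    unfolding C_inf_def using C_k_const[OF g(1)] by blast
  then have "C_inf h U" unfolding h_def[abs_def] by (rule C_inf_frechet_derivative[OF g(1,3)])
  then have hc: "continuous_on (?I \<times> M) h"
    using C_inf_continuous_on continuous_on_subset g(2) by blast
  have hd: "((\<lambda>s. f s x) has_real_derivative h (s, x)) (at s within T)" if "s \<in> ?I" "x \<in> M" "T \<subseteq> ?I" "s \<in> T" for s x T
  proof -
    have "((\<lambda>s. (s, x)) has_derivative (\<lambda>t. (t, 0))) (at s within T)" by (auto intro!: derivative_eq_intros)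
    moreover have gd: "(g has_derivative frechet_derivative g (at (s, x))) (at (s, x))"
      by (rule C_inf_has_derivative[OF g(3)]) (use g(2) that in blast)
    ultimately have "((\<lambda>s. g (s, x)) has_derivative (\<lambda>t. frechet_derivative g (at (s, x)) (t, 0))) (at s within T)"
      by (rule has_derivative_compose)
    moreover have "frechet_derivative g (at (s, x)) (t, 0) = h (s, x) * t" for t
      using linear_scale[OF has_derivative_linear[OF gd], of t "(1, 0)"] by (simp add: h_def)
    ultimately have "((\<lambda>s. g (s, x)) has_real_derivative h (s, x)) (at s within T)"
      by (simp add: has_field_derivative_def)
    then show ?thesis
      by (rule has_field_derivative_transform_within[where d = 1]) (use that g(4) in auto)
  qed
  have "compact (?J \<times> M)" by (intro compact_Times compact_M) simp
  moreover have "?J \<times> M \<subseteq> ?I \<times> M" using JI by auto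
  ultimately have "bounded (h ` (?J \<times> M))"
    using compact_imp_bounded compact_continuous_image continuous_on_subset[OF hc] by blast
  then obtain C where C: "\<And>z. z \<in> ?J \<times> M \<Longrightarrow> norm (h z) \<le> C" by (auto simp: bounded_iff)
  have f'_eq: "f' x = h (0, x)" if "x \<in> M" for x
  proof -
    have "((\<lambda>s. f s x) has_real_derivative h (0, x)) (at 0 within ?I)" using \<epsilon> that by (intro hd) auto
    then have "((\<lambda>s. f s x) has_real_derivative h (0, x)) (at 0)"
      using \<epsilon> at_within_open[of 0 ?I] by simp
    then show ?thesis using f'[OF that] DERIV_unique by blast
  qed
  have "continuous_on M (\<lambda>x. h (0, x))"
    using \<epsilon> by (intro continuous_on_compose2[OF hc] continuous_intros) auto
  then have mf': "f' \<in> borel_measurable vol"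
    using f'_eq by (intro borel_measurable_vol) (metis (mono_tags, lifting) continuous_on_cong)
  have lip: "\<bar>f s x - f 0 x\<bar> \<le> C * \<bar>s\<bar>" if "s \<in> ?J" "x \<in> M" for s x
  proof -
    have "norm (f s x - f 0 x) \<le> C * norm (s - 0)"
    proof (rule field_differentiable_bound[of ?J])
      show "((\<lambda>s. f s x) has_real_derivative h (t, x)) (at t within ?J)" if "t \<in> ?J" for t
        using that \<open>x \<in> M\<close> JI by (intro hd) auto
    qed (use that C \<epsilon> in auto)
    then show ?thesis by simp
  qed
  have sl: "integrable vol (f s)" if "s \<in> ?I" for s
    by (rule integrable_smooth[OF smooth_slice[OF f that]])
  \<comment> \<open>Setting the quotient to zero outside \<open>?J\<close> makes the bound hold for
    every member of a null sequence and not merely eventually.\<close>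
  define q where "q s x = (if s \<in> ?J then (f s x - f 0 x) / s else 0)" for s x
  have mq: "q s \<in> borel_measurable vol" for s
  proof (cases "s \<in> ?J")
    case True
    then have "s \<in> ?I" "0 \<in> ?I" using JI \<epsilon> by auto
    then have "f s \<in> borel_measurable vol" "f 0 \<in> borel_measurable vol" using sl by auto
    then show ?thesis using True by (simp add: q_def[abs_def])
  qed (simp add: q_def[abs_def] del: atLeastAtMost_iff)
  have lim: "((\<lambda>s. \<integral>x. q s x \<partial>vol) \<longlongrightarrow> (\<integral>x. f' x \<partial>vol)) (at 0)"
    unfolding tendsto_at_iff_sequentially o_def
  proof (intro allI impI)
    fix X :: "nat \<Rightarrow> real" assume X: "\<forall>i. X i \<in> UNIV - {0}" "X \<longlonglongrightarrow> 0"
    have evJ: "\<forall>\<^sub>F s in at 0. s \<in> ?J"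
      using \<epsilon> eventually_at_in_open'[of "{-(\<epsilon>/2)<..<\<epsilon>/2}" 0] by (auto elim!: eventually_mono)
    have Xat: "filterlim X (at 0) sequentially" using X by (auto simp: filterlim_at)
    show "(\<lambda>i. \<integral>x. q (X i) x \<partial>vol) \<longlonglongrightarrow> (\<integral>x. f' x \<partial>vol)"
    proof (rule integral_dominated_convergence[where w = "\<lambda>_. \<bar>C\<bar>"])
      show "AE x in vol. (\<lambda>i. q (X i) x) \<longlonglongrightarrow> f' x"
      proof (rule AE_I2)
        fix x assume "x \<in> space vol"
        then have x: "x \<in> M" by (simp add: space_vol)
        have "((\<lambda>s. (f s x - f 0 x) / s) \<longlongrightarrow> f' x) (at 0)"
          using f'[OF x] by (simp add: has_field_derivative_iff)
        moreover have "\<forall>\<^sub>F s in at 0. (f s x - f 0 x) / s = q s x"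
          using evJ by eventually_elim (simp add: q_def)
        ultimately have "((\<lambda>s. q s x) \<longlongrightarrow> f' x) (at 0)" using tendsto_cong by fastforce
        then show "(\<lambda>i. q (X i) x) \<longlonglongrightarrow> f' x" using Xat by (rule filterlim_compose)
      qed
      show "AE x in vol. norm (q (X i) x) \<le> \<bar>C\<bar>" for i
      proof (rule AE_I2)
        fix x assume "x \<in> space vol"
        then have x: "x \<in> M" by (simp add: space_vol)
        have "X i \<noteq> 0" using X(1) by auto
        then show "norm (q (X i) x) \<le> \<bar>C\<bar>"
          using lip[of "X i" x] x by (auto simp: q_def divide_le_eq abs_mult intro: order_trans[OF _ mult_right_mono[OF abs_ge_self]])
      qed
    qed (use mq mf' in auto)
  qed
  have "\<forall>\<^sub>F s in at 0. (\<integral>x. q s x \<partial>vol) = ((\<integral>x. f s x \<partial>vol) - (\<integral>x. f 0 x \<partial>vol)) / (s - 0)"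
  proof -
    have "\<forall>\<^sub>F s in at 0. s \<in> {-(\<epsilon>/2)<..<\<epsilon>/2}"
      using \<epsilon> by (intro eventually_at_in_open') auto
    then show ?thesis
    proof eventually_elim
      fix s assume s: "s \<in> {-(\<epsilon>/2)<..<\<epsilon>/2}"
      then have "integrable vol (f s)" "integrable vol (f 0)" using \<epsilon> by (auto intro!: sl)
      then show "(\<integral>x. q s x \<partial>vol) = ((\<integral>x. f s x \<partial>vol) - (\<integral>x. f 0 x \<partial>vol)) / (s - 0)"
        using s by (simp add: q_def)
    qed
  qed
  from tendsto_cong[OF this] lim show ?thesis by (simp add: has_field_derivative_iff)
qed

end

text \<open>For the Riemannian volume, \<open>H\<close> is minus the trace of the second fundamental
  form in the ambient space, and \<open>divergence\<close> is the divergence theorem for the ambient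
  field \<open>f b\<close>, tangential part and normal part together.\<close>

locale closed_submanifold = compact_submanifold M P vol
  for M :: "'e::euclidean_space set" and P vol +
  fixes H :: "'e \<Rightarrow> 'e"
  assumes smooth_H: "smooth_on_set M H"
    and H_normal: "x \<in> M \<Longrightarrow> P x (H x) = 0"
    and divergence: "smooth_on_set M f \<Longrightarrow> b \<in> Basis \<Longrightarrow>
      (\<integral>x. pder f x b \<partial>vol) = (\<integral>x. (H x \<bullet> b) * f x \<partial>vol)"
begin

text \<open>The difference of the integrands is a sum of derivatives of products. By
  \<open>divergence\<close> it integrates to a pairing in which \<omega> has \<open>H\<close> in its
  first slot, and forms vanish on normal vectors.\<close>

lemma fext_fco_adjoint:
  assumes t: "hform \<theta>" and w: "hform \<omega>"
  shows "(\<integral>x. form_ip (fext \<theta> x) (\<omega> x) \<partial>vol) = (\<integral>x. form_ip (\<theta> x) (fco \<omega> x) \<partial>vol)"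
proof -
  let ?f = "\<lambda>b bs y. \<theta> y bs \<bullet> \<omega> y (b # bs)"
  have sf: "smooth_on_set M (?f b bs)" for b bs
    by (intro smooth_on_set_inner hform_smooth t w)
  have sp: "smooth_on_set M (\<lambda>x. pder (?f b bs) x b)" for b bs
    using smooth_slice[OF smooth_pder[OF smooth_const_family[OF sf] smooth_on_set_const], of 0 UNIV] by simp
  have sh: "smooth_on_set M (\<lambda>x. (H x \<bullet> b) * ?f b bs x)" for b bs
    by (intro smooth_on_set_mult sf smooth_on_set_inner smooth_H smooth_on_set_const)
  have "(\<integral>x. form_ip (fext \<theta> x) (\<omega> x) \<partial>vol) - (\<integral>x. form_ip (\<theta> x) (fco \<omega> x) \<partial>vol) =
      (\<integral>x. form_ip (fext \<theta> x) (\<omega> x) - form_ip (\<theta> x) (fco \<omega> x) \<partial>vol)"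
    by (intro Bochner_Integration.integral_diff[symmetric] integrable_smooth smooth_form_ip_slice hform_fext hform_fco t w)
  also have "\<dots> = (\<integral>x. (\<Sum>k\<le>DIM('e). (\<Sum>b\<in>Basis. \<Sum>bs\<in>tuples k Basis. pder (?f b bs) x b) / fact k) \<partial>vol)"
  proof (rule integral_cong_M)
    fix x assume x: "x \<in> M"
    show "form_ip (fext \<theta> x) (\<omega> x) - form_ip (\<theta> x) (fco \<omega> x) =
      (\<Sum>k\<le>DIM('e). (\<Sum>b\<in>Basis. \<Sum>bs\<in>tuples k Basis. pder (?f b bs) x b) / fact k)"
      unfolding form_ip_fext[OF t w x] form_ip_fco[OF t w x]
        pder_bilinear[OF bounded_bilinear_inner hform_smooth[OF t] hform_smooth[OF w] x]
      by (simp add: sum.distrib add_divide_distrib)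
  qed
  also have "\<dots> = (\<Sum>k\<le>DIM('e). (\<Sum>b\<in>Basis. \<Sum>bs\<in>tuples k Basis. (\<integral>x. pder (?f b bs) x b \<partial>vol)) / fact k)"
    by (simp add: Bochner_Integration.integral_sum integrable_smooth sp)
  also have "\<dots> = (\<Sum>k\<le>DIM('e). (\<Sum>b\<in>Basis. \<Sum>bs\<in>tuples k Basis. (\<integral>x. (H x \<bullet> b) * ?f b bs x \<partial>vol)) / fact k)"
    by (simp add: divergence[OF sf])
  also have "\<dots> = (\<integral>x. (\<Sum>k\<le>DIM('e). (\<Sum>b\<in>Basis. \<Sum>bs\<in>tuples k Basis. (H x \<bullet> b) * ?f b bs x) / fact k) \<partial>vol)"
    by (simp add: Bochner_Integration.integral_sum integrable_smooth sh)
  also have "\<dots> = (\<integral>x. 0 \<partial>vol)"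
  proof (rule integral_cong_M)
    fix x assume x: "x \<in> M"
    have "(\<Sum>b\<in>Basis. (H x \<bullet> b) * ?f b bs x) = 0" for bs
    proof -
      have lin: "linear (\<lambda>v. \<omega> x (v # bs))" by (rule altform_linear_hd[OF hform_altform[OF w x]])
      have "(\<Sum>b\<in>Basis. (H x \<bullet> b) * ?f b bs x) = \<theta> x bs \<bullet> \<omega> x ((\<Sum>b\<in>Basis. (H x \<bullet> b) *\<^sub>R b) # bs)"
        by (simp only: linear_sum[OF lin] linear_scale[OF lin] inner_sum_right inner_scaleR_right)
      also have "\<dots> = \<theta> x bs \<bullet> \<omega> x (P x (H x) # bs)"
        by (simp only: euclidean_representation hform_Cons_P[OF w x])
      finally show ?thesis by (simp add: H_normal[OF x] linear_0[OF lin])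
    qed
    then show "(\<Sum>k\<le>DIM('e). (\<Sum>b\<in>Basis. \<Sum>bs\<in>tuples k Basis. (H x \<bullet> b) * ?f b bs x) / fact k) = 0"
      by (subst sum.swap) simp
  qed
  finally show ?thesis by simp
qed

lemma fdirac_self_adjoint:
  assumes t: "hform \<theta>" and w: "hform \<omega>"
  shows "(\<integral>x. form_ip (fdirac \<theta> x) (\<omega> x) \<partial>vol) = (\<integral>x. form_ip (\<theta> x) (fdirac \<omega> x) \<partial>vol)"
proof -
  note int = integrable_smooth smooth_form_ip_slice hform_fext hform_fco t w
  have "(\<integral>x. form_ip (fdirac \<theta> x) (\<omega> x) \<partial>vol) =
      (\<integral>x. form_ip (fco \<theta> x) (\<omega> x) \<partial>vol) + (\<integral>x. form_ip (fext \<theta> x) (\<omega> x) \<partial>vol)"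
    unfolding fdirac_def form_ip_add_left by (intro Bochner_Integration.integral_add int)
  also have "\<dots> = (\<integral>x. form_ip (\<theta> x) (fext \<omega> x) \<partial>vol) + (\<integral>x. form_ip (\<theta> x) (fco \<omega> x) \<partial>vol)"
    using fext_fco_adjoint[OF w t] fext_fco_adjoint[OF t w] by (simp add: form_ip_commute)
  also have "\<dots> = (\<integral>x. form_ip (\<theta> x) (fdirac \<omega> x) \<partial>vol)"
    unfolding fdirac_def form_ip_add_right add.commute[of "\<integral>x. form_ip (\<theta> x) (fext \<omega> x) \<partial>vol"]
    by (intro Bochner_Integration.integral_add[symmetric] int)
  finally show ?thesis .
qed

end

section \<open>Spheres\<close>

text \<open>The great circle through \<open>y\<close> with velocity \<open>v\<close>. For
  \<open>v = 0\<close> the division by zero is harmless: the sine vanishes and the curve is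
  constant.\<close>

definition sphere_curve :: "real \<Rightarrow> 'a::real_normed_vector \<Rightarrow> 'a \<Rightarrow> real \<Rightarrow> 'a" where
  "sphere_curve R y v t = cos (norm v / R * t) *\<^sub>R y + sin (norm v / R * t) *\<^sub>R ((R / norm v) *\<^sub>R v)"

lemma norm_sphere_curve:
  fixes y v :: "'a::euclidean_space"
  assumes "R > 0" "norm y = R" "v \<bullet> y = 0"
  shows "norm (sphere_curve R y v t) = R"
proof (cases "v = 0")
  case False
  let ?c = "cos (norm v / R * t)" and ?s = "sin (norm v / R * t)"
  have yy: "y \<bullet> y = R\<^sup>2" using assms(2) power2_norm_eq_inner[of y] by simp
  have yv: "y \<bullet> v = 0" using assms(3) by (simp add: inner_commute)
  have vv: "R / norm v * (R / norm v * (v \<bullet> v)) = R\<^sup>2"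
    using False unfolding power2_norm_eq_inner[symmetric] power2_eq_square by simp
  have "(norm (sphere_curve R y v t))\<^sup>2 = ?c * (?c * (y \<bullet> y)) + ?s * (?s * (R / norm v * (R / norm v * (v \<bullet> v))))"
    unfolding power2_norm_eq_inner sphere_curve_def
    by (simp add: inner_add_left inner_add_right yv assms(3))
  also have "\<dots> = R\<^sup>2 * (?c\<^sup>2 + ?s\<^sup>2)" unfolding vv yy power2_eq_square distrib_left
    by (simp only: mult.assoc mult.commute mult.left_commute)
  finally have "(norm (sphere_curve R y v t))\<^sup>2 = R\<^sup>2" by simp
  then show ?thesis using assms(1) by (simp add: power2_eq_iff_nonneg)
qed (simp add: sphere_curve_def assms(2))

lemma sphere_curve_0 [simp]: "sphere_curve R y v 0 = y"
  by (simp add: sphere_curve_def)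

lemma sphere_curve_has_vector_derivative:
  fixes y v :: "'a::euclidean_space"
  assumes "R > 0" shows "(sphere_curve R y v has_vector_derivative v) (at 0)"
proof -
  have 1: "((\<lambda>t. cos (c * t) *\<^sub>R y + sin (c * t) *\<^sub>R w) has_derivative (\<lambda>s. s *\<^sub>R (c *\<^sub>R w))) (at 0)" for c w
    by (auto intro!: derivative_eq_intros)
  have "(norm v / R) *\<^sub>R ((R / norm v) *\<^sub>R v) = v" using assms by (cases "v = 0") simp_all
  then show ?thesis
    unfolding sphere_curve_def[abs_def] has_vector_derivative_def
    using 1[of "norm v / R" "(R / norm v) *\<^sub>R v"] by simp
qed

lemma smooth_sphere_curve: "smooth_on_set S (sphere_curve R y (v::'a::euclidean_space))"
  unfolding sphere_curve_def[abs_def] by (rule smooth_on_set_cos_sin)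

text \<open>Differentiates the constant squared norm of \<open>h\<close> along a curve in
  \<open>M\<close>. The map \<open>h\<close> is the identity for a sphere and a coordinate
  projection for the torus.\<close>

lemma tangent_space_inner_zero:
  fixes h :: "'a::euclidean_space \<Rightarrow> 'b::euclidean_space"
  assumes h: "bounded_linear h" and const: "\<And>y. y \<in> M \<Longrightarrow> norm (h y) = R"
    and v: "v \<in> tangent_space M x"
  shows "h v \<bullet> h x = 0"
proof -
  obtain \<epsilon> \<gamma> where \<gamma>: "\<epsilon> > 0" "\<gamma> ` {-\<epsilon><..<\<epsilon>} \<subseteq> M" "\<gamma> (0::real) = x" "(\<gamma> has_vector_derivative v) (at 0)"
    using v unfolding tangent_space_def by blast
  have "((\<lambda>t. h (\<gamma> t)) has_vector_derivative h v) (at 0)"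
    by (rule bounded_linear.has_vector_derivative[OF h \<gamma>(4)])
  then have "((\<lambda>t. h (\<gamma> t) \<bullet> h (\<gamma> t)) has_derivative (\<lambda>t. h x \<bullet> (t *\<^sub>R h v) + (t *\<^sub>R h v) \<bullet> h x)) (at 0)"
    using has_derivative_inner \<gamma>(3) unfolding has_vector_derivative_def by fastforce
  moreover have "((\<lambda>t. h (\<gamma> t) \<bullet> h (\<gamma> t)) has_derivative (\<lambda>t. 0)) (at 0)"
  proof (rule has_derivative_transform_within_open[of "\<lambda>_. R\<^sup>2" _ 0 UNIV "{-\<epsilon><..<\<epsilon>}"])
    show "R\<^sup>2 = h (\<gamma> t) \<bullet> h (\<gamma> t)" if "t \<in> {-\<epsilon><..<\<epsilon>}" for t
    proof -
      have "\<gamma> t \<in> M" using \<gamma>(2) that by blast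
      then show ?thesis using const by (simp flip: power2_norm_eq_inner)
    qed
  qed (use \<gamma>(1) in auto)
  ultimately have "(\<lambda>t. h x \<bullet> (t *\<^sub>R h v) + (t *\<^sub>R h v) \<bullet> h x) = (\<lambda>t::real. 0)"
    by (rule has_derivative_unique)
  from fun_cong[OF this, of 1] show ?thesis by (simp add: inner_commute)
qed

lemma tangent_space_sphere:
  fixes y :: "'a::euclidean_space"
  assumes "R > 0" "norm y = R"
  shows "tangent_space (sphere 0 R) y = {v. v \<bullet> y = 0}"
proof
  show "tangent_space (sphere 0 R) y \<subseteq> {v. v \<bullet> y = 0}"
    using tangent_space_inner_zero[of "\<lambda>x. x" "sphere 0 R" R] by auto
  show "{v. v \<bullet> y = 0} \<subseteq> tangent_space (sphere 0 R) y"
  proof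
    fix v assume "v \<in> {v. v \<bullet> y = 0}"
    then have "v \<bullet> y = 0" by simp
    then have "sphere_curve R y v ` {-1<..<1} \<subseteq> sphere 0 R"
      using norm_sphere_curve[OF assms] by auto
    then show "v \<in> tangent_space (sphere 0 R) y"
      unfolding tangent_space_def
      by (intro CollectI exI[of _ "1::real"] exI[of _ "sphere_curve R y v"] conjI
          smooth_sphere_curve sphere_curve_has_vector_derivative[OF assms(1)]) simp_all
  qed
qed

lemma orth_proj_sphere:
  fixes y :: "'a::euclidean_space"
  assumes "norm y = 1" shows "orth_proj (tangent_space (sphere 0 1) y) v = nproj y v"
  unfolding orth_proj_def tangent_space_sphere[OF zero_less_one assms]
proof (rule the_equality)
  show "nproj y v \<in> {v. v \<bullet> y = 0} \<and> (\<forall>u\<in>{v. v \<bullet> y = 0}. (v - nproj y v) \<bullet> u = 0)"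
    using nproj_orthogonal[OF assms] by (auto simp: nproj_def inner_commute)
next
  fix w assume w: "w \<in> {v. v \<bullet> y = 0} \<and> (\<forall>u\<in>{v. v \<bullet> y = 0}. (v - w) \<bullet> u = 0)"
  have "(nproj y v - w) \<bullet> y = 0" using w nproj_orthogonal[OF assms] by (simp add: inner_diff_left)
  then have "(v - w) \<bullet> (nproj y v - w) = 0" and "(nproj y v - v) \<bullet> (nproj y v - w) = 0"
    using w by (auto simp: nproj_def inner_commute)
  then have "(nproj y v - w) \<bullet> (nproj y v - w) = 0"
    using inner_add_left[of "v - w" "nproj y v - v" "nproj y v - w"] by simp
  then show "w = nproj y v" by simp
qed

section \<open>Forms along maps into the unit sphere\<close>

lemma form_ip_nproj:
  "form_ip (\<lambda>vs. nproj y (f vs)) g = form_ip f (\<lambda>vs. nproj y (g vs))"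
  by (simp add: form_ip_def nproj_sym)

lemma form_ip_cong: "(\<And>vs. f vs = f' vs) \<Longrightarrow> (\<And>vs. g vs = g' vs) \<Longrightarrow> form_ip f g = form_ip f' g'"
  by (simp add: form_ip_def)

definition zero_form :: "('e \<Rightarrow> 'f::zero) \<Rightarrow> 'e \<Rightarrow> 'e list \<Rightarrow> 'f" where
  "zero_form \<phi> x vs = (if vs = [] then \<phi> x else 0)"

lemma altform_zero_form: "altform (zero_form \<phi> x)"
  by (auto simp: altform_def zero_form_def)

context submanifold
begin

lemma hform_family_zero_form:
  assumes "smooth_on_set (I \<times> M) (\<lambda>z. \<phi> (fst z) (snd z))"
  shows "hform_family I (\<lambda>s. zero_form (\<phi> s))"
  unfolding hform_family_def
proof (intro conjI ballI allI)
  show "smooth_on_set (I \<times> M) (\<lambda>z. zero_form (\<phi> (fst z)) (snd z) vs)" for vs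
    using assms by (cases "vs = []") (simp_all add: zero_form_def smooth_on_set_const)
qed (simp_all add: altform_zero_form zero_form_def)

lemma hform_zero_form: "smooth_on_set M \<phi> \<Longrightarrow> hform (zero_form \<phi>)"
  using hform_of_family[OF hform_family_zero_form[of "{0}" "\<lambda>_. \<phi>"]] smooth_const_family by blast

lemma fext_zero_form:
  assumes x: "x \<in> M"
  shows "fext (zero_form \<phi>) x vs = (case vs of [v] \<Rightarrow> pder \<phi> x v | _ \<Rightarrow> 0)"
proof (cases vs)
  case (Cons v ws)
  show ?thesis
  proof (cases ws)
    case Nil
    then show ?thesis using Cons by (simp add: fext_def covd_def zero_form_def)
  next
    case (Cons w zs)
    have "covd (zero_form \<phi>) x u us = 0" if "us \<noteq> []" for u us
      using that by (simp add: covd_def zero_form_def pder_const x)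
    then have "fext (zero_form \<phi>) x vs = 0"
      unfolding fext_def asum_eq_sum using \<open>vs = v # ws\<close> Cons
      by (intro sum.neutral) (auto simp: Cons_nth_drop_Suc[symmetric] take_Cons split: nat.splits)
    then show ?thesis using \<open>vs = v # ws\<close> Cons by simp
  qed
qed (simp add: fext_def)

definition es0 :: "('e \<Rightarrow> 'f::euclidean_space) \<Rightarrow> 'e \<Rightarrow> 'e list \<Rightarrow> 'f" where
  "es0 \<phi> x vs = nproj (\<phi> x) (fco (fext (zero_form \<phi>)) x vs)"

text \<open>The index is shifted by two: \<open>es \<phi> j\<close> is the flat description of
  \<open>ES_form\<close> for \<open>r = j + 2\<close>.\<close>

primrec es :: "('e \<Rightarrow> 'f::euclidean_space) \<Rightarrow> nat \<Rightarrow> 'e \<Rightarrow> 'e list \<Rightarrow> 'f" where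
  "es \<phi> 0 = es0 \<phi>"
| "es \<phi> (Suc j) = (\<lambda>x vs. nproj (\<phi> x) (fdirac (es \<phi> j) x vs))"

text \<open>Forms that involve \<open>codiff\<close> are known only at points of \<open>M\<close>
  and on tangent vectors. The form \<open>f\<close> agrees with \<omega> there and extends it
  through \<open>P\<close>, which makes the ambient calculus applicable.\<close>

definition represents :: "('e, 'f::euclidean_space) form \<Rightarrow> ('e \<Rightarrow> 'e list \<Rightarrow> 'f) \<Rightarrow> bool" where
  "represents \<omega> f \<longleftrightarrow> hform f \<and> (\<forall>x\<in>M. \<forall>vs. set vs \<subseteq> tangent_space M x \<longrightarrow> \<omega> x vs = f x vs)"

lemma represents_hform: "represents \<omega> f \<Longrightarrow> hform f"
  and represents_eq: "represents \<omega> f \<Longrightarrow> x \<in> M \<Longrightarrow> set vs \<subseteq> tangent_space M x \<Longrightarrow> \<omega> x vs = f x vs"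
  unfolding represents_def by auto

lemma represents_map_P: "represents \<omega> f \<Longrightarrow> x \<in> M \<Longrightarrow> \<omega> x (map (P x) vs) = f x vs"
  using represents_eq[OF _ _ map_P_tangent] hform_map_P[OF represents_hform] by metis

lemma represents_refl: "hform f \<Longrightarrow> represents f f"
  by (simp add: represents_def)

lemma tangent_field_P: "tangent_field M (\<lambda>x. P x v)"
  by (simp add: tangent_field_def smooth_P P_tangent)

lemma orthonormal_frame_props:
  assumes "x \<in> M"
  shows "distinct (orthonormal_frame M x)" "pairwise orthogonal (set (orthonormal_frame M x))"
    "\<And>e. e \<in> set (orthonormal_frame M x) \<Longrightarrow> norm e = 1"
    "span (set (orthonormal_frame M x)) = tangent_space M x"
proof -
  obtain B where B: "pairwise orthogonal B" "\<And>e. e \<in> B \<Longrightarrow> norm e = 1" "independent B" "span B = tangent_space M x"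
    using orthonormal_basis_subspace[OF subspace_tangent_space[OF assms]] by metis
  obtain es where "set es = B" "distinct es"
    using finite_distinct_list independent_imp_finite[OF B(3)] by blast
  then have "\<exists>es. distinct es \<and> pairwise orthogonal (set es) \<and> (\<forall>e\<in>set es. norm e = 1) \<and>
               span (set es) = tangent_space M x" using B by blast
  from someI_ex[OF this] show "distinct (orthonormal_frame M x)" "pairwise orthogonal (set (orthonormal_frame M x))"
    "\<And>e. e \<in> set (orthonormal_frame M x) \<Longrightarrow> norm e = 1"
    "span (set (orthonormal_frame M x)) = tangent_space M x"
    unfolding orthonormal_frame_def by blast+
qed

lemma P_orthonormal_frame:
  assumes x: "x \<in> M"
  shows "P x b = (\<Sum>e\<in>set (orthonormal_frame M x). (b \<bullet> e) *\<^sub>R e)"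
proof -
  let ?E = "set (orthonormal_frame M x)"
  note fr = orthonormal_frame_props[OF x]
  have "(P x b \<bullet> e) = b \<bullet> e" if "e \<in> ?E" for e
  proof -
    have "e \<in> tangent_space M x" using fr(4) span_base[OF that] by blast
    then show ?thesis by (simp add: P_sym[OF x] P_eq[OF x])
  qed
  moreover have "(\<Sum>e\<in>?E. (P x b \<bullet> e) *\<^sub>R e) = P x b"
    by (rule orthonormal_basis_expand[OF fr(2)]) (use fr P_tangent[OF x] in auto)
  ultimately show ?thesis by simp
qed

lemma form_inner_eq:
  assumes w: "represents \<omega> f" and t: "represents \<theta> g" and x: "x \<in> M"
  shows "form_inner M \<omega> \<theta> x = form_ip (f x) (g x)"
proof -
  let ?es = "orthonormal_frame M x"
  note fr = orthonormal_frame_props[OF x]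
  have "set vs \<subseteq> tangent_space M x" if "vs \<in> set (subseqs ?es)" for vs
  proof -
    have "set vs \<in> Pow (set ?es)" using that by (simp flip: subseqs_powset)
    then show ?thesis using span_superset fr(4) by blast
  qed
  then have "form_inner M \<omega> \<theta> x = (\<Sum>vs\<leftarrow>subseqs ?es. f x vs \<bullet> g x vs)"
    unfolding form_inner_def
    by (intro arg_cong[of _ _ sum_list] map_cong refl) (simp add: represents_eq[OF w x] represents_eq[OF t x])
  also have "\<dots> = form_ip (\<lambda>vs. f x (map (P x) vs)) (\<lambda>vs. g x (map (P x) vs))"
    by (rule form_ip_orthonormal[OF hform_altform[OF represents_hform[OF w] x]
          hform_altform[OF represents_hform[OF t] x] fr(1,2,3) P_orthonormal_frame[OF x]])
  finally show ?thesis
    by (simp add: hform_map_P[OF represents_hform[OF w] x] hform_map_P[OF represents_hform[OF t] x])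
qed

end

section \<open>Identification of the covariant operators for maps into the unit sphere\<close>

locale sphere_map = closed_submanifold M P vol H
  for M :: "'e::euclidean_space set" and P vol H +
  fixes \<phi> :: "'e \<Rightarrow> 'f::euclidean_space"
  assumes smooth_phi: "smooth_on_set M \<phi>" and norm_phi: "x \<in> M \<Longrightarrow> norm (\<phi> x) = 1"
begin

abbreviation N :: "'f set" where "N \<equiv> sphere 0 1"

text \<open>Orthogonality is to the position vector \<phi>, so the values are tangent to the target
  sphere.\<close>

definition normal :: "('e \<Rightarrow> 'e list \<Rightarrow> 'f) \<Rightarrow> bool" where
  "normal f \<longleftrightarrow> (\<forall>x\<in>M. \<forall>vs. f x vs \<bullet> \<phi> x = 0)"

lemma tangent_space_N: "x \<in> M \<Longrightarrow> tangent_space N (\<phi> x) = {v. v \<bullet> \<phi> x = 0}"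
  by (intro tangent_space_sphere norm_phi) auto

lemma normal_nproj: "normal (\<lambda>x vs. nproj (\<phi> x) (f x vs))"
  by (simp add: normal_def nproj_orthogonal norm_phi)

lemma nproj_normal: "normal f \<Longrightarrow> x \<in> M \<Longrightarrow> nproj (\<phi> x) (f x vs) = f x vs"
  by (simp add: normal_def nproj_eq)

lemma smooth_forms_represents:
  assumes w: "\<omega> \<in> smooth_forms M N \<phi>"
  shows "represents \<omega> (\<lambda>x vs. \<omega> x (map (P x) vs))" "normal (\<lambda>x vs. \<omega> x (map (P x) vs))"
proof -
  let ?f = "\<lambda>x vs. \<omega> x (map (P x) vs)"
  have val: "\<omega> x vs \<in> tangent_space N (\<phi> x)" if "x \<in> M" "set vs \<subseteq> tangent_space M x" for x vs
    using w that unfolding smooth_forms_def by blast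
  have lin: "\<omega> x (us @ (a *\<^sub>R u + b *\<^sub>R v) # ws) = a *\<^sub>R \<omega> x (us @ u # ws) + b *\<^sub>R \<omega> x (us @ v # ws)"
    if "x \<in> M" "set us \<union> set ws \<union> {u, v} \<subseteq> tangent_space M x" for x us ws u v and a b :: real
    using w that unfolding smooth_forms_def by blast
  have alt: "\<omega> x vs = 0" if "x \<in> M" "set vs \<subseteq> tangent_space M x" "\<not> distinct vs" for x vs
    using w that unfolding smooth_forms_def by blast
  have sm: "smooth_on_set M (\<lambda>x. \<omega> x (map (\<lambda>X. X x) Xs))" if "\<And>X. X \<in> set Xs \<Longrightarrow> tangent_field M X" for Xs
    using w that unfolding smooth_forms_def by blast
  have "hform ?f"
    unfolding hform_def
  proof (intro conjI ballI allI)
    fix x vs assume x: "x \<in> M"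
    show "?f x (map (P x) vs) = ?f x vs" by (simp only: map_P_idem[OF x])
    show "altform (?f x)"
      unfolding altform_def
    proof (intro conjI allI impI)
      fix us ws u v and a b :: real
      show "?f x (us @ (a *\<^sub>R u + b *\<^sub>R v) # ws) = a *\<^sub>R ?f x (us @ u # ws) + b *\<^sub>R ?f x (us @ v # ws)"
        using lin[OF x, of "map (P x) us" "map (P x) ws" "P x u" "P x v" a b] P_tangent[OF x]
        by (auto simp: linear_add[OF linear_P[OF x]] linear_scale[OF linear_P[OF x]])
      show "?f x vs = 0" if "\<not> distinct vs" for vs
        using that by (intro alt x map_P_tangent) (simp add: distinct_map)
    qed
  next
    show "smooth_on_set M (\<lambda>x. ?f x vs)" for vs
      using sm[of "map (\<lambda>v x. P x v) vs"] tangent_field_P by (auto simp: o_def)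
  qed
  then show "represents \<omega> ?f" by (simp add: represents_def map_P_eq)
  show "normal ?f"
    unfolding normal_def
  proof (intro ballI allI)
    fix x vs assume x: "x \<in> M"
    show "?f x vs \<bullet> \<phi> x = 0"
      using val[OF x map_P_tangent[OF x]] by (simp add: tangent_space_N[OF x])
  qed
qed

lemma represents_smooth_forms:
  assumes w: "represents \<omega> f" and n: "normal f"
  shows "\<omega> \<in> smooth_forms M N \<phi>"
proof -
  note h = represents_hform[OF w]
  have 1: "smooth_on_set M (\<lambda>x. \<omega> x (map (\<lambda>X. X x) Xs))" if Xs: "\<And>X. X \<in> set Xs \<Longrightarrow> tangent_field M X" for Xs
  proof (rule smooth_on_set_cong)
    show "smooth_on_set M (\<lambda>x. f x (map (\<lambda>X. X x) Xs))"
      by (rule smooth_on_set_altform_args[where \<Gamma> = f, OF hform_altform[OF h] hform_smooth[OF h]])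
        (use Xs in \<open>simp_all add: tangent_field_def\<close>)
    fix x assume x: "x \<in> M"
    then show "f x (map (\<lambda>X. X x) Xs) = \<omega> x (map (\<lambda>X. X x) Xs)"
      using Xs by (intro represents_eq[OF w x, symmetric]) (auto simp: tangent_field_def)
  qed
  have 2: "\<omega> x vs \<in> tangent_space N (\<phi> x)" if "x \<in> M" "set vs \<subseteq> tangent_space M x" for x vs
    using n that by (simp add: represents_eq[OF w] tangent_space_N normal_def)
  have 3: "\<omega> x (us @ (a *\<^sub>R u + b *\<^sub>R v) # ws) = a *\<^sub>R \<omega> x (us @ u # ws) + b *\<^sub>R \<omega> x (us @ v # ws)"
    if x: "x \<in> M" and T: "set us \<union> set ws \<union> {u, v} \<subseteq> tangent_space M x" for x us ws u v and a b :: real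
  proof -
    have "a *\<^sub>R u + b *\<^sub>R v \<in> tangent_space M x"
      using T subspace_tangent_space[OF x] by (auto intro!: subspace_add subspace_scale)
    then show ?thesis
      using T altform_combination[OF hform_altform[OF h x], of us a u b v ws]
      by (simp add: represents_eq[OF w x])
  qed
  have 4: "\<omega> x vs = 0" if "x \<in> M" "set vs \<subseteq> tangent_space M x" "\<not> distinct vs" for x vs
    using that by (simp add: represents_eq[OF w] altform_not_distinct[OF hform_altform[OF h]])
  show ?thesis
    unfolding smooth_forms_def using 1 2 3 4 by (intro CollectI conjI ballI allI impI) simp_all
qed

text \<open>The extensions of \<open>ws\<close> by projection have zero covariant derivative at
  \<open>x\<close> by \<open>P_pder_P\<close>, so every Levi-Civita term is \<omega> with a zero
  argument. Only the projection of the target sphere remains.\<close>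

lemma cov_deriv_eq:
  assumes w: "represents \<omega> f" and x: "x \<in> M" and v: "v \<in> tangent_space M x"
    and ws: "set ws \<subseteq> tangent_space M x"
  shows "cov_deriv M N \<phi> \<omega> x v ws = nproj (\<phi> x) (covd f x v ws)"
proof -
  have "dir_deriv M (\<lambda>y. \<omega> y (map (orth_proj (tangent_space M y)) ws)) x = dir_deriv M (\<lambda>y. f y ws) x"
  proof (rule dir_deriv_cong[OF x])
    fix y assume y: "y \<in> M"
    then have "map (orth_proj (tangent_space M y)) ws = map (P y) ws" by (simp add: orth_proj_tangent)
    then show "\<omega> y (map (orth_proj (tangent_space M y)) ws) = f y ws"
      by (simp only: represents_map_P[OF w y])
  qed
  then have 1: "pullback_connection M N \<phi> (\<lambda>y. \<omega> y (map (orth_proj (tangent_space M y)) ws)) x v =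
      nproj (\<phi> x) (covd f x v ws)"
    unfolding pullback_connection_def
    by (simp add: orth_proj_sphere[OF norm_phi[OF x]] covd_def pder_def map_P_eq[OF x ws] P_eq[OF x v])
  have 2: "\<omega> x (ws[j := levi_civita M (\<lambda>y. orth_proj (tangent_space M y) (ws ! j)) x v]) = 0" if j: "j < length ws" for j
  proof -
    have wj: "ws ! j \<in> tangent_space M x" using ws j nth_mem by blast
    have "levi_civita M (\<lambda>y. orth_proj (tangent_space M y) (ws ! j)) x v =
        P x (dir_deriv M (\<lambda>y. P y (ws ! j)) x v)"
      unfolding levi_civita_def orth_proj_tangent[OF x]
      using dir_deriv_cong[OF x, of "\<lambda>y. orth_proj (tangent_space M y) (ws ! j)" "\<lambda>y. P y (ws ! j)"]
      by (simp add: orth_proj_tangent)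
    also have "\<dots> = 0"
      using P_pder_P[OF x, of "ws ! j" v] by (simp add: pder_def P_eq[OF x v] P_eq[OF x wj])
    finally have "ws[j := levi_civita M (\<lambda>y. orth_proj (tangent_space M y) (ws ! j)) x v] =
        take j ws @ 0 # drop (Suc j) ws" using j by (simp add: upd_conv_take_nth_drop)
    moreover have "set (take j ws @ 0 # drop (Suc j) ws) \<subseteq> tangent_space M x"
      using ws set_take_subset[of j ws] set_drop_subset[of "Suc j" ws] subspace_0[OF subspace_tangent_space[OF x]] by auto
    ultimately show ?thesis
      by (simp only: represents_eq[OF w x] altform_zero[OF hform_altform[OF represents_hform[OF w] x]])
  qed
  show ?thesis unfolding cov_deriv_def 1 using 2 by simp
qed

lemma ext_deriv_represents:
  assumes w: "represents \<omega> f"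
  shows "represents (ext_deriv M N \<phi> \<omega>) (\<lambda>x vs. nproj (\<phi> x) (fext f x vs))"
  unfolding represents_def
proof (intro conjI ballI allI impI)
  show "hform (\<lambda>x vs. nproj (\<phi> x) (fext f x vs))"
    by (intro hform_nproj hform_fext represents_hform[OF w] smooth_phi)
  fix x vs assume x: "x \<in> M" and vs: "set vs \<subseteq> tangent_space M x"
  have "cov_deriv M N \<phi> \<omega> x (vs ! i) (take i vs @ drop (Suc i) vs) =
      nproj (\<phi> x) (covd f x (vs ! i) (take i vs @ drop (Suc i) vs))" if "i < length vs" for i
    using vs that set_take_subset[of i vs] set_drop_subset[of "Suc i" vs] nth_mem[OF that]
    by (intro cov_deriv_eq[OF w x]) auto
  then show "ext_deriv M N \<phi> \<omega> x vs = nproj (\<phi> x) (fext f x vs)"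
    unfolding ext_deriv_def fext_def asum_eq_sum
    by (simp add: linear_sum[OF linear_nproj] linear_scale[OF linear_nproj])
qed

text \<open>The projected flat codifferential meets the specification by
  \<open>fext_fco_adjoint\<close>. Since \<open>codiff\<close> is merely some solution, the
  difference \<open>t\<close> of the two is taken as a test form; its squared norm integrates to
  zero, hence it vanishes.\<close>

lemma codiff_represents:
  assumes w: "represents \<omega> f" and n: "normal f"
  shows "represents (codiff M vol N \<phi> \<omega>) (\<lambda>x vs. nproj (\<phi> x) (fco f x vs))"
proof -
  let ?z = "\<lambda>x vs. nproj (\<phi> x) (fco f x vs)"
  let ?Q = "\<lambda>\<eta>. \<eta> \<in> smooth_forms M N \<phi> \<and>
        (\<forall>\<theta>\<in>smooth_forms M N \<phi>.
           (\<integral>x. form_inner M (ext_deriv M N \<phi> \<theta>) \<omega> x \<partial>vol) = (\<integral>x. form_inner M \<theta> \<eta> x \<partial>vol))"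
  note hf = represents_hform[OF w]
  have hz: "hform ?z" by (intro hform_nproj hform_fco hf smooth_phi)
  have adj: "(\<integral>x. form_inner M (ext_deriv M N \<phi> \<theta>) \<omega> x \<partial>vol) = (\<integral>x. form_ip (g x) (?z x) \<partial>vol)"
    if t: "represents \<theta> g" "normal g" for \<theta> g
  proof -
    have "(\<integral>x. form_inner M (ext_deriv M N \<phi> \<theta>) \<omega> x \<partial>vol) = (\<integral>x. form_ip (fext g x) (f x) \<partial>vol)"
      by (rule integral_cong_M)
        (simp add: form_inner_eq[OF ext_deriv_represents[OF t(1)] w] form_ip_nproj nproj_normal[OF n])
    also have "\<dots> = (\<integral>x. form_ip (g x) (fco f x) \<partial>vol)"
      by (rule fext_fco_adjoint[OF represents_hform[OF t(1)] hf])
    also have "\<dots> = (\<integral>x. form_ip (g x) (?z x) \<partial>vol)"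
      by (rule integral_cong_M) (simp add: form_ip_nproj[symmetric] nproj_normal[OF t(2)])
    finally show ?thesis .
  qed
  have "?Q ?z"
  proof (intro conjI ballI)
    show "?z \<in> smooth_forms M N \<phi>"
      by (rule represents_smooth_forms[OF represents_refl[OF hz] normal_nproj])
    fix \<theta> assume \<theta>: "\<theta> \<in> smooth_forms M N \<phi>"
    show "(\<integral>x. form_inner M (ext_deriv M N \<phi> \<theta>) \<omega> x \<partial>vol) = (\<integral>x. form_inner M \<theta> ?z x \<partial>vol)"
      unfolding adj[OF smooth_forms_represents[OF \<theta>]]
      by (rule integral_cong_M)
        (simp add: form_inner_eq[OF smooth_forms_represents(1)[OF \<theta>] represents_refl[OF hz]])
  qed
  then have Q: "?Q (codiff M vol N \<phi> \<omega>)"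
    unfolding codiff_def by (rule someI[where P = ?Q])
  define g where "g x vs = codiff M vol N \<phi> \<omega> x (map (P x) vs)" for x vs
  have g: "represents (codiff M vol N \<phi> \<omega>) g" "normal g"
    using smooth_forms_represents[OF conjunct1[OF Q]] by (simp_all add: g_def[abs_def])
  note hg = represents_hform[OF g(1)]
  define t where "t x vs = g x vs + (-1) *\<^sub>R ?z x vs" for x vs
  have mz: "hform (\<lambda>x vs. (-1) *\<^sub>R ?z x vs)"
    using hz unfolding hform_def
    by (auto intro!: altform_minus smooth_on_set_minus)
  have ht: "hform t" unfolding t_def[abs_def] by (rule hform_add[OF hg mz])
  have nt: "normal t" using g(2) normal_nproj[of "fco f"] unfolding normal_def t_def by (simp add: inner_diff_left)
  have "(\<integral>x. form_ip (t x) (g x) \<partial>vol) = (\<integral>x. form_inner M (ext_deriv M N \<phi> t) \<omega> x \<partial>vol)"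
    using Q represents_smooth_forms[OF represents_refl[OF ht] nt]
      integral_cong_M[OF form_inner_eq[OF represents_refl[OF ht] g(1)]] by simp
  also have "\<dots> = (\<integral>x. form_ip (t x) (?z x) \<partial>vol)" by (rule adj[OF represents_refl[OF ht] nt])
  finally have eq: "(\<integral>x. form_ip (t x) (g x) \<partial>vol) = (\<integral>x. form_ip (t x) (?z x) \<partial>vol)" .
  have "(\<integral>x. form_ip (t x) (t x) \<partial>vol) = (\<integral>x. form_ip (t x) (g x) - form_ip (t x) (?z x) \<partial>vol)"
  proof (rule integral_cong_M)
    fix x
    have tx: "t x = (\<lambda>vs. g x vs - ?z x vs)" by (simp add: t_def fun_eq_iff)
    have "form_ip (t x) (\<lambda>vs. g x vs - ?z x vs) = form_ip (t x) (g x) - form_ip (t x) (?z x)"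
      by (simp add: form_ip_commute[of "t x"] form_ip_diff_left)
    then show "form_ip (t x) (t x) = form_ip (t x) (g x) - form_ip (t x) (?z x)" by (simp only: tx[symmetric])
  qed
  also have "\<dots> = (\<integral>x. form_ip (t x) (g x) \<partial>vol) - (\<integral>x. form_ip (t x) (?z x) \<partial>vol)"
    by (intro Bochner_Integration.integral_diff integrable_smooth smooth_form_ip_slice ht hg hz)
  finally have "(\<integral>x. form_ip (t x) (t x) \<partial>vol) = 0" using eq by simp
  then have "form_ip (t x) (t x) = 0" if "x \<in> M" for x
    using that by (intro integral_eq_0_imp[of "\<lambda>x. form_ip (t x) (t x)"] form_ip_nonneg
        smooth_on_set_continuous_on smooth_form_ip_slice ht) auto
  then have "t x vs = 0" if "x \<in> M" for x vs
    using form_ip_eq_0[OF hform_altform[OF ht that]] that by blast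
  then have "g x vs = ?z x vs" if "x \<in> M" for x vs using that by (simp add: t_def)
  then show ?thesis using g(1) hz unfolding represents_def by simp
qed

lemma hform_es: "hform (es \<phi> j)"
proof (induction j)
  case 0
  then show ?case unfolding es.simps es0_def[abs_def]
    by (intro hform_nproj hform_fco hform_fext hform_zero_form smooth_phi)
next
  case (Suc j)
  then show ?case unfolding es.simps by (intro hform_nproj hform_fdirac smooth_phi)
qed

lemma normal_es: "normal (es \<phi> j)"
  by (cases j) (simp_all add: normal_nproj es0_def[abs_def])

lemma pder_phi: "x \<in> M \<Longrightarrow> pder \<phi> x v \<bullet> \<phi> x = 0"
proof -
  assume x: "x \<in> M"
  have "pder (\<lambda>y. \<phi> y \<bullet> \<phi> y) x v = pder (\<lambda>y. 1) x v"
    by (rule pder_cong[OF x]) (simp add: norm_phi dot_square_norm)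
  then show ?thesis
    by (simp add: pder_bilinear[OF bounded_bilinear_inner smooth_phi smooth_phi x] pder_const[OF x] inner_commute)
qed

lemma normal_fext_phi: "normal (fext (zero_form \<phi>))"
  unfolding normal_def by (auto simp: fext_zero_form pder_phi split: list.splits)

lemma map_differential_represents: "represents (map_differential M \<phi>) (fext (zero_form \<phi>))"
  unfolding represents_def
  by (auto intro!: hform_fext hform_zero_form smooth_phi split: list.splits
      simp: map_differential_def fext_zero_form pder_def P_eq)

lemma tension_eq: "x \<in> M \<Longrightarrow> tension M vol N \<phi> x = - es0 \<phi> x []"
  unfolding tension_def es0_def
  using represents_eq[OF codiff_represents[OF map_differential_represents normal_fext_phi], of x "[]"] by simp

lemma es0_Cons: "x \<in> M \<Longrightarrow> es0 \<phi> x (v # vs) = 0"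
proof -
  assume x: "x \<in> M"
  have "covd (fext (zero_form \<phi>)) x b (b # v # vs) = pder (\<lambda>y. 0) x b" for b
    unfolding covd_def by (rule pder_cong[OF x]) (simp add: fext_zero_form)
  then show ?thesis
    unfolding es0_def fco_def by (simp add: pder_const[OF x] linear_0[OF linear_nproj])
qed

lemma ES_form_represents: "represents (ES_form M vol N r \<phi>) (es \<phi> (r - 2))"
proof -
  have "represents (((\<lambda>\<omega> x vs. codiff M vol N \<phi> \<omega> x vs + ext_deriv M N \<phi> \<omega> x vs) ^^ j)
       (\<lambda>x vs. if vs = [] then - tension M vol N \<phi> x else 0)) (es \<phi> j)" for j
  proof (induction j)
    case 0
    have "(if vs = [] then - tension M vol N \<phi> x else 0) = es0 \<phi> x vs" if "x \<in> M" for x vs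
      using that by (cases vs) (simp_all add: tension_eq es0_Cons)
    then show ?case using hform_es[of 0] by (simp add: represents_def)
  next
    case (Suc j)
    show ?case
      using represents_eq[OF codiff_represents[OF Suc.IH normal_es]]
        represents_eq[OF ext_deriv_represents[OF Suc.IH]] hform_es[of "Suc j"]
      by (simp add: represents_def fdirac_def linear_add[OF linear_nproj])
  qed
  then show ?thesis unfolding ES_form_def .
qed

lemma ES_energy_eq: "ES_energy M vol N r \<phi> = 1 / 2 * (\<integral>x. form_ip (es \<phi> (r - 2) x) (es \<phi> (r - 2) x) \<partial>vol)"
  unfolding ES_energy_def
  using integral_cong_M[OF form_inner_eq[OF ES_form_represents ES_form_represents]] by simp

end

section \<open>The first variation\<close>

lemma has_real_derivative_form_ip:
  fixes f g :: "real \<Rightarrow> 'e::euclidean_space list \<Rightarrow> 'f::real_inner"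
  assumes "\<And>bs. ((\<lambda>s. f s bs) has_vector_derivative f' bs) (at a)"
    and "\<And>bs. ((\<lambda>s. g s bs) has_vector_derivative g' bs) (at a)"
  shows "((\<lambda>s. form_ip (f s) (g s)) has_real_derivative form_ip (f a) g' + form_ip f' (g a)) (at a)"
proof -
  have "((\<lambda>s. \<Sum>k\<le>DIM('e). (\<Sum>bs\<in>tuples k Basis. f s bs \<bullet> g s bs) / fact k) has_vector_derivative
      (\<Sum>k\<le>DIM('e). (\<Sum>bs\<in>tuples k Basis. f a bs \<bullet> g' bs + f' bs \<bullet> g a bs) / fact k)) (at a)"
    by (intro has_vector_derivative_sum has_vector_derivative_divide
        bounded_bilinear.has_vector_derivative[OF bounded_bilinear_inner] assms)
  then show ?thesis
    unfolding form_ip_def has_real_derivative_iff_has_vector_derivative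
    by (simp add: sum.distrib add_divide_distrib)
qed

lemma form_ip_zero_form:
  fixes a :: "'e::euclidean_space \<Rightarrow> 'f::real_inner"
  shows "form_ip (zero_form a x) g = a x \<bullet> g []"
proof -
  have "(\<Sum>bs\<in>tuples k Basis. zero_form a x bs \<bullet> g bs) / fact k = (if k = 0 then a x \<bullet> g [] else 0)"
    for k
  proof (cases "k = 0")
    case False
    then have "(\<Sum>bs\<in>tuples k Basis. zero_form a x bs \<bullet> g bs) = 0"
      by (intro sum.neutral) (auto simp: tuples_def zero_form_def)
    with False show ?thesis by simp
  qed (simp add: zero_form_def)
  then show ?thesis unfolding form_ip_def by simp
qed

lemma form_ip_nproj_left:
  "form_ip (\<lambda>vs. nproj y (f vs)) g = form_ip f g - form_ip (\<lambda>vs. f vs \<bullet> y) (\<lambda>vs. g vs \<bullet> y)"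
proof -
  have "nproj y (f bs) \<bullet> g bs = f bs \<bullet> g bs - (f bs \<bullet> y) * (g bs \<bullet> y)" for bs
    by (simp add: nproj_def inner_diff_left inner_commute[of y])
  then show ?thesis unfolding form_ip_def by (simp add: sum_subtractf diff_divide_distrib)
qed

lemma form_ip_0_left: "form_ip (\<lambda>vs. 0) g = 0"
  and form_ip_0_right: "form_ip g (\<lambda>vs. 0) = 0"
  by (simp_all add: form_ip_def)

context closed_submanifold
begin

lemma smooth_has_vector_derivative:
  fixes f :: "real \<Rightarrow> 'e \<Rightarrow> 'f::euclidean_space"
  assumes f: "smooth_on_set ({-\<epsilon><..<\<epsilon>} \<times> M) (\<lambda>z. f (fst z) (snd z))" and "\<epsilon> > 0" and x: "x \<in> M"
  shows "((\<lambda>s. f s x) has_vector_derivative vector_derivative (\<lambda>s. f s x) (at 0)) (at 0)"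
proof -
  let ?I = "{-\<epsilon><..<\<epsilon>}"
  have "smooth_on_set ?I (\<lambda>s. f s x)"
    using smooth_on_set_compose[OF f smooth_on_set_Pair[OF smooth_on_set_id[of ?I] smooth_on_set_const[of ?I x]]] x
    by auto
  then have "((\<lambda>s. f s x) has_derivative dir_deriv ?I (\<lambda>s. f s x) 0) (at 0 within ?I)"
    using assms(2) by (intro smooth_has_derivative) auto
  moreover have "at 0 within ?I = at 0" using assms(2) by (intro at_within_open) auto
  ultimately have "(\<lambda>s. f s x) differentiable (at 0)" unfolding differentiable_def by auto
  then show ?thesis by (simp add: vector_derivative_works)
qed

text \<open>By symmetry, differentiating both factors gives twice the derivative with one factor
  frozen at parameter 0, which the factor 1/2 compensates. Only pairings with a fixed form have to
  be differentiated afterwards.\<close>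

lemma energy_derivative:
  assumes \<epsilon>: "\<epsilon> > 0" and w: "hform_family {-\<epsilon><..<\<epsilon>} \<omega>"
    and B: "((\<lambda>s. \<integral>x. form_ip (\<omega> 0 x) (\<omega> s x) \<partial>vol) has_real_derivative B) (at 0)"
  shows "((\<lambda>s. 1 / 2 * (\<integral>x. form_ip (\<omega> s x) (\<omega> s x) \<partial>vol)) has_real_derivative B) (at 0)"
proof -
  let ?I = "{-\<epsilon><..<\<epsilon>}"
  define w' where "w' x vs = vector_derivative (\<lambda>s. \<omega> s x vs) (at 0)" for x vs
  have w': "((\<lambda>s. \<omega> s x vs) has_vector_derivative w' x vs) (at 0)" if "x \<in> M" for x vs
    unfolding w'_def by (rule smooth_has_vector_derivative[OF hform_family_smooth[OF w] \<epsilon> that])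
  have w0: "hform (\<omega> 0)" using hform_family_slice[OF w] \<epsilon> by auto
  have "((\<lambda>s. \<integral>x. form_ip (\<omega> 0 x) (\<omega> s x) \<partial>vol) has_real_derivative (\<integral>x. form_ip (\<omega> 0 x) (w' x) \<partial>vol)) (at 0)"
  proof (rule has_real_derivative_integral[OF \<epsilon>])
    show "smooth_on_set (?I \<times> M) (\<lambda>z. form_ip (\<omega> 0 (snd z)) (\<omega> (fst z) (snd z)))"
      by (rule smooth_form_ip[OF hform_family_const[OF w0] w])
    fix x assume x: "x \<in> M"
    from has_real_derivative_form_ip[of "\<lambda>s. \<omega> 0 x" "\<lambda>_. 0" 0 "\<lambda>s. \<omega> s x" "w' x", OF has_vector_derivative_const w'[OF x]]
    show "((\<lambda>s. form_ip (\<omega> 0 x) (\<omega> s x)) has_real_derivative form_ip (\<omega> 0 x) (w' x)) (at 0)"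
      by (simp add: form_ip_0_left)
  qed
  then have Beq: "B = (\<integral>x. form_ip (\<omega> 0 x) (w' x) \<partial>vol)" using B DERIV_unique by blast
  have "((\<lambda>s. \<integral>x. form_ip (\<omega> s x) (\<omega> s x) \<partial>vol) has_real_derivative (\<integral>x. 2 * form_ip (\<omega> 0 x) (w' x) \<partial>vol)) (at 0)"
  proof (rule has_real_derivative_integral[OF \<epsilon>])
    show "smooth_on_set (?I \<times> M) (\<lambda>z. form_ip (\<omega> (fst z) (snd z)) (\<omega> (fst z) (snd z)))"
      by (rule smooth_form_ip[OF w w])
    fix x assume x: "x \<in> M"
    from has_real_derivative_form_ip[of "\<lambda>s. \<omega> s x" "w' x" 0 "\<lambda>s. \<omega> s x" "w' x", OF w'[OF x] w'[OF x]]
    show "((\<lambda>s. form_ip (\<omega> s x) (\<omega> s x)) has_real_derivative 2 * form_ip (\<omega> 0 x) (w' x)) (at 0)"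
      by (simp add: form_ip_commute[of "w' x"])
  qed
  from DERIV_cmult[OF this, of "1 / 2"] show ?thesis by (simp add: Beq)
qed

text \<open>
  Only the projection depends on the parameter. Splitting it as the projection at \<open>0\<close> plus a
  remainder that vanishes at \<open>0\<close>, the derivative of \<open>\<eta>\<close> never enters the remainder term.
\<close>

lemma nproj_variation:
  fixes \<Phi> :: "real \<Rightarrow> 'e \<Rightarrow> 'f::euclidean_space"
  assumes \<epsilon>: "\<epsilon> > 0" and \<Phi>: "smooth_on_set ({-\<epsilon><..<\<epsilon>} \<times> M) (\<lambda>z. \<Phi> (fst z) (snd z))"
    and V: "\<And>x. x \<in> M \<Longrightarrow> ((\<lambda>s. \<Phi> s x) has_vector_derivative V x) (at 0)"
    and Z: "hform Z" and \<eta>: "hform_family {-\<epsilon><..<\<epsilon>} \<eta>"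
    and B: "((\<lambda>s. \<integral>x. form_ip (\<lambda>vs. nproj (\<Phi> 0 x) (Z x vs)) (\<eta> s x) \<partial>vol) has_real_derivative B) (at 0)"
  shows "((\<lambda>s. \<integral>x. form_ip (Z x) (\<lambda>vs. nproj (\<Phi> s x) (\<eta> s x vs)) \<partial>vol) has_real_derivative
    B - (\<integral>x. form_ip (\<lambda>vs. Z x vs \<bullet> V x) (\<lambda>vs. \<eta> 0 x vs \<bullet> \<Phi> 0 x) +
              form_ip (\<lambda>vs. Z x vs \<bullet> \<Phi> 0 x) (\<lambda>vs. \<eta> 0 x vs \<bullet> V x) \<partial>vol)) (at 0)"
proof -
  let ?I = "{-\<epsilon><..<\<epsilon>}"
  have s0: "(0::real) \<in> ?I" using \<epsilon> by simp
  define \<eta>' where "\<eta>' x vs = vector_derivative (\<lambda>s. \<eta> s x vs) (at 0)" for x vs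
  have \<eta>': "((\<lambda>s. \<eta> s x vs) has_vector_derivative \<eta>' x vs) (at 0)" if "x \<in> M" for x vs
    unfolding \<eta>'_def by (rule smooth_has_vector_derivative[OF hform_family_smooth[OF \<eta>] \<epsilon> that])
  let ?p = "\<lambda>t s x. form_ip (\<lambda>vs. Z x vs \<bullet> \<Phi> t x) (\<lambda>vs. \<eta> s x vs \<bullet> \<Phi> t x)"
  let ?c = "\<lambda>x. form_ip (\<lambda>vs. Z x vs \<bullet> V x) (\<lambda>vs. \<eta> 0 x vs \<bullet> \<Phi> 0 x) +
              form_ip (\<lambda>vs. Z x vs \<bullet> \<Phi> 0 x) (\<lambda>vs. \<eta> 0 x vs \<bullet> V x)"
  have \<Phi>0: "smooth_on_set M (\<Phi> 0)" by (rule smooth_slice[OF \<Phi> s0])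
  have sm1: "smooth_on_set (?I \<times> M) (\<lambda>z. ?p 0 (fst z) (snd z))"
    unfolding form_ip_def divide_inverse
    by (intro smooth_on_set_sum smooth_on_set_mult smooth_on_set_inner smooth_on_set_const
        smooth_const_family[OF hform_smooth[OF Z]] hform_family_smooth[OF \<eta>] smooth_const_family[OF \<Phi>0])
  have sm2: "smooth_on_set (?I \<times> M) (\<lambda>z. ?p (fst z) (fst z) (snd z))"
    unfolding form_ip_def divide_inverse
    by (intro smooth_on_set_sum smooth_on_set_mult smooth_on_set_inner smooth_on_set_const
        smooth_const_family[OF hform_smooth[OF Z]] hform_family_smooth[OF \<eta>] \<Phi>)
  have rem: "((\<lambda>s. \<integral>x. ?p 0 s x - ?p s s x \<partial>vol) has_real_derivative (\<integral>x. - ?c x \<partial>vol)) (at 0)"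
  proof (rule has_real_derivative_integral[OF \<epsilon>])
    show "smooth_on_set (?I \<times> M) (\<lambda>z. ?p 0 (fst z) (snd z) - ?p (fst z) (fst z) (snd z))"
      by (rule smooth_on_set_diff[OF sm1 sm2])
    fix x assume x: "x \<in> M"
    note ip = bounded_bilinear.has_vector_derivative[OF bounded_bilinear_inner]
    have d1: "((\<lambda>s. ?p 0 s x) has_real_derivative
        form_ip (\<lambda>vs. Z x vs \<bullet> \<Phi> 0 x) (\<lambda>vs. \<eta> 0 x vs \<bullet> 0 + \<eta>' x vs \<bullet> \<Phi> 0 x) +
        form_ip (\<lambda>vs. 0) (\<lambda>vs. \<eta> 0 x vs \<bullet> \<Phi> 0 x)) (at 0)"
      by (rule has_real_derivative_form_ip[OF has_vector_derivative_const ip[OF \<eta>'[OF x] has_vector_derivative_const]])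
    have d2: "((\<lambda>s. ?p s s x) has_real_derivative
        form_ip (\<lambda>vs. Z x vs \<bullet> \<Phi> 0 x) (\<lambda>vs. \<eta> 0 x vs \<bullet> V x + \<eta>' x vs \<bullet> \<Phi> 0 x) +
        form_ip (\<lambda>vs. Z x vs \<bullet> V x + 0 \<bullet> \<Phi> 0 x) (\<lambda>vs. \<eta> 0 x vs \<bullet> \<Phi> 0 x)) (at 0)"
      by (rule has_real_derivative_form_ip[OF ip[OF has_vector_derivative_const V[OF x]] ip[OF \<eta>'[OF x] V[OF x]]])
    show "((\<lambda>s. ?p 0 s x - ?p s s x) has_real_derivative - ?c x) (at 0)"
      by (rule DERIV_cong[OF DERIV_diff[OF d1 d2]]) (simp add: form_ip_add_right form_ip_0_left)
  qed
  have eq: "(\<integral>x. form_ip (Z x) (\<lambda>vs. nproj (\<Phi> s x) (\<eta> s x vs)) \<partial>vol) =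
      (\<integral>x. form_ip (\<lambda>vs. nproj (\<Phi> 0 x) (Z x vs)) (\<eta> s x) \<partial>vol) + (\<integral>x. ?p 0 s x - ?p s s x \<partial>vol)"
    if s: "s \<in> ?I" for s
  proof -
    have i1: "integrable vol (\<lambda>x. form_ip (\<lambda>vs. nproj (\<Phi> 0 x) (Z x vs)) (\<eta> s x))"
      by (intro integrable_smooth smooth_form_ip_slice hform_nproj Z \<Phi>0 hform_family_slice[OF \<eta> s])
    have i2: "integrable vol (\<lambda>x. ?p 0 s x - ?p s s x)"
      using smooth_slice[OF smooth_on_set_diff[OF sm1 sm2, unfolded fst_conv], OF s] by (intro integrable_smooth) simp
    have "form_ip (Z x) (\<lambda>vs. nproj (\<Phi> s x) (\<eta> s x vs)) =
        form_ip (\<lambda>vs. nproj (\<Phi> 0 x) (Z x vs)) (\<eta> s x) + (?p 0 s x - ?p s s x)" for x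
      unfolding form_ip_nproj[symmetric] unfolding form_ip_nproj_left by simp
    then show ?thesis by (simp only: Bochner_Integration.integral_add[OF i1 i2])
  qed
  have "((\<lambda>s. (\<integral>x. form_ip (\<lambda>vs. nproj (\<Phi> 0 x) (Z x vs)) (\<eta> s x) \<partial>vol) + (\<integral>x. ?p 0 s x - ?p s s x \<partial>vol))
     has_real_derivative B + (\<integral>x. - ?c x \<partial>vol)) (at 0)"
    by (rule DERIV_add[OF B rem])
  then have "((\<lambda>s. \<integral>x. form_ip (Z x) (\<lambda>vs. nproj (\<Phi> s x) (\<eta> s x vs)) \<partial>vol)
     has_real_derivative B + (\<integral>x. - ?c x \<partial>vol)) (at 0)"
    by (rule has_field_derivative_transform_within_open[where S = ?I]) (use s0 eq in auto)
  then show ?thesis by (simp only: Bochner_Integration.integral_minus diff_conv_add_uminus)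
qed

lemma hform_family_es:
  assumes "smooth_on_set (I \<times> M) (\<lambda>z. \<Phi> (fst z) (snd z))"
  shows "hform_family I (\<lambda>s. es (\<Phi> s) j)"
proof (induction j)
  case 0
  show ?case unfolding es.simps es0_def[abs_def]
    by (intro hform_family_nproj hform_family_fco hform_family_fext hform_family_zero_form assms)
next
  case (Suc j)
  then show ?case unfolding es.simps by (intro hform_family_nproj hform_family_fdirac assms)
qed

lemma covd_cong: "x \<in> M \<Longrightarrow> (\<And>y vs. y \<in> M \<Longrightarrow> \<omega> y vs = \<theta> y vs) \<Longrightarrow> covd \<omega> x u ws = covd \<theta> x u ws"
  unfolding covd_def by (rule pder_cong)

lemma covd_scaleR: "hform \<omega> \<Longrightarrow> x \<in> M \<Longrightarrow> covd (\<lambda>y vs. a *\<^sub>R \<omega> y vs) x u ws = a *\<^sub>R covd \<omega> x u ws"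
  unfolding covd_def by (intro pder_scaleR hform_smooth)

text \<open>Agreement holds only at points of \<open>M\<close>, so the forms cannot be rewritten as
  functions. The case \<open>a = 1\<close> serves as plain congruence.\<close>

lemma fext_cong_scaleR:
  assumes "hform \<omega>" "x \<in> M" "\<And>y vs. y \<in> M \<Longrightarrow> \<theta> y vs = a *\<^sub>R \<omega> y vs"
  shows "fext \<theta> x vs = a *\<^sub>R fext \<omega> x vs"
proof -
  have "covd \<theta> x u ws = a *\<^sub>R covd \<omega> x u ws" for u ws
    using covd_cong[OF assms(2,3)] covd_scaleR[OF assms(1,2)] by simp
  then show ?thesis unfolding fext_def asum_eq_sum by (simp add: scaleR_sum_right mult.commute)
qed

lemma fco_cong_scaleR:
  assumes "hform \<omega>" "x \<in> M" "\<And>y vs. y \<in> M \<Longrightarrow> \<theta> y vs = a *\<^sub>R \<omega> y vs"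
  shows "fco \<theta> x vs = a *\<^sub>R fco \<omega> x vs"
proof -
  have "covd \<theta> x u ws = a *\<^sub>R covd \<omega> x u ws" for u ws
    using covd_cong[OF assms(2,3)] covd_scaleR[OF assms(1,2)] by simp
  then show ?thesis unfolding fco_def by (simp add: scaleR_sum_right)
qed

lemma fdirac_cong_scaleR:
  assumes "hform \<omega>" "x \<in> M" "\<And>y vs. y \<in> M \<Longrightarrow> \<theta> y vs = a *\<^sub>R \<omega> y vs"
  shows "fdirac \<theta> x vs = a *\<^sub>R fdirac \<omega> x vs"
  unfolding fdirac_def by (simp add: fext_cong_scaleR[OF assms] fco_cong_scaleR[OF assms] scaleR_add_right)

lemma fco_zero_form: "x \<in> M \<Longrightarrow> fco (zero_form a) x vs = 0"
  by (simp add: fco_def covd_def zero_form_def pder_const)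

lemma fco_fext_zero_form_Cons:
  assumes x: "x \<in> M" shows "fco (fext (zero_form a)) x (v # vs) = 0"
proof -
  have "covd (fext (zero_form a)) x b (b # v # vs) = pder (\<lambda>y. 0) x b" for b
    unfolding covd_def by (rule pder_cong[OF x]) (simp add: fext_zero_form)
  then show ?thesis unfolding fco_def by (simp add: pder_const[OF x])
qed

end

text \<open>
  Behind these assumptions stands a hypersurface of the sphere on which the mean curvature and the
  length of the second fundamental form are constant: \<open>\<nu>\<close> is a normal field of constant squared
  length \<open>\<rho>\<close>, the tension field is \<open>- \<kappa> \<nu>\<close> and \<open>\<mu>\<close> is the squared length of the
  second fundamental form.
\<close>

locale normal_eigenmap = sphere_map M P vol H \<phi>
  for M :: "'e::euclidean_space set" and P vol H and \<phi> :: "'e \<Rightarrow> 'f::euclidean_space" +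
  fixes \<nu> :: "'e \<Rightarrow> 'f" and \<kappa> \<mu> \<rho> c :: real
  assumes smooth_nu: "smooth_on_set M \<nu>"
    and lap_phi: "x \<in> M \<Longrightarrow> fco (fext (zero_form \<phi>)) x [] = \<kappa> *\<^sub>R \<nu> x + c *\<^sub>R \<phi> x"
    and lap_nu: "x \<in> M \<Longrightarrow> fco (fext (zero_form \<nu>)) x [] = \<mu> *\<^sub>R \<nu> x + (\<kappa> * \<rho>) *\<^sub>R \<phi> x"
    and d_d_nu: "x \<in> M \<Longrightarrow> fext (fext (zero_form \<nu>)) x vs = 0"
    and nu_phi: "x \<in> M \<Longrightarrow> \<nu> x \<bullet> \<phi> x = 0"
    and d_nu_phi: "x \<in> M \<Longrightarrow> pder \<nu> x u \<bullet> \<phi> x = 0"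
begin

abbreviation "\<omega>0 \<equiv> zero_form \<nu>"
abbreviation "\<omega>1 \<equiv> fext (zero_form \<nu>)"
abbreviation "w \<equiv> \<lambda>x. \<mu> *\<^sub>R \<nu> x + (\<kappa> * \<rho>) *\<^sub>R \<phi> x"

lemma hform_omega: "hform \<omega>0" "hform \<omega>1"
  by (intro hform_fext hform_zero_form smooth_nu)+

lemma hform_w: "hform (zero_form w)"
  by (intro hform_zero_form smooth_on_set_add smooth_on_set_scaleR smooth_on_set_const smooth_nu smooth_phi)

lemma phi_phi: "x \<in> M \<Longrightarrow> \<phi> x \<bullet> \<phi> x = 1"
  using norm_phi by (simp add: dot_square_norm)

lemma fdirac_omega0: "x \<in> M \<Longrightarrow> fdirac \<omega>0 x vs = \<omega>1 x vs"
  by (simp add: fdirac_def fco_zero_form)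

lemma fdirac_omega1: "x \<in> M \<Longrightarrow> fdirac \<omega>1 x vs = zero_form w x vs"
  by (cases vs) (simp_all add: fdirac_def d_d_nu lap_nu fco_fext_zero_form_Cons zero_form_def)

lemma nproj_omega0: "x \<in> M \<Longrightarrow> nproj (\<phi> x) (\<omega>0 x vs) = \<omega>0 x vs"
  by (simp add: zero_form_def nproj_eq nu_phi)

lemma omega1_phi: "x \<in> M \<Longrightarrow> \<omega>1 x vs \<bullet> \<phi> x = 0"
  by (simp add: fext_zero_form d_nu_phi split: list.splits)

lemma nproj_w: "x \<in> M \<Longrightarrow> nproj (\<phi> x) (zero_form w x vs) = \<mu> *\<^sub>R \<omega>0 x vs"
  by (simp add: zero_form_def nproj_def inner_add_left nu_phi phi_phi)

text \<open>The operator D sends \<nu> to d\<nu> and d\<nu> to \<Delta>\<nu>. The form d\<nu> is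
  already orthogonal to \<phi>, and projecting \<Delta>\<nu> leaves \<mu>\<nu>, so that two steps
  amount to a factor \<mu>.\<close>

lemma es_even: "x \<in> M \<Longrightarrow> es \<phi> (2 * l) x vs = (\<kappa> * \<mu> ^ l) *\<^sub>R \<omega>0 x vs"
  and es_odd: "x \<in> M \<Longrightarrow> es \<phi> (Suc (2 * l)) x vs = (\<kappa> * \<mu> ^ l) *\<^sub>R \<omega>1 x vs"
proof -
  have odd: "es \<phi> (Suc (2 * l)) x vs = (\<kappa> * \<mu> ^ l) *\<^sub>R \<omega>1 x vs"
    if ev: "\<And>x vs. x \<in> M \<Longrightarrow> es \<phi> (2 * l) x vs = (\<kappa> * \<mu> ^ l) *\<^sub>R \<omega>0 x vs" and x: "x \<in> M" for l x vs
    using fdirac_cong_scaleR[OF hform_omega(1) x ev, of vs]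
    by (simp add: fdirac_omega0[OF x] nproj_eq omega1_phi[OF x])
  have ev: "es \<phi> (2 * l) x vs = (\<kappa> * \<mu> ^ l) *\<^sub>R \<omega>0 x vs" if "x \<in> M" for l x vs
    using that
  proof (induction l arbitrary: x vs)
    case (0 x vs)
    then show ?case
      by (cases vs) (simp_all add: es0_def lap_phi fco_fext_zero_form_Cons zero_form_def
          linear_0[OF linear_nproj] linear_add[OF linear_nproj] linear_scale[OF linear_nproj] nproj_eq nu_phi,
          simp add: nproj_def phi_phi)
  next
    case (Suc l x vs)
    have "es \<phi> (2 * Suc l) x vs = nproj (\<phi> x) (fdirac (es \<phi> (Suc (2 * l))) x vs)" by simp
    also have "fdirac (es \<phi> (Suc (2 * l))) x vs = (\<kappa> * \<mu> ^ l) *\<^sub>R zero_form w x vs"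
      using fdirac_cong_scaleR[OF hform_omega(2) Suc.prems odd[OF Suc.IH], of vs]
      by (simp add: fdirac_omega1[OF Suc.prems])
    finally show ?case
      by (simp add: linear_scale[OF linear_nproj] nproj_w[OF Suc.prems] mult_ac)
  qed
  show "x \<in> M \<Longrightarrow> es \<phi> (2 * l) x vs = (\<kappa> * \<mu> ^ l) *\<^sub>R \<omega>0 x vs" by (rule ev)
  show "x \<in> M \<Longrightarrow> es \<phi> (Suc (2 * l)) x vs = (\<kappa> * \<mu> ^ l) *\<^sub>R \<omega>1 x vs" by (rule odd[OF ev])
qed

section \<open>Transfer of the operators to the fixed side of the inner product\<close>

definition normal_part :: "('e \<Rightarrow> 'f) \<Rightarrow> real" where
  "normal_part V = (\<integral>x. \<nu> x \<bullet> V x \<partial>vol)"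

context
  fixes \<epsilon> :: real and \<Phi> :: "real \<Rightarrow> 'e \<Rightarrow> 'f" and V :: "'e \<Rightarrow> 'f"
  assumes eps: "\<epsilon> > 0" and Phi: "smooth_on_set ({-\<epsilon><..<\<epsilon>} \<times> M) (\<lambda>z. \<Phi> (fst z) (snd z))"
    and norm_Phi: "\<And>s x. s \<in> {-\<epsilon><..<\<epsilon>} \<Longrightarrow> x \<in> M \<Longrightarrow> norm (\<Phi> s x) = 1"
    and Phi_0: "\<And>x. x \<in> M \<Longrightarrow> \<Phi> 0 x = \<phi> x"
    and V: "\<And>x. x \<in> M \<Longrightarrow> ((\<lambda>s. \<Phi> s x) has_vector_derivative V x) (at 0)"
begin

abbreviation "h \<equiv> normal_part V"

lemma phi_V: "x \<in> M \<Longrightarrow> \<phi> x \<bullet> V x = 0"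
proof -
  assume x: "x \<in> M"
  have "((\<lambda>s. \<Phi> s x \<bullet> \<Phi> s x) has_vector_derivative \<Phi> 0 x \<bullet> V x + V x \<bullet> \<Phi> 0 x) (at 0)"
    by (rule bounded_bilinear.has_vector_derivative[OF bounded_bilinear_inner V[OF x] V[OF x]])
  moreover have "((\<lambda>s. \<Phi> s x \<bullet> \<Phi> s x) has_vector_derivative 0) (at 0)"
  proof (rule has_vector_derivative_transform_within_open[of "\<lambda>s. 1"])
    show "0 \<in> {-\<epsilon><..<\<epsilon>}" using eps by simp
    show "1 = \<Phi> s x \<bullet> \<Phi> s x" if "s \<in> {-\<epsilon><..<\<epsilon>}" for s
      using norm_Phi[OF that x] by (simp add: dot_square_norm)
  qed simp_all
  ultimately have "\<Phi> 0 x \<bullet> V x + V x \<bullet> \<Phi> 0 x = 0" by (rule vector_derivative_unique_at)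
  then show ?thesis by (simp add: Phi_0[OF x] inner_commute)
qed

lemma es_Phi_0: "x \<in> M \<Longrightarrow> es (\<Phi> 0) j x vs = es \<phi> j x vs"
proof (induction j arbitrary: x vs)
  case 0
  have hz: "hform (zero_form \<phi>)" by (rule hform_zero_form[OF smooth_phi])
  have "fext (zero_form (\<Phi> 0)) y us = 1 *\<^sub>R fext (zero_form \<phi>) y us" if "y \<in> M" for y us
    by (rule fext_cong_scaleR[OF hz that]) (simp add: zero_form_def Phi_0)
  from fco_cong_scaleR[OF hform_fext[OF hz] 0 this] show ?case by (simp add: es0_def Phi_0[OF 0])
next
  case (Suc j)
  from fdirac_cong_scaleR[OF hform_es[of j] Suc.prems, of "es (\<Phi> 0) j" 1 vs] Suc.IH
  show ?case by (simp add: Phi_0[OF Suc.prems])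
qed

text \<open>One transfer: \<open>nproj_variation\<close> puts the outer projection on
  \<open>Z\<close>, which becomes \<open>Y\<close>, and self-adjointness puts D on \<open>Y\<close>.
  The motion of the projection leaves a correction, assumed here to be a constant multiple of \<nu>
  \<bullet> V.\<close>

lemma es_step:
  assumes Z: "hform Z" and Y: "hform Y" and ZY: "\<And>x vs. x \<in> M \<Longrightarrow> nproj (\<phi> x) (Z x vs) = Y x vs"
    and B: "((\<lambda>s. \<integral>x. form_ip (fdirac Y x) (es (\<Phi> s) j x) \<partial>vol) has_real_derivative B) (at 0)"
    and C: "\<And>x. x \<in> M \<Longrightarrow> form_ip (\<lambda>vs. Z x vs \<bullet> V x) (\<lambda>vs. fdirac (es \<phi> j) x vs \<bullet> \<phi> x) +
              form_ip (\<lambda>vs. Z x vs \<bullet> \<phi> x) (\<lambda>vs. fdirac (es \<phi> j) x vs \<bullet> V x) = C * (\<nu> x \<bullet> V x)"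
  shows "((\<lambda>s. \<integral>x. form_ip (Z x) (es (\<Phi> s) (Suc j) x) \<partial>vol) has_real_derivative B - C * h) (at 0)"
proof -
  let ?I = "{-\<epsilon><..<\<epsilon>}"
  have fam: "hform_family ?I (\<lambda>s. es (\<Phi> s) j)" by (rule hform_family_es[OF Phi])
  have "(\<integral>x. form_ip (fdirac Y x) (es (\<Phi> s) j x) \<partial>vol) =
      (\<integral>x. form_ip (\<lambda>vs. nproj (\<Phi> 0 x) (Z x vs)) (fdirac (es (\<Phi> s) j) x) \<partial>vol)" if "s \<in> ?I" for s
  proof -
    have "(\<integral>x. form_ip (fdirac Y x) (es (\<Phi> s) j x) \<partial>vol) = (\<integral>x. form_ip (Y x) (fdirac (es (\<Phi> s) j) x) \<partial>vol)"
      by (rule fdirac_self_adjoint[OF Y hform_family_slice[OF fam that]])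
    then show ?thesis by (simp add: ZY Phi_0 cong: integral_cong_M)
  qed
  then have "((\<lambda>s. \<integral>x. form_ip (\<lambda>vs. nproj (\<Phi> 0 x) (Z x vs)) (fdirac (es (\<Phi> s) j) x) \<partial>vol) has_real_derivative B) (at 0)"
    by (intro has_field_derivative_transform_within_open[OF B, of ?I]) (use eps in auto)
  from nproj_variation[OF eps Phi V Z hform_family_fdirac[OF fam] this]
  have "((\<lambda>s. \<integral>x. form_ip (Z x) (es (\<Phi> s) (Suc j) x) \<partial>vol) has_real_derivative
     B - (\<integral>x. form_ip (\<lambda>vs. Z x vs \<bullet> V x) (\<lambda>vs. fdirac (es (\<Phi> 0) j) x vs \<bullet> \<Phi> 0 x) +
              form_ip (\<lambda>vs. Z x vs \<bullet> \<Phi> 0 x) (\<lambda>vs. fdirac (es (\<Phi> 0) j) x vs \<bullet> V x) \<partial>vol)) (at 0)"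
    by simp
  moreover have "(\<integral>x. form_ip (\<lambda>vs. Z x vs \<bullet> V x) (\<lambda>vs. fdirac (es (\<Phi> 0) j) x vs \<bullet> \<Phi> 0 x) +
              form_ip (\<lambda>vs. Z x vs \<bullet> \<Phi> 0 x) (\<lambda>vs. fdirac (es (\<Phi> 0) j) x vs \<bullet> V x) \<partial>vol) =
     (\<integral>x. C * (\<nu> x \<bullet> V x) \<partial>vol)"
  proof (rule integral_cong_M)
    fix x assume x: "x \<in> M"
    have "fdirac (es (\<Phi> 0) j) x vs = fdirac (es \<phi> j) x vs" for vs
      using fdirac_cong_scaleR[OF hform_es[of j] x, of "es (\<Phi> 0) j" 1 vs] es_Phi_0 by simp
    then show "form_ip (\<lambda>vs. Z x vs \<bullet> V x) (\<lambda>vs. fdirac (es (\<Phi> 0) j) x vs \<bullet> \<Phi> 0 x) +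
              form_ip (\<lambda>vs. Z x vs \<bullet> \<Phi> 0 x) (\<lambda>vs. fdirac (es (\<Phi> 0) j) x vs \<bullet> V x) = C * (\<nu> x \<bullet> V x)"
      using C[OF x] by (simp add: Phi_0[OF x])
  qed
  ultimately show ?thesis by (simp add: normal_part_def)
qed

text \<open>The last transfer. With all operators on the fixed side, \<open>\<Phi> s\<close> itself
  is paired linearly with a multiple of \<Delta>\<nu>. In the assumption on \<open>C\<close>, the
  factors \<open>c\<close> and \<kappa> \<nu> \<bullet> V are the inner products of \<Delta>\<phi>
  with \<phi> and with V.\<close>

lemma es_start:
  assumes z: "smooth_on_set M z" and zr: "\<And>x. x \<in> M \<Longrightarrow> nproj (\<phi> x) (z x) = a *\<^sub>R \<nu> x"
    and C: "\<And>x. x \<in> M \<Longrightarrow> (z x \<bullet> V x) * c + (z x \<bullet> \<phi> x) * (\<kappa> * (\<nu> x \<bullet> V x)) = C * (\<nu> x \<bullet> V x)"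
  shows "((\<lambda>s. \<integral>x. form_ip (zero_form z x) (es (\<Phi> s) 0 x) \<partial>vol) has_real_derivative a * \<mu> * h - C * h) (at 0)"
proof -
  let ?I = "{-\<epsilon><..<\<epsilon>}"
  have s0: "0 \<in> ?I" using eps by simp
  have famz: "hform_family ?I (\<lambda>s. zero_form (\<Phi> s))" by (rule hform_family_zero_form[OF Phi])
  have hz: "hform (zero_form z)" by (rule hform_zero_form[OF z])
  have base: "((\<lambda>s. \<integral>x. a * (w x \<bullet> \<Phi> s x) \<partial>vol) has_real_derivative (\<integral>x. a * \<mu> * (\<nu> x \<bullet> V x) \<partial>vol)) (at 0)"
  proof (rule has_real_derivative_integral[OF eps])
    show "smooth_on_set (?I \<times> M) (\<lambda>z. a * (w (snd z) \<bullet> \<Phi> (fst z) (snd z)))"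
      by (intro smooth_on_set_mult smooth_on_set_inner smooth_on_set_const Phi smooth_const_family
          smooth_on_set_add smooth_on_set_scaleR smooth_nu smooth_phi)
    fix x assume x: "x \<in> M"
    have "((\<lambda>s. w x \<bullet> \<Phi> s x) has_vector_derivative w x \<bullet> V x + 0 \<bullet> \<Phi> 0 x) (at 0)"
      by (rule bounded_bilinear.has_vector_derivative[OF bounded_bilinear_inner has_vector_derivative_const V[OF x]])
    then have "((\<lambda>s. w x \<bullet> \<Phi> s x) has_real_derivative \<mu> * (\<nu> x \<bullet> V x)) (at 0)"
      by (simp add: has_real_derivative_iff_has_vector_derivative inner_add_left phi_V[OF x])
    from DERIV_cmult[OF this, of a] show "((\<lambda>s. a * (w x \<bullet> \<Phi> s x)) has_real_derivative a * \<mu> * (\<nu> x \<bullet> V x)) (at 0)"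
      by (simp add: mult.assoc)
  qed
  have "(\<integral>x. a * (w x \<bullet> \<Phi> s x) \<partial>vol) =
      (\<integral>x. form_ip (\<lambda>vs. nproj (\<Phi> 0 x) (zero_form z x vs)) (fco (fext (zero_form (\<Phi> s))) x) \<partial>vol)" if s: "s \<in> ?I" for s
  proof -
    note hs = hform_family_slice[OF famz s]
    let ?Y = "\<lambda>x vs. nproj (\<Phi> 0 x) (zero_form z x vs)"
    have hY: "hform ?Y" by (intro hform_nproj hz smooth_slice[OF Phi s0])
    have Y: "?Y x vs = a *\<^sub>R \<omega>0 x vs" if "x \<in> M" for x vs
      using zr[OF that] by (simp add: zero_form_def Phi_0[OF that] linear_0[OF linear_nproj])
    \<comment> \<open>The Laplacian is moved in two halves, first the codifferential and then the
      exterior derivative.\<close>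
    have "(\<integral>x. form_ip (?Y x) (fco (fext (zero_form (\<Phi> s))) x) \<partial>vol) =
        (\<integral>x. form_ip (fext ?Y x) (fext (zero_form (\<Phi> s)) x) \<partial>vol)"
      by (rule fext_fco_adjoint[symmetric, OF hY hform_fext[OF hs]])
    also have "\<dots> = (\<integral>x. form_ip (fext (zero_form (\<Phi> s)) x) (fext ?Y x) \<partial>vol)" by (simp only: form_ip_commute)
    also have "\<dots> = (\<integral>x. form_ip (zero_form (\<Phi> s) x) (fco (fext ?Y) x) \<partial>vol)"
      by (rule fext_fco_adjoint[OF hs hform_fext[OF hY]])
    also have "\<dots> = (\<integral>x. a * (w x \<bullet> \<Phi> s x) \<partial>vol)"
    proof (rule integral_cong_M)
      fix x assume x: "x \<in> M"
      have "fco (fext ?Y) x [] = a *\<^sub>R fco (fext \<omega>0) x []"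
        by (rule fco_cong_scaleR[OF hform_omega(2) x fext_cong_scaleR[OF hform_omega(1) _ Y]])
      then show "form_ip (zero_form (\<Phi> s) x) (fco (fext ?Y) x) = a * (w x \<bullet> \<Phi> s x)"
        by (simp add: form_ip_zero_form lap_nu[OF x] inner_commute)
    qed
    finally show ?thesis by simp
  qed
  then have "((\<lambda>s. \<integral>x. form_ip (\<lambda>vs. nproj (\<Phi> 0 x) (zero_form z x vs)) (fco (fext (zero_form (\<Phi> s))) x) \<partial>vol)
      has_real_derivative a * \<mu> * h) (at 0)"
    unfolding normal_part_def
    by (intro has_field_derivative_transform_within_open[OF base[simplified], of ?I]) (use eps in auto)
  from nproj_variation[OF eps Phi V hz hform_family_fco[OF hform_family_fext[OF famz]] this]
  have "((\<lambda>s. \<integral>x. form_ip (zero_form z x) (es (\<Phi> s) 0 x) \<partial>vol) has_real_derivative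
     a * \<mu> * h - (\<integral>x. form_ip (\<lambda>vs. zero_form z x vs \<bullet> V x) (\<lambda>vs. fco (fext (zero_form (\<Phi> 0))) x vs \<bullet> \<Phi> 0 x) +
              form_ip (\<lambda>vs. zero_form z x vs \<bullet> \<Phi> 0 x) (\<lambda>vs. fco (fext (zero_form (\<Phi> 0))) x vs \<bullet> V x) \<partial>vol)) (at 0)"
    by (simp add: es0_def[abs_def])
  moreover have "(\<integral>x. form_ip (\<lambda>vs. zero_form z x vs \<bullet> V x) (\<lambda>vs. fco (fext (zero_form (\<Phi> 0))) x vs \<bullet> \<Phi> 0 x) +
              form_ip (\<lambda>vs. zero_form z x vs \<bullet> \<Phi> 0 x) (\<lambda>vs. fco (fext (zero_form (\<Phi> 0))) x vs \<bullet> V x) \<partial>vol) =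
     (\<integral>x. C * (\<nu> x \<bullet> V x) \<partial>vol)"
  proof (rule integral_cong_M)
    fix x assume x: "x \<in> M"
    have hp: "hform (zero_form \<phi>)" by (rule hform_zero_form[OF smooth_phi])
    have "fext (zero_form (\<Phi> 0)) y us = 1 *\<^sub>R fext (zero_form \<phi>) y us" if "y \<in> M" for y us
      by (rule fext_cong_scaleR[OF hp that]) (simp add: zero_form_def Phi_0)
    from fco_cong_scaleR[OF hform_fext[OF hp] x this]
    have y0: "fco (fext (zero_form (\<Phi> 0))) x [] = \<kappa> *\<^sub>R \<nu> x + c *\<^sub>R \<phi> x" by (simp add: lap_phi[OF x])
    have zf: "(\<lambda>vs. zero_form z x vs \<bullet> y) = zero_form (\<lambda>x. z x \<bullet> y) x" for y
      by (auto simp: zero_form_def)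
    show "form_ip (\<lambda>vs. zero_form z x vs \<bullet> V x) (\<lambda>vs. fco (fext (zero_form (\<Phi> 0))) x vs \<bullet> \<Phi> 0 x) +
              form_ip (\<lambda>vs. zero_form z x vs \<bullet> \<Phi> 0 x) (\<lambda>vs. fco (fext (zero_form (\<Phi> 0))) x vs \<bullet> V x) = C * (\<nu> x \<bullet> V x)"
      unfolding zf form_ip_zero_form y0 Phi_0[OF x]
      using C[OF x] by (simp add: inner_add_left nu_phi[OF x] phi_phi[OF x] phi_V[OF x])
  qed
  ultimately show ?thesis by (simp add: normal_part_def)
qed

lemma zero_form_inner: "(\<lambda>vs. zero_form z x vs \<bullet> y) = zero_form (\<lambda>x. z x \<bullet> y) x"
  by (auto simp: zero_form_def)

lemma fdirac_es_odd: "x \<in> M \<Longrightarrow> fdirac (es \<phi> (Suc (2 * l))) x vs = (\<kappa> * \<mu> ^ l) *\<^sub>R zero_form w x vs"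
  using fdirac_cong_scaleR[OF hform_omega(2) _ es_odd] by (simp add: fdirac_omega1)

lemma fdirac_es_even: "x \<in> M \<Longrightarrow> fdirac (es \<phi> (2 * l)) x vs = (\<kappa> * \<mu> ^ l) *\<^sub>R \<omega>1 x vs"
  using fdirac_cong_scaleR[OF hform_omega(1) _ es_even] by (simp add: fdirac_omega0)

text \<open>No correction arises, because d\<nu> stands on both sides of the projection and is
  orthogonal to \<phi>.\<close>

lemma derivative_omega1:
  assumes "((\<lambda>s. \<integral>x. form_ip (zero_form w x) (es (\<Phi> s) (2 * l) x) \<partial>vol) has_real_derivative B) (at 0)"
  shows "((\<lambda>s. \<integral>x. form_ip (\<omega>1 x) (es (\<Phi> s) (Suc (2 * l)) x) \<partial>vol) has_real_derivative B) (at 0)"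
proof -
  have "((\<lambda>s. \<integral>x. form_ip (\<omega>1 x) (es (\<Phi> s) (Suc (2 * l)) x) \<partial>vol) has_real_derivative B - 0 * h) (at 0)"
  proof (rule es_step[OF hform_omega(2) hform_omega(2)])
    show "nproj (\<phi> x) (\<omega>1 x vs) = \<omega>1 x vs" if "x \<in> M" for x vs
      by (simp add: nproj_eq omega1_phi[OF that])
    have "(\<integral>x. form_ip (fdirac \<omega>1 x) (es (\<Phi> s) (2 * l) x) \<partial>vol) =
        (\<integral>x. form_ip (zero_form w x) (es (\<Phi> s) (2 * l) x) \<partial>vol)" for s
      by (rule integral_cong_M, rule form_ip_cong) (simp_all add: fdirac_omega1)
    then show "((\<lambda>s. \<integral>x. form_ip (fdirac \<omega>1 x) (es (\<Phi> s) (2 * l) x) \<partial>vol) has_real_derivative B) (at 0)"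
      using assms by simp
    show "form_ip (\<lambda>vs. \<omega>1 x vs \<bullet> V x) (\<lambda>vs. fdirac (es \<phi> (2 * l)) x vs \<bullet> \<phi> x) +
         form_ip (\<lambda>vs. \<omega>1 x vs \<bullet> \<phi> x) (\<lambda>vs. fdirac (es \<phi> (2 * l)) x vs \<bullet> V x) = 0 * (\<nu> x \<bullet> V x)" if "x \<in> M" for x
      by (simp add: fdirac_es_even[OF that] omega1_phi[OF that] form_ip_0_left form_ip_0_right)
  qed
  then show ?thesis by simp
qed

lemma w_inner: "x \<in> M \<Longrightarrow> w x \<bullet> V x = \<mu> * (\<nu> x \<bullet> V x)" "x \<in> M \<Longrightarrow> w x \<bullet> \<phi> x = \<kappa> * \<rho>"
  by (simp_all add: inner_add_left phi_V nu_phi phi_phi)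

text \<open>In the induction \<Delta>\<nu> stands on both sides of the projection, and each side in
  turn supplies its component \<kappa>\<rho> along \<phi>; this accounts for the 2 in every round.
  In the base case the other side is \<Delta>\<phi>, which gives the term with \<open>c\<close> and
  a single \<kappa>^2 \<rho>.\<close>

lemma derivative_w:
  "((\<lambda>s. \<integral>x. form_ip (zero_form w x) (es (\<Phi> s) (2 * l) x) \<partial>vol) has_real_derivative
     \<mu> ^ l * (\<mu>\<^sup>2 - \<mu> * c - (2 * real l + 1) * \<kappa>\<^sup>2 * \<rho>) * h) (at 0)"
proof (induction l)
  case 0
  have "((\<lambda>s. \<integral>x. form_ip (zero_form w x) (es (\<Phi> s) 0 x) \<partial>vol) has_real_derivative
      \<mu> * \<mu> * h - (\<mu> * c + \<kappa>\<^sup>2 * \<rho>) * h) (at 0)"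
  proof (rule es_start)
    show "smooth_on_set M w"
      by (intro smooth_on_set_add smooth_on_set_scaleR smooth_on_set_const smooth_nu smooth_phi)
    show "nproj (\<phi> x) (w x) = \<mu> *\<^sub>R \<nu> x" if "x \<in> M" for x
      using nproj_w[OF that, of "[]"] by (simp add: zero_form_def)
    show "(w x \<bullet> V x) * c + (w x \<bullet> \<phi> x) * (\<kappa> * (\<nu> x \<bullet> V x)) = (\<mu> * c + \<kappa>\<^sup>2 * \<rho>) * (\<nu> x \<bullet> V x)" if "x \<in> M" for x
      unfolding w_inner[OF that] by (simp add: algebra_simps power2_eq_square)
  qed
  then show ?case by (simp add: algebra_simps power2_eq_square)
next
  case (Suc l)
  let ?B = "\<mu> ^ l * (\<mu>\<^sup>2 - \<mu> * c - (2 * real l + 1) * \<kappa>\<^sup>2 * \<rho>) * h"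
  have "((\<lambda>s. \<integral>x. form_ip (zero_form w x) (es (\<Phi> s) (Suc (Suc (2 * l))) x) \<partial>vol) has_real_derivative
      \<mu> * ?B - (2 * \<kappa>\<^sup>2 * \<rho> * \<mu> ^ Suc l) * h) (at 0)"
  proof (rule es_step[OF hform_w])
    show "hform (\<lambda>x vs. \<mu> *\<^sub>R \<omega>0 x vs)"
      using hform_omega(1) unfolding hform_def
      by (auto intro!: altform_linear_image[of "\<lambda>v. \<mu> *\<^sub>R v"] smooth_on_set_scaleR smooth_on_set_const
          bounded_linear.linear[OF bounded_linear_scaleR_right])
    show "nproj (\<phi> x) (zero_form w x vs) = \<mu> *\<^sub>R \<omega>0 x vs" if "x \<in> M" for x vs by (rule nproj_w[OF that])
    have "(\<integral>x. form_ip (fdirac (\<lambda>x vs. \<mu> *\<^sub>R \<omega>0 x vs) x) (es (\<Phi> s) (Suc (2 * l)) x) \<partial>vol) =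
        \<mu> * (\<integral>x. form_ip (\<omega>1 x) (es (\<Phi> s) (Suc (2 * l)) x) \<partial>vol)" for s
    proof -
      have "(\<integral>x. form_ip (fdirac (\<lambda>x vs. \<mu> *\<^sub>R \<omega>0 x vs) x) (es (\<Phi> s) (Suc (2 * l)) x) \<partial>vol) =
          (\<integral>x. \<mu> * form_ip (\<omega>1 x) (es (\<Phi> s) (Suc (2 * l)) x) \<partial>vol)"
      proof (rule integral_cong_M)
        fix x assume x: "x \<in> M"
        have "fdirac (\<lambda>x vs. \<mu> *\<^sub>R \<omega>0 x vs) x vs = \<mu> *\<^sub>R \<omega>1 x vs" for vs
          using fdirac_cong_scaleR[OF hform_omega(1) x refl] by (simp add: fdirac_omega0[OF x])
        then have "fdirac (\<lambda>x vs. \<mu> *\<^sub>R \<omega>0 x vs) x = (\<lambda>vs. \<mu> *\<^sub>R \<omega>1 x vs)" by (rule ext)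
        then show "form_ip (fdirac (\<lambda>x vs. \<mu> *\<^sub>R \<omega>0 x vs) x) (es (\<Phi> s) (Suc (2 * l)) x) =
            \<mu> * form_ip (\<omega>1 x) (es (\<Phi> s) (Suc (2 * l)) x)" by (simp only: form_ip_scaleR_left)
      qed
      then show ?thesis by simp
    qed
    then show "((\<lambda>s. \<integral>x. form_ip (fdirac (\<lambda>x vs. \<mu> *\<^sub>R \<omega>0 x vs) x) (es (\<Phi> s) (Suc (2 * l)) x) \<partial>vol)
        has_real_derivative \<mu> * ?B) (at 0)"
      using DERIV_cmult[OF derivative_omega1[OF Suc.IH], of \<mu>] by (simp only:)
    show "form_ip (\<lambda>vs. zero_form w x vs \<bullet> V x) (\<lambda>vs. fdirac (es \<phi> (Suc (2 * l))) x vs \<bullet> \<phi> x) +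
         form_ip (\<lambda>vs. zero_form w x vs \<bullet> \<phi> x) (\<lambda>vs. fdirac (es \<phi> (Suc (2 * l))) x vs \<bullet> V x) =
         (2 * \<kappa>\<^sup>2 * \<rho> * \<mu> ^ Suc l) * (\<nu> x \<bullet> V x)" if "x \<in> M" for x
    proof -
      have wz: "zero_form w x [] = w x" by (simp add: zero_form_def)
      show ?thesis
        unfolding zero_form_inner form_ip_zero_form fdirac_es_odd[OF that] inner_scaleR_left wz
          w_inner[OF that] by (simp add: power2_eq_square algebra_simps)
    qed
  qed
  then show ?case by (simp add: algebra_simps power2_eq_square)
qed

text \<open>As \<nu> has no component along \<phi>, the outermost transfer yields only one of the
  two correction terms. This completes the odd count of \<open>derivative_w\<close> to 2l.\<close>

lemma derivative_nu:
  "((\<lambda>s. \<integral>x. form_ip (\<omega>0 x) (es (\<Phi> s) (2 * l) x) \<partial>vol) has_real_derivative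
     (\<mu> ^ Suc l - \<mu> ^ l * c - 2 * real l * \<mu> ^ (l - 1) * \<kappa>\<^sup>2 * \<rho>) * h) (at 0)"
proof (cases l)
  case 0
  have "((\<lambda>s. \<integral>x. form_ip (\<omega>0 x) (es (\<Phi> s) 0 x) \<partial>vol) has_real_derivative 1 * \<mu> * h - c * h) (at 0)"
    by (rule es_start[OF smooth_nu]) (simp_all add: nproj_eq nu_phi mult.commute)
  then show ?thesis by (simp add: 0 algebra_simps)
next
  case (Suc l')
  let ?B = "\<mu> ^ l' * (\<mu>\<^sup>2 - \<mu> * c - (2 * real l' + 1) * \<kappa>\<^sup>2 * \<rho>) * h"
  have "((\<lambda>s. \<integral>x. form_ip (\<omega>0 x) (es (\<Phi> s) (Suc (Suc (2 * l'))) x) \<partial>vol) has_real_derivative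
      ?B - (\<kappa>\<^sup>2 * \<rho> * \<mu> ^ l') * h) (at 0)"
  proof (rule es_step[OF hform_omega(1) hform_omega(1)])
    show "nproj (\<phi> x) (\<omega>0 x vs) = \<omega>0 x vs" if "x \<in> M" for x vs by (rule nproj_omega0[OF that])
    have "(\<integral>x. form_ip (fdirac \<omega>0 x) (es (\<Phi> s) (Suc (2 * l')) x) \<partial>vol) =
        (\<integral>x. form_ip (\<omega>1 x) (es (\<Phi> s) (Suc (2 * l')) x) \<partial>vol)" for s
      by (rule integral_cong_M, rule form_ip_cong) (simp_all add: fdirac_omega0)
    then show "((\<lambda>s. \<integral>x. form_ip (fdirac \<omega>0 x) (es (\<Phi> s) (Suc (2 * l')) x) \<partial>vol) has_real_derivative ?B) (at 0)"
      using derivative_omega1[OF derivative_w] by (simp only:)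
    show "form_ip (\<lambda>vs. \<omega>0 x vs \<bullet> V x) (\<lambda>vs. fdirac (es \<phi> (Suc (2 * l'))) x vs \<bullet> \<phi> x) +
         form_ip (\<lambda>vs. \<omega>0 x vs \<bullet> \<phi> x) (\<lambda>vs. fdirac (es \<phi> (Suc (2 * l'))) x vs \<bullet> V x) =
         (\<kappa>\<^sup>2 * \<rho> * \<mu> ^ l') * (\<nu> x \<bullet> V x)" if "x \<in> M" for x
    proof -
      have wz: "zero_form w x [] = w x" by (simp add: zero_form_def)
      show ?thesis
        unfolding zero_form_inner form_ip_zero_form fdirac_es_odd[OF that] inner_scaleR_left wz
          w_inner[OF that] nu_phi[OF that] by (simp add: power2_eq_square algebra_simps)
    qed
  qed
  then show ?thesis by (simp add: Suc algebra_simps power2_eq_square)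
qed

text \<open>At parameter 0 the form is \<kappa> \<mu>^l times \<nu> or d\<nu>, according to the
  parity of k. The two derivative formulas then merge into one expression in k.\<close>

lemma energy_first_variation:
  "((\<lambda>s. 1 / 2 * (\<integral>x. form_ip (es (\<Phi> s) k x) (es (\<Phi> s) k x) \<partial>vol)) has_real_derivative
     \<kappa> * h * (\<mu> ^ Suc k - c * \<mu> ^ k - real k * \<mu> ^ (k - 1) * \<kappa>\<^sup>2 * \<rho>)) (at 0)"
proof (rule energy_derivative[OF eps hform_family_es[OF Phi]])
  have red: "(\<integral>x. form_ip (es (\<Phi> 0) k x) (es (\<Phi> s) k x) \<partial>vol) = a * (\<integral>x. form_ip (Z x) (es (\<Phi> s) k x) \<partial>vol)"
    if "\<And>x vs. x \<in> M \<Longrightarrow> es \<phi> k x vs = a *\<^sub>R Z x vs" for s a Z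
  proof -
    have "(\<integral>x. form_ip (es (\<Phi> 0) k x) (es (\<Phi> s) k x) \<partial>vol) = (\<integral>x. a * form_ip (Z x) (es (\<Phi> s) k x) \<partial>vol)"
    proof (rule integral_cong_M)
      fix x assume x: "x \<in> M"
      have "es (\<Phi> 0) k x = (\<lambda>vs. a *\<^sub>R Z x vs)" using es_Phi_0[OF x] that[OF x] by (intro ext) simp
      then show "form_ip (es (\<Phi> 0) k x) (es (\<Phi> s) k x) = a * form_ip (Z x) (es (\<Phi> s) k x)"
        by (simp only: form_ip_scaleR_left)
    qed
    then show ?thesis by simp
  qed
  show "((\<lambda>s. \<integral>x. form_ip (es (\<Phi> 0) k x) (es (\<Phi> s) k x) \<partial>vol) has_real_derivative
     \<kappa> * h * (\<mu> ^ Suc k - c * \<mu> ^ k - real k * \<mu> ^ (k - 1) * \<kappa>\<^sup>2 * \<rho>)) (at 0)"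
  proof (cases "even k")
    case True
    then obtain l where k: "k = 2 * l" by (elim evenE)
    \<comment> \<open>The truncated exponents at \<open>l = 0\<close> do no harm, since both sides
      carry the factor \<open>real l\<close>.\<close>
    have p: "real l * (\<mu> ^ l * (\<mu> ^ (l - 1) * a)) = real l * (\<mu> ^ (2 * l - 1) * a)" for a
      by (cases l) (simp_all add: power_add mult_2_right mult_ac)
    have "((\<lambda>s. \<integral>x. form_ip (es (\<Phi> 0) k x) (es (\<Phi> s) k x) \<partial>vol) has_real_derivative
       (\<kappa> * \<mu> ^ l) * ((\<mu> ^ Suc l - \<mu> ^ l * c - 2 * real l * \<mu> ^ (l - 1) * \<kappa>\<^sup>2 * \<rho>) * h)) (at 0)"
      using DERIV_cmult[OF derivative_nu[of l], of "\<kappa> * \<mu> ^ l"] red[of "\<kappa> * \<mu> ^ l" \<omega>0] es_even[of _ l]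
      by (simp only: k)
    moreover have "(\<kappa> * \<mu> ^ l) * ((\<mu> ^ Suc l - \<mu> ^ l * c - 2 * real l * \<mu> ^ (l - 1) * \<kappa>\<^sup>2 * \<rho>) * h) =
       \<kappa> * h * (\<mu> ^ l * \<mu> ^ Suc l - c * (\<mu> ^ l * \<mu> ^ l) - 2 * (real l * \<mu> ^ l * \<mu> ^ (l - 1)) * \<kappa>\<^sup>2 * \<rho>)"
      by (simp add: algebra_simps)
    moreover have "\<mu> ^ l * \<mu> ^ Suc l = \<mu> ^ Suc (2 * l)" "\<mu> ^ l * \<mu> ^ l = \<mu> ^ (2 * l)"
      by (simp_all add: mult_2 power_add)
    ultimately show ?thesis by (simp only: p k of_nat_mult of_nat_numeral mult.assoc)
  next
    case False
    then obtain l where k: "k = Suc (2 * l)" by (elim oddE) simp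
    have "((\<lambda>s. \<integral>x. form_ip (es (\<Phi> 0) k x) (es (\<Phi> s) k x) \<partial>vol) has_real_derivative
       (\<kappa> * \<mu> ^ l) * (\<mu> ^ l * (\<mu>\<^sup>2 - \<mu> * c - (2 * real l + 1) * \<kappa>\<^sup>2 * \<rho>) * h)) (at 0)"
      using DERIV_cmult[OF derivative_omega1[OF derivative_w[of l]], of "\<kappa> * \<mu> ^ l"] red[of "\<kappa> * \<mu> ^ l" \<omega>1] es_odd[of _ l]
      by (simp only: k)
    moreover have "(\<kappa> * \<mu> ^ l) * (\<mu> ^ l * (\<mu>\<^sup>2 - \<mu> * c - (2 * real l + 1) * \<kappa>\<^sup>2 * \<rho>) * h) =
       \<kappa> * h * (\<mu> ^ Suc k - c * \<mu> ^ k - real k * \<mu> ^ (k - 1) * \<kappa>\<^sup>2 * \<rho>)"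
    proof -
      have kk: "\<mu> ^ (2 * l) = \<mu> ^ l * \<mu> ^ l" by (simp add: mult_2 power_add)
      have "k - 1 = 2 * l" "real k = 2 * real l + 1" by (simp_all add: k)
      moreover have "\<mu> ^ Suc k = \<mu> ^ l * \<mu> ^ l * \<mu>\<^sup>2" "\<mu> ^ k = \<mu> ^ l * \<mu> ^ l * \<mu>"
        unfolding k power_Suc kk power2_eq_square by (simp_all only: mult_ac)
      moreover have "(\<kappa> * a) * (a * (\<mu>\<^sup>2 - \<mu> * c - n * \<kappa>\<^sup>2 * \<rho>) * y) =
          \<kappa> * y * (a * a * \<mu>\<^sup>2 - c * (a * a * \<mu>) - n * (a * a) * \<kappa>\<^sup>2 * \<rho>)" for a n y
        by (simp add: algebra_simps)
      ultimately show ?thesis using kk by (simp only:)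
    qed
    ultimately show ?thesis by (simp only:)
  qed
qed

end

end

section \<open>The volume of spheres\<close>

lemma nn_integral_lborel_shift:
  fixes f :: "'a::euclidean_space \<Rightarrow> ennreal"
  assumes [measurable]: "f \<in> borel_measurable borel"
  shows "(\<integral>\<^sup>+x. f (t + x) \<partial>lborel) = (\<integral>\<^sup>+x. f x \<partial>lborel)"
    and "(\<integral>\<^sup>+x. f (t - x) \<partial>lborel) = (\<integral>\<^sup>+x. f x \<partial>lborel)"
proof -
  have "lborel = distr lborel borel (\<lambda>x::'a. t + c *\<^sub>R x)" if "\<bar>c\<bar> = 1" for c :: real
    using lborel_affine[of c t] that by (auto simp: density_1)
  from this[of 1] this[of "-1"]
  have "lborel = distr lborel borel (\<lambda>x::'a. t + x)" "lborel = distr lborel borel (\<lambda>x::'a. t - x)"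
    by simp_all
  then show "(\<integral>\<^sup>+x. f (t + x) \<partial>lborel) = (\<integral>\<^sup>+x. f x \<partial>lborel)"
    and "(\<integral>\<^sup>+x. f (t - x) \<partial>lborel) = (\<integral>\<^sup>+x. f x \<partial>lborel)"
    using nn_integral_distr[of "\<lambda>x. t + x" lborel borel f] nn_integral_distr[of "\<lambda>x. t - x" lborel borel f] by simp_all
qed

text \<open>
  Two translation invariant measures are proportional; the unit ball, which is invariant under
  \<open>T\<close>, determines the factor.
\<close>

lemma distr_lborel_isometry:
  fixes T :: "'a::euclidean_space \<Rightarrow> 'a"
  assumes T: "linear T" "\<And>x. norm (T x) = norm x"
  shows "distr lborel borel T = lborel"
proof (rule measure_eqI)
  have Tm [measurable]: "T \<in> borel_measurable borel"
    using T(1) by (simp add: linear_continuous_on linear_conv_bounded_linear borel_measurable_continuous_onI)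
  have inj: "inj T"
    using T by (subst linear_injective_0) (metis norm_eq_zero)+
  have surj: "surj T" by (rule linear_inj_imp_surj[OF T(1) inj])
  fix A :: "'a set" assume "A \<in> sets (distr lborel borel T)"
  then have A [measurable]: "A \<in> sets borel" by simp
  define B where "B = ball (0::'a) 1"
  have B [measurable]: "B \<in> sets borel" by (simp add: B_def)
  let ?i = "indicator :: 'a set \<Rightarrow> 'a \<Rightarrow> ennreal"
  let ?m = "emeasure (distr lborel borel T)"
  have mi [measurable]: "?i C \<in> borel_measurable borel" if "C \<in> sets borel" for C
    using that by (rule borel_measurable_indicator)
  have TB: "T -` B = B" using T(2) by (auto simp: B_def dist_norm)
  have shift: "(\<integral>\<^sup>+y. ?i B (t + y) \<partial>lborel) = emeasure lborel B" for t
    unfolding nn_integral_lborel_shift(1)[OF mi[OF B]] using B by simp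
  have reflect: "(\<integral>\<^sup>+y. ?i A (t - y) \<partial>lborel) = emeasure lborel A" for t
    unfolding nn_integral_lborel_shift(2)[OF mi[OF A]] using A by simp
  have eT: "?m C = (\<integral>\<^sup>+x. ?i C (T x) \<partial>lborel)" if "C \<in> sets borel" for C
  proof -
    have "?m C = (\<integral>\<^sup>+x. ?i C x \<partial>distr lborel borel T)" using that by simp
    also have "\<dots> = (\<integral>\<^sup>+x. ?i C (T x) \<partial>lborel)"
      using mi[OF that] by (intro nn_integral_distr) simp_all
    finally show ?thesis .
  qed
  have mT [measurable]: "(\<lambda>x. ?i C (T x)) \<in> borel_measurable borel" if "C \<in> sets borel" for C
    using measurable_compose[OF Tm mi[OF that]] .
  \<comment> \<open>The double integral of 1_A(Tx) 1_B(Tx + y) is evaluated in two ways. Integrating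
    over y first gives the measure of \<open>B\<close> for every x. After shifting x by the preimage
    of y the integrand is 1_A(Tx - y) 1_B(Tx), and its integral over y is the measure of
    \<open>A\<close>.\<close>
  have "?m A * emeasure lborel B = (\<integral>\<^sup>+x. ?i A (T x) * emeasure lborel B \<partial>lborel)"
    unfolding eT[OF A] by (rule nn_integral_multc[symmetric]) (use mT[OF A] in simp)
  also have "\<dots> = (\<integral>\<^sup>+x. (\<integral>\<^sup>+y. ?i A (T x) * ?i B (T x + y) \<partial>lborel) \<partial>lborel)"
  proof (rule nn_integral_cong)
    fix x
    have "(\<lambda>y. ?i B (T x + y)) \<in> borel_measurable lborel" by measurable
    from nn_integral_cmult[OF this, of "?i A (T x)"]
    show "?i A (T x) * emeasure lborel B = (\<integral>\<^sup>+y. ?i A (T x) * ?i B (T x + y) \<partial>lborel)"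
      by (simp only: shift)
  qed
  also have "\<dots> = (\<integral>\<^sup>+y. (\<integral>\<^sup>+x. ?i A (T x) * ?i B (T x + y) \<partial>lborel) \<partial>lborel)"
    by (rule lborel_pair.Fubini'[symmetric]) measurable
  also have "\<dots> = (\<integral>\<^sup>+y. (\<integral>\<^sup>+x. ?i A (T x - y) * ?i B (T x) \<partial>lborel) \<partial>lborel)"
  proof (rule nn_integral_cong)
    fix y :: 'a
    obtain z where z: "T z = y" using surj by (metis surjD)
    have "(\<lambda>x. ?i A (T x) * ?i B (T x + y)) \<in> borel_measurable borel" by measurable
    from nn_integral_lborel_shift(1)[OF this, of "- z"]
    show "(\<integral>\<^sup>+x. ?i A (T x) * ?i B (T x + y) \<partial>lborel) = (\<integral>\<^sup>+x. ?i A (T x - y) * ?i B (T x) \<partial>lborel)"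
      by (simp add: linear_diff[OF T(1)] z)
  qed
  also have "\<dots> = (\<integral>\<^sup>+x. (\<integral>\<^sup>+y. ?i A (T x - y) * ?i B (T x) \<partial>lborel) \<partial>lborel)"
    by (rule lborel_pair.Fubini') measurable
  also have "\<dots> = (\<integral>\<^sup>+x. emeasure lborel A * ?i B (T x) \<partial>lborel)"
  proof (rule nn_integral_cong)
    fix x
    have "(\<lambda>y. ?i A (T x - y)) \<in> borel_measurable lborel" by measurable
    from nn_integral_multc[OF this, of "?i B (T x)"]
    show "(\<integral>\<^sup>+y. ?i A (T x - y) * ?i B (T x) \<partial>lborel) = emeasure lborel A * ?i B (T x)"
      by (simp only: reflect)
  qed
  also have "\<dots> = emeasure lborel A * ?m B"
    unfolding eT[OF B] by (rule nn_integral_cmult) (use mT[OF B] in simp)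
  also have "?m B = emeasure lborel B"
    using Tm B by (simp add: emeasure_distr TB)
  finally have eq: "?m A * emeasure lborel B = emeasure lborel A * emeasure lborel B" .
  have fin: "emeasure lborel B \<noteq> \<infinity>" using emeasure_bounded_finite[of B] by (simp add: B_def)
  have "\<not> negligible B" by (rule open_not_negligible) (simp_all add: B_def)
  then have pos: "emeasure lborel B \<noteq> 0" using B by (simp add: negligible_iff_emeasure0)
  show "?m A = emeasure lborel A"
    using arg_cong[OF eq, of "\<lambda>a. a / emeasure lborel B"] fin pos by (simp add: ennreal_mult_divide_eq)
qed simp

abbreviation (input) sphere_cone :: "real \<Rightarrow> 'a::euclidean_space set \<Rightarrow> 'a set" where
  "sphere_cone R A \<equiv> {x \<in> cball 0 R - {0}. (R / norm x) *\<^sub>R x \<in> A}"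

lemma space_sphere_volume [simp]: "space (sphere_volume R) = sphere 0 R"
  and sets_sphere_volume [simp]: "sets (sphere_volume R) = sets (restrict_space borel (sphere 0 R))"
  by (simp_all add: sphere_volume_def space_scale_measure space_restrict_space)

lemma measurable_sphere_proj:
  assumes "R > 0"
  shows "(\<lambda>x::'a::euclidean_space. (R / norm x) *\<^sub>R x) \<in>
    restrict_space lborel (cball 0 R - {0}) \<rightarrow>\<^sub>M restrict_space borel (sphere 0 R)"
proof (rule measurable_restrict_space2)
  show "(\<lambda>x::'a. (R / norm x) *\<^sub>R x) \<in> space (restrict_space lborel (cball 0 R - {0})) \<rightarrow> sphere 0 R"
    using assms by (auto simp: space_restrict_space)
  show "(\<lambda>x::'a. (R / norm x) *\<^sub>R x) \<in> borel_measurable (restrict_space lborel (cball 0 R - {0}))"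
    by (intro measurable_restrict_space1) measurable
qed

lemma emeasure_sphere_volume:
  fixes A :: "'a::euclidean_space set"
  assumes R: "R > 0" and A: "A \<in> sets (restrict_space borel (sphere 0 R))"
  shows "emeasure (sphere_volume R) A = ennreal (real DIM('a) / R) * emeasure lborel (sphere_cone R A)"
    and "sphere_cone R A \<in> sets borel"
proof -
  have eq: "(\<lambda>x. (R / norm x) *\<^sub>R x) -` A \<inter> space (restrict_space lborel (cball 0 R - {0})) = sphere_cone R A"
    by (auto simp: space_restrict_space)
  have "sphere_cone R A \<in> sets (restrict_space lborel (cball 0 R - {0}))"
    using measurable_sets[OF measurable_sphere_proj[OF R] A] by (simp only: eq)
  then show 1: "sphere_cone R A \<in> sets borel" by (subst (asm) sets_restrict_space_iff) auto
  have "emeasure (distr (restrict_space lborel (cball 0 R - {0})) (restrict_space borel (sphere 0 R))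
      (\<lambda>x. (R / norm x) *\<^sub>R x)) A = emeasure lborel (sphere_cone R A)"
    unfolding emeasure_distr[OF measurable_sphere_proj[OF R] A] eq
    by (rule emeasure_restrict_space) auto
  then show "emeasure (sphere_volume R) A = ennreal (real DIM('a) / R) * emeasure lborel (sphere_cone R A)"
    by (simp add: sphere_volume_def)
qed

lemma finite_measure_sphere_volume:
  assumes "R > 0" shows "finite_measure (sphere_volume R :: 'a::euclidean_space measure)"
proof (rule finite_measureI)
  have "sphere 0 R \<in> sets (restrict_space borel (sphere (0::'a) R))"
    using sets.top[of "restrict_space borel (sphere (0::'a) R)"] by (simp add: space_restrict_space)
  then have "emeasure (sphere_volume R) (space (sphere_volume R :: 'a measure)) =
      ennreal (real DIM('a) / R) * emeasure lborel (sphere_cone R (sphere (0::'a) R))"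
    by (simp add: emeasure_sphere_volume[OF assms])
  moreover have "emeasure lborel (sphere_cone R (sphere (0::'a) R)) < \<infinity>"
    by (rule emeasure_bounded_finite) (rule bounded_subset[of "cball 0 R"], auto)
  ultimately show "emeasure (sphere_volume R) (space (sphere_volume R :: 'a measure)) \<noteq> \<infinity>"
    by (simp add: ennreal_mult_eq_top_iff)
qed

lemma emeasure_sphere_volume_pos:
  fixes U :: "'a::euclidean_space set"
  assumes R: "R > 0" and U: "open U" "z \<in> U" "norm z = R"
  shows "emeasure (sphere_volume R) (U \<inter> sphere 0 R) > 0"
proof -
  let ?p = "\<lambda>x::'a. (R / norm x) *\<^sub>R x" and ?W = "ball 0 R - {0::'a}"
  have "U \<inter> sphere 0 R \<in> sets (restrict_space borel (sphere 0 R))"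
    unfolding sets_restrict_space by (rule image_eqI[where x = U]) (simp_all add: U(1) Int_commute)
  note e = emeasure_sphere_volume[OF R this]
  have "continuous_on ?W ?p" by (intro continuous_intros) auto
  then have op: "open (?W \<inter> ?p -` U)"
    using U(1) by (intro continuous_open_preimage) auto
  \<comment> \<open>A point on the ray through \<open>z\<close> but inside the ball, which shows
    that the open part of the cone over \<open>U\<close> is not empty.\<close>
  have "(1 / 2) *\<^sub>R z \<in> ?W \<inter> ?p -` U" using U R by auto
  then have "\<not> negligible (?W \<inter> ?p -` U)" using open_not_negligible[OF op] by blast
  then have "emeasure lborel (?W \<inter> ?p -` U) \<noteq> 0"
    using op by (simp add: negligible_iff_emeasure0)
  moreover have "emeasure lborel (?W \<inter> ?p -` U) \<le> emeasure lborel (sphere_cone R (U \<inter> sphere 0 R))"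
    using e(2) R by (intro emeasure_mono) auto
  ultimately have "emeasure lborel (sphere_cone R (U \<inter> sphere 0 R)) \<noteq> 0" by (metis le_zero_eq)
  then show ?thesis unfolding e(1) using R by (simp add: zero_less_iff_neq_zero)
qed

text \<open>A linear map that preserves the norm commutes with the radial projection, so the cone
  over a preimage is the preimage of the cone, and invariance of Lebesgue measure applies.\<close>

lemma distr_sphere_volume_isometry:
  fixes T :: "'a::euclidean_space \<Rightarrow> 'a"
  assumes R: "R > 0" and T: "linear T" "\<And>x. norm (T x) = norm x"
  shows "T \<in> sphere_volume R \<rightarrow>\<^sub>M sphere_volume R" "distr (sphere_volume R) (sphere_volume R) T = sphere_volume R"
proof -
  have Tm [measurable]: "T \<in> borel_measurable borel"
    using T(1) by (simp add: linear_continuous_on linear_conv_bounded_linear borel_measurable_continuous_onI)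
  have "T \<in> restrict_space borel (sphere 0 R) \<rightarrow>\<^sub>M restrict_space borel (sphere 0 R)"
    using T(2) by (intro measurable_restrict_space2 measurable_restrict_space1) (auto simp: space_restrict_space)
  then show m: "T \<in> sphere_volume R \<rightarrow>\<^sub>M sphere_volume R"
    using measurable_cong_sets[OF sets_sphere_volume sets_sphere_volume] by blast
  have inj: "T x = 0 \<longleftrightarrow> x = 0" for x using T(2)[of x] by (metis norm_eq_zero)
  show "distr (sphere_volume R) (sphere_volume R) T = sphere_volume R"
  proof (rule measure_eqI)
    fix A assume "A \<in> sets (distr (sphere_volume R) (sphere_volume R) T)"
    then have A: "A \<in> sets (sphere_volume R)" by simp
    let ?A = "T -` A \<inter> space (sphere_volume R)"
    have A': "?A \<in> sets (restrict_space borel (sphere 0 R))"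
      using measurable_sets[OF m A] by simp
    have As: "A \<in> sets (restrict_space borel (sphere 0 R))" using A by simp
    have "sphere_cone R ?A = T -` sphere_cone R A"
      using R T(2) by (auto simp: inj linear_scale[OF T(1)])
    then have "emeasure lborel (sphere_cone R ?A) = emeasure (distr lborel borel T) (sphere_cone R A)"
      using emeasure_sphere_volume(2)[OF R As] by (simp add: emeasure_distr)
    then have "emeasure lborel (sphere_cone R ?A) = emeasure lborel (sphere_cone R A)"
      by (simp add: distr_lborel_isometry[OF T])
    then show "emeasure (distr (sphere_volume R) (sphere_volume R) T) A = emeasure (sphere_volume R) A"
      unfolding emeasure_distr[OF m A] emeasure_sphere_volume(1)[OF R A'] emeasure_sphere_volume(1)[OF R As] by simp
  qed simp
qed

section \<open>The divergence theorem from rotations\<close>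

text \<open>For orthonormal \<open>i\<close> and \<open>j\<close>, the rotation by the angle
  \<open>t\<close> in their plane. It is written as a correction of the identity, so the other
  coordinates need not be named.\<close>

definition rot :: "'e::euclidean_space \<Rightarrow> 'e \<Rightarrow> real \<Rightarrow> 'e \<Rightarrow> 'e" where
  "rot i j t z = z + (cos t - 1) *\<^sub>R ((z \<bullet> i) *\<^sub>R i + (z \<bullet> j) *\<^sub>R j) + sin t *\<^sub>R ((z \<bullet> i) *\<^sub>R j - (z \<bullet> j) *\<^sub>R i)"

lemma linear_rot: "linear (rot i j t)"
  by (rule linearI) (simp_all add: rot_def inner_add_left algebra_simps)

lemma norm_rot:
  fixes i j :: "'e::euclidean_space"
  assumes "i \<in> Basis" "j \<in> Basis" "i \<noteq> j"
  shows "norm (rot i j t z) = norm z"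
proof -
  define a b \<alpha> \<beta> where ab: "a = z \<bullet> i" "b = z \<bullet> j" "\<alpha> = (cos t - 1) * a - sin t * b" "\<beta> = (cos t - 1) * b + sin t * a"
  have r: "rot i j t z = z + (\<alpha> *\<^sub>R i + \<beta> *\<^sub>R j)" by (simp add: rot_def ab algebra_simps)
  have ij: "i \<bullet> i = 1" "j \<bullet> j = 1" "i \<bullet> j = 0" "j \<bullet> i = 0" using assms by (auto simp: inner_Basis)
  have "rot i j t z \<bullet> rot i j t z = z \<bullet> z + (2 * (\<alpha> * a + \<beta> * b) + \<alpha> * \<alpha> + \<beta> * \<beta>)"
    unfolding r by (simp add: inner_add_left inner_add_right ij inner_commute[of i z] inner_commute[of j z] ab(1,2)[symmetric] algebra_simps)
  \<comment> \<open>The change of the squared norm is a multiple of sin^2 + cos^2 - 1.\<close>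
  moreover have "2 * (((c - 1) * a - s * b) * a + ((c - 1) * b + s * a) * b) +
      ((c - 1) * a - s * b) * ((c - 1) * a - s * b) + ((c - 1) * b + s * a) * ((c - 1) * b + s * a) =
      (s\<^sup>2 + c\<^sup>2 - 1) * (a\<^sup>2 + b\<^sup>2)" for s c
    by (simp add: algebra_simps power2_eq_square)
  from this[of "cos t" "sin t"]
  have "2 * (\<alpha> * a + \<beta> * b) + \<alpha> * \<alpha> + \<beta> * \<beta> = 0" unfolding ab(3,4) by simp
  ultimately show ?thesis by (simp add: norm_eq)
qed

lemma rot_has_vector_derivative:
  "((\<lambda>t. rot i j t z) has_vector_derivative (z \<bullet> i) *\<^sub>R j - (z \<bullet> j) *\<^sub>R i) (at 0)"
proof -
  have "((\<lambda>t. z + (cos t - 1) *\<^sub>R u + sin t *\<^sub>R v) has_derivative (\<lambda>s. s *\<^sub>R v)) (at 0)" for u v :: 'a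
    by (auto intro!: derivative_eq_intros)
  then show ?thesis unfolding has_vector_derivative_def rot_def .
qed

lemma smooth_cos_sin_fst:
  "smooth_on_set S (\<lambda>z::real \<times> 'e::euclidean_space. cos (fst z))"
  "smooth_on_set S (\<lambda>z::real \<times> 'e::euclidean_space. sin (fst z))"
proof -
  have "smooth_on_set UNIV (\<lambda>t::real. cos t)" "smooth_on_set UNIV (\<lambda>t::real. sin t)"
    using smooth_on_set_cos_sin[of UNIV 1 "1::real" 0] smooth_on_set_cos_sin[of UNIV 1 "0::real" 1] by simp_all
  then show "smooth_on_set S (\<lambda>z::real \<times> 'e. cos (fst z))" "smooth_on_set S (\<lambda>z::real \<times> 'e. sin (fst z))"
    using smooth_on_set_compose[OF _ smooth_on_set_fst[OF smooth_on_set_id[of S]], of UNIV cos]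
      smooth_on_set_compose[OF _ smooth_on_set_fst[OF smooth_on_set_id[of S]], of UNIV sin] by simp_all
qed

lemma smooth_rot: "smooth_on_set S (\<lambda>z. rot i j (fst z) (snd z))"
  unfolding rot_def
  by (intro smooth_on_set_add smooth_on_set_diff smooth_on_set_scaleR smooth_on_set_inner smooth_on_set_const
      smooth_cos_sin_fst smooth_on_set_snd smooth_on_set_id)

context compact_submanifold
begin

text \<open>The integral of \<open>g\<close> along the flow of an isometry is constant in time; its
  time derivative at 0 is the integral of the derivative of \<open>g\<close> along the Killing
  field.\<close>

lemma integral_pder_killing:
  fixes g :: "'e \<Rightarrow> real"
  assumes M: "\<And>t z. z \<in> M \<Longrightarrow> rot i j t z \<in> M"
    and inv: "\<And>(f :: 'e \<Rightarrow> real) t. continuous_on M f \<Longrightarrow> (\<integral>z. f (rot i j t z) \<partial>vol) = (\<integral>z. f z \<partial>vol)"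
    and tan: "\<And>z. z \<in> M \<Longrightarrow> P z ((z \<bullet> i) *\<^sub>R j - (z \<bullet> j) *\<^sub>R i) = (z \<bullet> i) *\<^sub>R j - (z \<bullet> j) *\<^sub>R i"
    and g: "smooth_on_set M g"
  shows "(\<integral>z. pder g z ((z \<bullet> i) *\<^sub>R j - (z \<bullet> j) *\<^sub>R i) \<partial>vol) = 0"
proof -
  have "((\<lambda>t. \<integral>z. g (rot i j t z) \<partial>vol) has_real_derivative
      (\<integral>z. pder g z ((z \<bullet> i) *\<^sub>R j - (z \<bullet> j) *\<^sub>R i) \<partial>vol)) (at 0)"
  proof (rule has_real_derivative_integral[of 1])
    show "smooth_on_set ({-1<..<1} \<times> M) (\<lambda>z. g (rot i j (fst z) (snd z)))"
      by (rule smooth_on_set_compose[OF g smooth_rot]) (use M in auto)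
    fix z assume z: "z \<in> M"
    let ?K = "(z \<bullet> i) *\<^sub>R j - (z \<bullet> j) *\<^sub>R i"
    have "((\<lambda>t. rot i j t z) has_derivative (\<lambda>t. t *\<^sub>R ?K)) (at 0)"
      using rot_has_vector_derivative unfolding has_vector_derivative_def .
    moreover have "(g has_derivative dir_deriv M g z) (at (rot i j 0 z) within range (\<lambda>t. rot i j t z))"
      using has_derivative_subset[OF smooth_has_derivative[OF g z], of "range (\<lambda>t. rot i j t z)"] M[OF z]
      by (auto simp: rot_def)
    ultimately have "((\<lambda>t. g (rot i j t z)) has_derivative (\<lambda>t. dir_deriv M g z (t *\<^sub>R ?K))) (at 0)"
      by (rule has_derivative_in_compose)
    moreover have "dir_deriv M g z (t *\<^sub>R ?K) = pder g z ?K * t" for t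
      using linear_scale[OF linear_dir_deriv[OF g z], of t ?K] by (simp add: pder_def tan[OF z])
    ultimately show "((\<lambda>t. g (rot i j t z)) has_real_derivative pder g z ?K) (at 0)"
      by (simp add: has_field_derivative_def)
  qed simp
  moreover have "(\<lambda>t. \<integral>z. g (rot i j t z) \<partial>vol) = (\<lambda>t. \<integral>z. g z \<partial>vol)"
    using inv[OF smooth_on_set_continuous_on[OF g]] by blast
  ultimately show ?thesis using DERIV_unique[OF _ DERIV_const] by metis
qed

text \<open>The rotation fields K_i = z_i e_j - z_j e_i have integral zero on every function; they
  are applied to z_i f and summed over i in \<open>B\<close>. The sum of z_i K_i is R^2 times the
  projection of e_j, while differentiating the factors z_i produces -(card B - 1) z_j f. A block
  \<open>B\<close> of coordinates allows the same argument for either sphere factor.\<close>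

lemma divergence_block:
  fixes f :: "'e \<Rightarrow> real"
  assumes B: "B \<subseteq> Basis" and j: "j \<in> B" and R: "R > 0"
    and norm: "\<And>z. z \<in> M \<Longrightarrow> (\<Sum>i\<in>B. (z \<bullet> i) * (z \<bullet> i)) = R\<^sup>2"
    and P: "\<And>z k. z \<in> M \<Longrightarrow> k \<in> B \<Longrightarrow> P z k = k - ((z \<bullet> k) / R\<^sup>2) *\<^sub>R (\<Sum>i\<in>B. (z \<bullet> i) *\<^sub>R i)"
    and M: "\<And>i k t z. i \<in> B \<Longrightarrow> k \<in> B \<Longrightarrow> i \<noteq> k \<Longrightarrow> z \<in> M \<Longrightarrow> rot i k t z \<in> M"
    and inv: "\<And>i k (f :: 'e \<Rightarrow> real) t. i \<in> B \<Longrightarrow> k \<in> B \<Longrightarrow> i \<noteq> k \<Longrightarrow> continuous_on M f \<Longrightarrow>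
      (\<integral>z. f (rot i k t z) \<partial>vol) = (\<integral>z. f z \<partial>vol)"
    and f: "smooth_on_set M f"
  shows "(\<integral>z. pder f z j \<partial>vol) = (\<integral>z. ((real (card B) - 1) / R\<^sup>2 * (z \<bullet> j)) * f z \<partial>vol)"
proof -
  have finB: "finite B" using B finite_Basis finite_subset by blast
  let ?K = "\<lambda>i z. (z \<bullet> i) *\<^sub>R j - (z \<bullet> j) *\<^sub>R i"
  let ?X = "\<lambda>z. \<Sum>i\<in>B. (z \<bullet> i) *\<^sub>R i"
  have tan: "P z (?K i z) = ?K i z" if "i \<in> B" "z \<in> M" for i z
  proof -
    have "P z (?K i z) = (z \<bullet> i) *\<^sub>R P z j - (z \<bullet> j) *\<^sub>R P z i"
      by (simp only: linear_diff[OF linear_P[OF that(2)]] linear_scale[OF linear_P[OF that(2)]])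
    then show ?thesis
      unfolding P[OF that(2) that(1)] P[OF that(2) j] by (simp add: scaleR_diff_right mult.commute)
  qed
  have sg: "smooth_on_set M (\<lambda>z. (z \<bullet> i) * f z)" for i
    by (intro smooth_on_set_mult smooth_on_set_inner smooth_on_set_id smooth_on_set_const f)
  have zero: "(\<integral>z. pder (\<lambda>z. (z \<bullet> i) * f z) z (?K i z) \<partial>vol) = 0" if i: "i \<in> B" for i
  proof (cases "i = j")
    case True
    have "pder (\<lambda>z. (z \<bullet> j) * f z) z 0 = 0" if "z \<in> M" for z
      by (rule linear_0[OF linear_pder[OF sg that]])
    then have "(\<integral>z. pder (\<lambda>z. (z \<bullet> j) * f z) z (?K j z) \<partial>vol) = (\<integral>z. 0 \<partial>vol)"
      by (intro integral_cong_M) simp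
    then show ?thesis using True by simp
  next
    case False
    show ?thesis
      by (rule integral_pder_killing[OF M[OF i j False] inv[OF i j False] tan[OF i] sg])
  qed
  have spd: "smooth_on_set M (\<lambda>z. pder g z (X z))" if "smooth_on_set M g" "smooth_on_set M X" for g :: "'e \<Rightarrow> real" and X
    using smooth_slice[OF smooth_pder[OF smooth_const_family[OF that(1)] smooth_const_family[OF that(2)]], of 0 UNIV] by simp
  have sK: "smooth_on_set M (?K i)" for i
    by (intro smooth_on_set_diff smooth_on_set_scaleR smooth_on_set_inner smooth_on_set_id smooth_on_set_const)
  have "(\<integral>z. R\<^sup>2 * pder f z j - (real (card B) - 1) * (z \<bullet> j) * f z \<partial>vol) =
      (\<integral>z. (\<Sum>i\<in>B. pder (\<lambda>z. (z \<bullet> i) * f z) z (?K i z)) \<partial>vol)"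
  proof (rule integral_cong_M)
    fix z assume z: "z \<in> M"
    have lin: "linear (pder f z)" by (rule linear_pder[OF f z])
    have id: "pder (\<lambda>z. z \<bullet> i) z v = P z v \<bullet> i" for i v
      by (rule pder_eq[OF _ z]) (auto intro!: derivative_eq_intros)
    have si: "smooth_on_set M (\<lambda>z. z \<bullet> i)" for i
      by (intro smooth_on_set_inner smooth_on_set_id smooth_on_set_const)
    have ji: "(j \<bullet> i) = (if i = j then 1 else 0)" "i \<bullet> i = 1" if "i \<in> B" for i
    proof -
      have "i \<in> Basis" "j \<in> Basis" using that j B by auto
      then show "(j \<bullet> i) = (if i = j then 1 else 0)" "i \<bullet> i = 1" by (auto simp: inner_Basis)
    qed
    have "pder (\<lambda>z. (z \<bullet> i) * f z) z (?K i z) =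
        pder f z ((z \<bullet> i) *\<^sub>R ?K i z) + ((if i = j then z \<bullet> j else 0) - (z \<bullet> j)) * f z" if i: "i \<in> B" for i
      using pder_bilinear[OF bounded_bilinear_mult si f z, of i "?K i z"]
      by (simp add: id tan[OF i z] inner_diff_left ji[OF i] linear_scale[OF lin])
    then have "(\<Sum>i\<in>B. pder (\<lambda>z. (z \<bullet> i) * f z) z (?K i z)) =
        pder f z (\<Sum>i\<in>B. (z \<bullet> i) *\<^sub>R ?K i z) + (\<Sum>i\<in>B. (if i = j then z \<bullet> j else 0) - (z \<bullet> j)) * f z"
      by (simp add: sum.distrib linear_sum[OF lin] sum_distrib_right)
    also have "(\<Sum>i\<in>B. (if i = j then z \<bullet> j else 0) - (z \<bullet> j)) = - (real (card B) - 1) * (z \<bullet> j)"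
      using finB j by (simp add: sum_subtractf algebra_simps)
    also have "(\<Sum>i\<in>B. (z \<bullet> i) *\<^sub>R ?K i z) = R\<^sup>2 *\<^sub>R P z j"
    proof -
      have "(\<Sum>i\<in>B. (z \<bullet> i) *\<^sub>R ?K i z) = (\<Sum>i\<in>B. (z \<bullet> i) * (z \<bullet> i)) *\<^sub>R j - (z \<bullet> j) *\<^sub>R ?X z"
        by (simp add: scaleR_diff_right sum_subtractf scaleR_sum_left scaleR_sum_right mult.commute)
      then show ?thesis using R by (simp add: norm[OF z] P[OF z j] scaleR_diff_right)
    qed
    also have "pder f z (R\<^sup>2 *\<^sub>R P z j) = R\<^sup>2 * pder f z j"
      by (simp add: linear_scale[OF lin] pder_P[OF z])
    finally show "R\<^sup>2 * pder f z j - (real (card B) - 1) * (z \<bullet> j) * f z =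
        (\<Sum>i\<in>B. pder (\<lambda>z. (z \<bullet> i) * f z) z (?K i z))" by (simp add: algebra_simps)
  qed
  also have "\<dots> = (\<Sum>i\<in>B. (\<integral>z. pder (\<lambda>z. (z \<bullet> i) * f z) z (?K i z) \<partial>vol))"
    by (rule Bochner_Integration.integral_sum) (intro integrable_smooth spd sg sK)
  also have "\<dots> = 0" by (simp add: zero)
  finally have "(\<integral>z. R\<^sup>2 * pder f z j - (real (card B) - 1) * (z \<bullet> j) * f z \<partial>vol) = 0" .
  moreover have "integrable vol (\<lambda>z. R\<^sup>2 * pder f z j)" "integrable vol (\<lambda>z. (real (card B) - 1) * (z \<bullet> j) * f z)"
    by (intro integrable_smooth smooth_on_set_mult smooth_on_set_const spd f smooth_on_set_inner smooth_on_set_id)+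
  ultimately have "R\<^sup>2 * (\<integral>z. pder f z j \<partial>vol) = (\<integral>z. (real (card B) - 1) * (z \<bullet> j) * f z \<partial>vol)"
    by simp
  then have "(\<integral>z. pder f z j \<partial>vol) = (1 / R\<^sup>2) * (\<integral>z. (real (card B) - 1) * (z \<bullet> j) * f z \<partial>vol)"
    using R by (simp add: field_simps)
  also have "\<dots> = (\<integral>z. (1 / R\<^sup>2) * ((real (card B) - 1) * (z \<bullet> j) * f z) \<partial>vol)" by simp
  finally show ?thesis by (simp add: mult.assoc)
qed

end

section \<open>The generalized Clifford torus\<close>

definition torus_proj :: "real \<Rightarrow> real \<Rightarrow> 'a::euclidean_space \<times> 'b::euclidean_space \<Rightarrow> 'a \<times> 'b \<Rightarrow> 'a \<times> 'b" where
  "torus_proj R1 R2 z v = (fst v - ((fst v \<bullet> fst z) / R1\<^sup>2) *\<^sub>R fst z, snd v - ((snd v \<bullet> snd z) / R2\<^sup>2) *\<^sub>R snd z)"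

text \<open>The field \<open>H\<close> of \<open>closed_submanifold\<close> for the torus: a sphere
  factor of dimension n and radius R contributes n / R^2 times its position vector.\<close>

definition torus_mean :: "real \<Rightarrow> real \<Rightarrow> 'a::euclidean_space \<times> 'b::euclidean_space \<Rightarrow> 'a \<times> 'b" where
  "torus_mean R1 R2 z = (((real DIM('a) - 1) / R1\<^sup>2) *\<^sub>R fst z, ((real DIM('b) - 1) / R2\<^sup>2) *\<^sub>R snd z)"

lemma tangent_space_clifford_torus:
  fixes z :: "'a::euclidean_space \<times> 'b::euclidean_space"
  assumes R: "R1 > 0" "R2 > 0" and z: "z \<in> clifford_torus R1 R2"
  shows "tangent_space (clifford_torus R1 R2) z = {v. fst v \<bullet> fst z = 0 \<and> snd v \<bullet> snd z = 0}"
proof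
  have n: "norm (fst y) = R1" "norm (snd y) = R2" if "y \<in> clifford_torus R1 R2" for y :: "'a \<times> 'b"
    using that by (auto simp: clifford_torus_def)
  show "tangent_space (clifford_torus R1 R2) z \<subseteq> {v. fst v \<bullet> fst z = 0 \<and> snd v \<bullet> snd z = 0}"
    using tangent_space_inner_zero[OF bounded_linear_fst n(1)] tangent_space_inner_zero[OF bounded_linear_snd n(2)] by blast
  show "{v. fst v \<bullet> fst z = 0 \<and> snd v \<bullet> snd z = 0} \<subseteq> tangent_space (clifford_torus R1 R2) z"
  proof
    fix v assume "v \<in> {v. fst v \<bullet> fst z = 0 \<and> snd v \<bullet> snd z = 0}"
    then have v: "fst v \<bullet> fst z = 0" "snd v \<bullet> snd z = 0" by auto
    let ?\<gamma> = "\<lambda>t. (sphere_curve R1 (fst z) (fst v) t, sphere_curve R2 (snd z) (snd v) t)"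
    have im: "?\<gamma> ` {-1<..<1} \<subseteq> clifford_torus R1 R2"
      using norm_sphere_curve[OF R(1) n(1)[OF z] v(1)] norm_sphere_curve[OF R(2) n(2)[OF z] v(2)]
      by (auto simp: clifford_torus_def)
    have "(?\<gamma> has_vector_derivative (fst v, snd v)) (at 0)"
      by (intro has_vector_derivative_Pair sphere_curve_has_vector_derivative R)
    then have d: "(?\<gamma> has_vector_derivative v) (at 0)" by simp
    have s: "smooth_on_set {-1<..<1} ?\<gamma>"
      by (intro smooth_on_set_Pair smooth_sphere_curve)
    show "v \<in> tangent_space (clifford_torus R1 R2) z"
      unfolding tangent_space_def
      by (intro CollectI exI[of _ "1::real"] exI[of _ ?\<gamma>] conjI s im d) simp_all
  qed
qed

lemma clifford_torus_inner:
  assumes "z \<in> clifford_torus R1 R2"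
  shows "fst z \<bullet> fst z = R1\<^sup>2" "snd z \<bullet> snd z = R2\<^sup>2"
  using assms by (auto simp: clifford_torus_def power2_norm_eq_inner[symmetric])

lemma submanifold_clifford_torus:
  assumes R: "R1 > 0" "R2 > 0"
  shows "submanifold (clifford_torus R1 R2 :: ('a::euclidean_space \<times> 'b::euclidean_space) set) (torus_proj R1 R2)"
proof (rule submanifold.intro)
  have R0: "R1 \<noteq> 0" "R2 \<noteq> 0" using R by auto
  fix z :: "'a \<times> 'b" assume z: "z \<in> clifford_torus R1 R2"
  note n = clifford_torus_inner[OF z]
  have orth: "fst (torus_proj R1 R2 z v) \<bullet> fst z = 0" "snd (torus_proj R1 R2 z v) \<bullet> snd z = 0" for v :: "'a \<times> 'b"
    using R0 by (simp_all add: torus_proj_def inner_diff_left n)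
  have fixed: "torus_proj R1 R2 z v = v" if "fst v \<bullet> fst z = 0" "snd v \<bullet> snd z = 0" for v :: "'a \<times> 'b"
    using that by (simp add: torus_proj_def)
  show "tangent_space (clifford_torus R1 R2) z = range (torus_proj R1 R2 z)"
    unfolding tangent_space_clifford_torus[OF R z]
  proof (intro set_eqI iffI)
    fix v assume "v \<in> {v. fst v \<bullet> fst z = 0 \<and> snd v \<bullet> snd z = 0}"
    then have "torus_proj R1 R2 z v = v" by (intro fixed) auto
    then show "v \<in> range (torus_proj R1 R2 z)" by (metis rangeI)
  qed (use orth in auto)
  show "linear (torus_proj R1 R2 z)"
    by (rule linearI) (simp_all add: torus_proj_def inner_add_left algebra_simps add_divide_distrib)
  show "torus_proj R1 R2 z u \<bullet> v = u \<bullet> torus_proj R1 R2 z v" for u v :: "'a \<times> 'b"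
    by (simp add: torus_proj_def inner_prod_def inner_diff_left inner_diff_right inner_commute mult.commute)
  show "torus_proj R1 R2 z (torus_proj R1 R2 z v) = torus_proj R1 R2 z v" for v :: "'a \<times> 'b"
    by (rule fixed[OF orth])
next
  show "smooth_on_set (clifford_torus R1 R2) (\<lambda>z. torus_proj R1 R2 z v)" for v :: "'a \<times> 'b"
    unfolding torus_proj_def divide_inverse
    by (intro smooth_on_set_Pair smooth_on_set_diff smooth_on_set_scaleR smooth_on_set_mult smooth_on_set_inner
        smooth_on_set_fst smooth_on_set_snd smooth_on_set_id smooth_on_set_const)
qed

lemma compact_submanifold_clifford_torus:
  assumes R: "R1 > 0" "R2 > 0"
  shows "compact_submanifold (clifford_torus R1 R2 :: ('a::euclidean_space \<times> 'b::euclidean_space) set)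
    (torus_proj R1 R2) (clifford_volume R1 R2)"
proof -
  let ?M = "clifford_torus R1 R2 :: ('a \<times> 'b) set" and ?v = "clifford_volume R1 R2 :: ('a \<times> 'b) measure"
  interpret submanifold ?M "torus_proj R1 R2" by (rule submanifold_clifford_torus[OF R])
  let ?s1 = "sphere_volume R1 :: 'a measure" and ?s2 = "sphere_volume R2 :: 'b measure"
  interpret s1: finite_measure ?s1 by (rule finite_measure_sphere_volume[OF R(1)])
  interpret s2: finite_measure ?s2 by (rule finite_measure_sphere_volume[OF R(2)])
  have id1: "(\<lambda>x. x) \<in> ?s1 \<rightarrow>\<^sub>M borel"
    unfolding measurable_cong_sets[OF sets_sphere_volume refl] by (rule measurable_restrict_space1) simp
  have id2: "(\<lambda>x. x) \<in> ?s2 \<rightarrow>\<^sub>M borel"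
    unfolding measurable_cong_sets[OF sets_sphere_volume refl] by (rule measurable_restrict_space1) simp
  show ?thesis
  proof (intro compact_submanifold.intro compact_submanifold_axioms.intro)
    show "submanifold ?M (torus_proj R1 R2)" by (rule submanifold_clifford_torus[OF R])
    show "compact ?M" unfolding clifford_torus_def by (intro compact_Times compact_sphere)
    show sp: "space ?v = ?M"
      by (simp add: clifford_volume_def clifford_torus_def space_pair_measure)
    have "(\<lambda>z. (fst z, snd z)) \<in> ?v \<rightarrow>\<^sub>M borel \<Otimes>\<^sub>M borel"
      unfolding clifford_volume_def
      using measurable_compose[OF measurable_fst id1] measurable_compose[OF measurable_snd id2]
      by (rule measurable_Pair)
    then show "(\<lambda>x. x) \<in> ?v \<rightarrow>\<^sub>M borel" by (simp add: borel_prod)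
    show "finite_measure ?v"
      unfolding clifford_volume_def by (rule finite_measure_pair_measure) unfold_locales
    fix U :: "('a \<times> 'b) set" assume U: "open U" "U \<inter> ?M \<noteq> {}"
    then obtain z where z: "z \<in> U" "z \<in> ?M" by blast
    obtain x y where "z = (x, y)" by (cases z)
    with z have xy: "(x, y) \<in> U" "norm x = R1" "norm y = R2" by (simp_all add: clifford_torus_def)
    obtain A B where AB: "open A" "open B" "(x, y) \<in> A \<times> B" "A \<times> B \<subseteq> U"
      using open_prod_elim[OF U(1) xy(1)] by metis
    have sA: "A \<inter> sphere 0 R1 \<in> sets ?s1"
      unfolding sets_sphere_volume sets_restrict_space
      by (rule image_eqI[where x = A]) (simp_all add: AB Int_commute)
    have sB: "B \<inter> sphere 0 R2 \<in> sets ?s2"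
      unfolding sets_sphere_volume sets_restrict_space
      by (rule image_eqI[where x = B]) (simp_all add: AB Int_commute)
    have "0 < emeasure ?s1 (A \<inter> sphere 0 R1) * emeasure ?s2 (B \<inter> sphere 0 R2)"
      using emeasure_sphere_volume_pos[OF R(1) AB(1) _ xy(2)] emeasure_sphere_volume_pos[OF R(2) AB(2) _ xy(3)] AB(3)
      by (simp add: ennreal_zero_less_mult_iff)
    also have "\<dots> = emeasure ?v ((A \<inter> sphere 0 R1) \<times> (B \<inter> sphere 0 R2))"
      unfolding clifford_volume_def by (rule s2.emeasure_pair_measure_Times[OF sA sB, symmetric])
    also have "\<dots> \<le> emeasure ?v (U \<inter> ?M)"
    proof (rule emeasure_mono)
      show "(A \<inter> sphere 0 R1) \<times> (B \<inter> sphere 0 R2) \<subseteq> U \<inter> ?M" using AB(4) by (auto simp: clifford_torus_def)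
      have "(\<lambda>x. x) -` U \<inter> space ?v \<in> sets ?v"
        using \<open>(\<lambda>x. x) \<in> ?v \<rightarrow>\<^sub>M borel\<close> U(1) by (intro measurable_sets) auto
      then show "U \<inter> ?M \<in> sets ?v" by (simp add: sp)
    qed
    finally show "emeasure ?v (U \<inter> ?M) > 0" .
  qed
qed

lemma integral_clifford_isometry:
  fixes T1 :: "'a::euclidean_space \<Rightarrow> 'a" and T2 :: "'b::euclidean_space \<Rightarrow> 'b" and f :: "'a \<times> 'b \<Rightarrow> real"
  assumes R: "R1 > 0" "R2 > 0" and T1: "linear T1" "\<And>x. norm (T1 x) = norm x"
    and T2: "linear T2" "\<And>x. norm (T2 x) = norm x" and f: "continuous_on (clifford_torus R1 R2) f"
  shows "(\<integral>z. f (T1 (fst z), T2 (snd z)) \<partial>clifford_volume R1 R2) = (\<integral>z. f z \<partial>clifford_volume R1 R2)"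
proof -
  interpret compact_submanifold "clifford_torus R1 R2 :: ('a \<times> 'b) set" "torus_proj R1 R2" "clifford_volume R1 R2"
    by (rule compact_submanifold_clifford_torus[OF R])
  let ?s1 = "sphere_volume R1 :: 'a measure" and ?s2 = "sphere_volume R2 :: 'b measure"
  let ?T = "\<lambda>(x, y). (T1 x, T2 y)"
  note d1 = distr_sphere_volume_isometry[OF R(1) T1] and d2 = distr_sphere_volume_isometry[OF R(2) T2]
  interpret s2: finite_measure ?s2 by (rule finite_measure_sphere_volume[OF R(2)])
  have "sigma_finite_measure (distr ?s2 ?s2 T2)" unfolding d2(2) by unfold_locales
  from pair_measure_distr[OF d1(1) d2(1) this]
  have d: "distr (clifford_volume R1 R2) (clifford_volume R1 R2) ?T = clifford_volume R1 R2"
    by (simp add: d1(2) d2(2) clifford_volume_def)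
  have m: "?T \<in> clifford_volume R1 R2 \<rightarrow>\<^sub>M clifford_volume R1 R2"
    using measurable_Pair[OF measurable_compose[OF measurable_fst d1(1)] measurable_compose[OF measurable_snd d2(1)]]
    by (simp add: clifford_volume_def case_prod_unfold)
  have "(\<integral>z. f z \<partial>clifford_volume R1 R2) = (\<integral>z. f z \<partial>distr (clifford_volume R1 R2) (clifford_volume R1 R2) ?T)"
    by (simp only: d)
  also have "\<dots> = (\<integral>z. f (?T z) \<partial>clifford_volume R1 R2)"
    by (rule integral_distr[OF m borel_measurable_vol[OF f]])
  finally show ?thesis by (simp add: case_prod_unfold)
qed

lemma sum_Basis_Pair:
  "(\<Sum>b\<in>Basis. F b) = (\<Sum>i\<in>Basis. F (i::'a::euclidean_space, 0)) + (\<Sum>i\<in>Basis. F (0, i::'b::euclidean_space))"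
proof -
  have "inj_on (\<lambda>u. (u::'a, 0::'b)) Basis" "inj_on (\<lambda>u. (0::'a, u::'b)) Basis"
    by (auto intro!: inj_onI Pair_inject)
  then show ?thesis
    unfolding Basis_prod_def
    by (subst sum.union_disjoint) (auto simp: Basis_prod_def sum.reindex)
qed

lemma closed_submanifold_clifford_torus:
  assumes R: "R1 > 0" "R2 > 0"
  shows "closed_submanifold (clifford_torus R1 R2 :: ('a::euclidean_space \<times> 'b::euclidean_space) set)
    (torus_proj R1 R2) (clifford_volume R1 R2) (torus_mean R1 R2)"
proof -
  let ?M = "clifford_torus R1 R2 :: ('a \<times> 'b) set" and ?v = "clifford_volume R1 R2 :: ('a \<times> 'b) measure"
  interpret compact_submanifold ?M "torus_proj R1 R2" ?v
    by (rule compact_submanifold_clifford_torus[OF R])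
  have R0: "R1 \<noteq> 0" "R2 \<noteq> 0" using R by auto
  have rot1: "rot (i, 0) (k, 0) t z = (rot i k t (fst z), snd z)" for i k :: 'a and t and z :: "'a \<times> 'b"
    by (rule prod_eqI) (simp_all add: rot_def inner_prod_def)
  have rot2: "rot (0, i) (0, k) t z = (fst z, rot i k t (snd z))" for i k :: 'b and t and z :: "'a \<times> 'b"
    by (rule prod_eqI) (simp_all add: rot_def inner_prod_def)
  let ?B1 = "(\<lambda>i. (i, 0)) ` Basis :: ('a \<times> 'b) set" and ?B2 = "(\<lambda>i. (0, i)) ` Basis :: ('a \<times> 'b) set"
  have inj: "inj_on (\<lambda>u. (u::'a, 0::'b)) Basis" "inj_on (\<lambda>u. (0::'a, u::'b)) Basis"
    by (auto intro!: inj_onI)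
  have sum_fst: "(\<Sum>i\<in>?B1. (z \<bullet> i) *\<^sub>R i) = (fst z, 0)" for z
    by (simp add: sum.reindex[OF inj(1)] inner_prod_def)
      (rule prod_eqI, simp_all add: fst_sum snd_sum euclidean_representation)
  have sum_snd: "(\<Sum>i\<in>?B2. (z \<bullet> i) *\<^sub>R i) = (0, snd z)" for z
    by (simp add: sum.reindex[OF inj(2)] inner_prod_def)
      (rule prod_eqI, simp_all add: fst_sum snd_sum euclidean_representation)
  have id: "linear (\<lambda>x. x)" by (rule linear_ident)
  show ?thesis
  proof unfold_locales
    show "smooth_on_set ?M (torus_mean R1 R2)"
      unfolding torus_mean_def[abs_def]
      by (intro smooth_on_set_Pair smooth_on_set_scaleR smooth_on_set_fst smooth_on_set_snd smooth_on_set_id smooth_on_set_const)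
    show "torus_proj R1 R2 z (torus_mean R1 R2 z) = 0" if "z \<in> ?M" for z
      using R0 by (simp add: torus_proj_def torus_mean_def clifford_torus_inner[OF that] prod_eq_iff)
    fix f :: "'a \<times> 'b \<Rightarrow> real" and b :: "'a \<times> 'b"
    assume f: "smooth_on_set ?M f" and b: "b \<in> Basis"
    consider (1) "b \<in> ?B1" | (2) "b \<in> ?B2" using b by (auto simp: Basis_prod_def)
    then show "(\<integral>z. pder f z b \<partial>?v) = (\<integral>z. (torus_mean R1 R2 z \<bullet> b) * f z \<partial>?v)"
    proof cases
      case 1
      have "(\<integral>z. pder f z b \<partial>?v) = (\<integral>z. ((real (card ?B1) - 1) / R1\<^sup>2 * (z \<bullet> b)) * f z \<partial>?v)"
      proof (rule divergence_block[OF _ 1 R(1) _ _ _ _ f])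
        show "?B1 \<subseteq> Basis" by (auto simp: Basis_prod_def)
        show "(\<Sum>i\<in>?B1. (z \<bullet> i) * (z \<bullet> i)) = R1\<^sup>2" if "z \<in> ?M" for z
          using clifford_torus_inner(1)[OF that] euclidean_inner[of "fst z" "fst z"]
          by (simp add: sum.reindex[OF inj(1)] inner_prod_def)
        show "torus_proj R1 R2 z k = k - ((z \<bullet> k) / R1\<^sup>2) *\<^sub>R (\<Sum>i\<in>?B1. (z \<bullet> i) *\<^sub>R i)" if "z \<in> ?M" "k \<in> ?B1" for z k
          unfolding sum_fst using that(2) by (auto simp: inner_prod_def torus_proj_def inner_commute)
        fix i k t assume ik: "i \<in> ?B1" "k \<in> ?B1" "i \<noteq> k"
        then obtain i' k' where i': "i = (i', 0)" "k = (k', 0)" "i' \<in> Basis" "k' \<in> Basis" "i' \<noteq> k'" by auto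
        show "rot i k t z \<in> ?M" if "z \<in> ?M" for z
          using that i' by (auto simp: rot1 clifford_torus_def norm_rot)
        show "(\<integral>z. g (rot i k t z) \<partial>?v) = (\<integral>z. g z \<partial>?v)" if "continuous_on ?M g" for g :: "'a \<times> 'b \<Rightarrow> real"
          using integral_clifford_isometry[OF R linear_rot norm_rot[OF i'(3-5)] id refl that] by (simp add: i' rot1)
      qed
      moreover have "torus_mean R1 R2 z \<bullet> b = (real (card ?B1) - 1) / R1\<^sup>2 * (z \<bullet> b)" for z
        using 1 by (auto simp: torus_mean_def inner_prod_def card_image[OF inj(1)])
      ultimately show ?thesis by simp
    next
      case 2
      have "(\<integral>z. pder f z b \<partial>?v) = (\<integral>z. ((real (card ?B2) - 1) / R2\<^sup>2 * (z \<bullet> b)) * f z \<partial>?v)"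
      proof (rule divergence_block[OF _ 2 R(2) _ _ _ _ f])
        show "?B2 \<subseteq> Basis" by (auto simp: Basis_prod_def)
        show "(\<Sum>i\<in>?B2. (z \<bullet> i) * (z \<bullet> i)) = R2\<^sup>2" if "z \<in> ?M" for z
          using clifford_torus_inner(2)[OF that] euclidean_inner[of "snd z" "snd z"]
          by (simp add: sum.reindex[OF inj(2)] inner_prod_def)
        show "torus_proj R1 R2 z k = k - ((z \<bullet> k) / R2\<^sup>2) *\<^sub>R (\<Sum>i\<in>?B2. (z \<bullet> i) *\<^sub>R i)" if "z \<in> ?M" "k \<in> ?B2" for z k
          unfolding sum_snd using that(2) by (auto simp: inner_prod_def torus_proj_def inner_commute)
        fix i k t assume ik: "i \<in> ?B2" "k \<in> ?B2" "i \<noteq> k"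
        then obtain i' k' where i': "i = (0, i')" "k = (0, k')" "i' \<in> Basis" "k' \<in> Basis" "i' \<noteq> k'" by auto
        show "rot i k t z \<in> ?M" if "z \<in> ?M" for z
          using that i' by (auto simp: rot2 clifford_torus_def norm_rot)
        show "(\<integral>z. g (rot i k t z) \<partial>?v) = (\<integral>z. g z \<partial>?v)" if "continuous_on ?M g" for g :: "'a \<times> 'b \<Rightarrow> real"
          using integral_clifford_isometry[OF R id refl linear_rot norm_rot[OF i'(3-5)] that] by (simp add: i' rot2)
      qed
      moreover have "torus_mean R1 R2 z \<bullet> b = (real (card ?B2) - 1) / R2\<^sup>2 * (z \<bullet> b)" for z
        using 2 by (auto simp: torus_mean_def inner_prod_def card_image[OF inj(2)])
      ultimately show ?thesis by simp
    qed
  qed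
qed

section \<open>Extrinsic geometry of the generalized Clifford torus\<close>

locale clifford =
  fixes R1 R2 p q :: real and M :: "('a::euclidean_space \<times> 'b::euclidean_space) set"
  assumes R1: "R1 > 0" and R2: "R2 > 0" and unit: "R1\<^sup>2 + R2\<^sup>2 = 1" and M_eq: "M = clifford_torus R1 R2"
    and p_eq: "p = real DIM('a) - 1" and q_eq: "q = real DIM('b) - 1"
begin

abbreviation "vol \<equiv> clifford_volume R1 R2 :: ('a \<times> 'b) measure"
abbreviation "pr \<equiv> torus_proj R1 R2 :: 'a \<times> 'b \<Rightarrow> 'a \<times> 'b \<Rightarrow> 'a \<times> 'b"
text \<open>R1 R2 times the unit normal of the torus in the sphere. The scaling avoids divisions,
  and the squared length becomes \<open>rho\<close>.\<close>

definition nu :: "'a \<times> 'b \<Rightarrow> 'a \<times> 'b" where "nu z = (R2\<^sup>2 *\<^sub>R fst z, - R1\<^sup>2 *\<^sub>R snd z)"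
text \<open>Up to a common sign the principal curvatures in the sphere are R2 / R1 with multiplicity
  p and -R1 / R2 with multiplicity q. Their sum is R1 R2 times \<open>kap\<close>, and the sum of
  their squares is \<open>mu\<close>.\<close>

definition "kap = p / R1\<^sup>2 - q / R2\<^sup>2"
definition "mu = R2\<^sup>2 * (p / R1\<^sup>2) + R1\<^sup>2 * (q / R2\<^sup>2)"
definition "rho = R1\<^sup>2 * R2\<^sup>2"

sublocale closed_submanifold M "torus_proj R1 R2" vol "torus_mean R1 R2"
  unfolding M_eq by (rule closed_submanifold_clifford_torus[OF R1 R2])

lemma torus_mean_eq: "torus_mean R1 R2 z = ((p / R1\<^sup>2) *\<^sub>R fst z, (q / R2\<^sup>2) *\<^sub>R snd z)" for z :: "'a \<times> 'b"
  by (simp add: torus_mean_def p_eq q_eq)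

lemma inner_M: "z \<in> M \<Longrightarrow> fst z \<bullet> fst z = R1\<^sup>2" "z \<in> M \<Longrightarrow> snd z \<bullet> snd z = R2\<^sup>2"
  using clifford_torus_inner[of z R1 R2] by (simp_all add: M_eq)

lemma R0: "R1 \<noteq> 0" "R2 \<noteq> 0"
  using R1 R2 by auto

lemma pr_orthogonal: "z \<in> M \<Longrightarrow> fst (pr z w) \<bullet> fst z = 0" "z \<in> M \<Longrightarrow> snd (pr z w) \<bullet> snd z = 0"
  using R0 by (simp_all add: torus_proj_def inner_diff_left inner_M)

lemma M_nonempty: "\<exists>z. z \<in> M"
proof -
  obtain x :: 'a where "norm x = R1" using vector_choose_size R1 less_imp_le by metis
  moreover obtain y :: 'b where "norm y = R2" using vector_choose_size R2 less_imp_le by metis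
  ultimately have "(x, y) \<in> M" by (simp add: M_eq clifford_torus_def)
  then show ?thesis by blast
qed

text \<open>Differentiating the projection of a fixed tangent vector gives a normal vector, the
  second fundamental form of the torus in the ambient space.\<close>

lemma pder_pr_tangent:
  assumes z: "z \<in> M"
  shows "pder (\<lambda>y. pr y (pr z w)) z u =
    - (((fst (pr z w) \<bullet> fst (pr z u)) / R1\<^sup>2) *\<^sub>R fst z, ((snd (pr z w) \<bullet> snd (pr z u)) / R2\<^sup>2) *\<^sub>R snd z)"
proof -
  let ?w = "pr z w"
  have prod: "((\<lambda>y. a y *\<^sub>R B y) has_derivative (\<lambda>v. a z *\<^sub>R B v + a v *\<^sub>R B z)) (at z within M)"
    if "linear a" "linear B" for a :: "'a \<times> 'b \<Rightarrow> real" and B :: "'a \<times> 'b \<Rightarrow> 'c::euclidean_space"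
    using that by (intro bounded_bilinear.FDERIV[OF bounded_bilinear_scaleR] bounded_linear_imp_has_derivative)
      (simp_all add: linear_conv_bounded_linear)
  have l: "linear (\<lambda>y::'a \<times> 'b. (fst ?w \<bullet> fst y) / R1\<^sup>2)" "linear (\<lambda>y::'a \<times> 'b. (snd ?w \<bullet> snd y) / R2\<^sup>2)"
    by (rule linearI, simp_all add: inner_add_right add_divide_distrib)+
  have "((\<lambda>y. pr y ?w) has_derivative
      (\<lambda>v. (0 - (((fst ?w \<bullet> fst z) / R1\<^sup>2) *\<^sub>R fst v + ((fst ?w \<bullet> fst v) / R1\<^sup>2) *\<^sub>R fst z),
            0 - (((snd ?w \<bullet> snd z) / R2\<^sup>2) *\<^sub>R snd v + ((snd ?w \<bullet> snd v) / R2\<^sup>2) *\<^sub>R snd z)))) (at z within M)"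
    unfolding torus_proj_def[of R1 R2 _ ?w]
    by (intro has_derivative_Pair has_derivative_diff has_derivative_const prod l linear_fst linear_snd)
  from pder_eq[OF this z] show ?thesis by (simp add: pr_orthogonal[OF z])
qed

lemma trace_pr:
  assumes z: "z \<in> M"
  shows "(\<Sum>b\<in>Basis. fst (pr z b) \<bullet> fst (pr z b)) = p" "(\<Sum>b\<in>Basis. snd (pr z b) \<bullet> snd (pr z b)) = q"
proof -
  have 1: "(i - ((i \<bullet> x) / R\<^sup>2) *\<^sub>R x) \<bullet> (i - ((i \<bullet> x) / R\<^sup>2) *\<^sub>R x) = 1 - (x \<bullet> i) * (x \<bullet> i) / R\<^sup>2"
    if "i \<in> Basis" "x \<bullet> x = R\<^sup>2" "R \<noteq> 0" for i x :: "'c::euclidean_space" and R :: real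
    using that by (simp add: inner_diff_left inner_diff_right inner_commute[of i x] power2_eq_square)
  have 2: "(\<Sum>i\<in>Basis. 1 - (x \<bullet> i) * (x \<bullet> i) / R\<^sup>2) = real DIM('c) - 1"
    if "x \<bullet> x = R\<^sup>2" "R \<noteq> 0" for x :: "'c::euclidean_space" and R :: real
    using that euclidean_inner[of x x] by (simp add: sum_subtractf flip: sum_divide_distrib)
  show "(\<Sum>b\<in>Basis. fst (pr z b) \<bullet> fst (pr z b)) = p"
    using 2[OF inner_M(1)[OF z] R0(1)] by (simp add: sum_Basis_Pair torus_proj_def 1 inner_M[OF z] R0 p_eq q_eq)
  show "(\<Sum>b\<in>Basis. snd (pr z b) \<bullet> snd (pr z b)) = q"
    using 2[OF inner_M(2)[OF z] R0(2)] by (simp add: sum_Basis_Pair torus_proj_def 1 inner_M[OF z] R0 p_eq q_eq)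
qed

lemma pder_linear: "linear A \<Longrightarrow> z \<in> M \<Longrightarrow> pder A z u = A (pr z u)" for A :: "'a \<times> 'b \<Rightarrow> 'a \<times> 'b"
  by (rule pder_eq[OF bounded_linear_imp_has_derivative]) (simp_all add: linear_conv_bounded_linear)

text \<open>Both the embedding and \<open>nu\<close> are restrictions of linear maps, so one formula
  gives the Hessians of both: the linear map applied to the second fundamental form.\<close>

lemma covd_fext_linear:
  fixes A :: "'a \<times> 'b \<Rightarrow> 'a \<times> 'b"
  assumes A: "linear A" and z: "z \<in> M"
  shows "covd (fext (zero_form A)) z u [w] =
    - A (((fst (pr z w) \<bullet> fst (pr z u)) / R1\<^sup>2) *\<^sub>R fst z, ((snd (pr z w) \<bullet> snd (pr z u)) / R2\<^sup>2) *\<^sub>R snd z)"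
proof -
  have "covd (fext (zero_form A)) z u [w] = pder (\<lambda>y. A (pr y (pr z w))) z u"
    unfolding covd_def by (rule pder_cong[OF z]) (simp add: fext_zero_form pder_linear[OF A])
  also have "\<dots> = A (pder (\<lambda>y. pr y (pr z w)) z u)"
    using A by (intro pder_linear_image smooth_P z) (simp add: linear_conv_bounded_linear)
  finally show ?thesis by (simp only: pder_pr_tangent[OF z] linear_neg[OF A])
qed

lemma fco_fext_linear:
  fixes A :: "'a \<times> 'b \<Rightarrow> 'a \<times> 'b"
  assumes A: "linear A" and z: "z \<in> M"
  shows "fco (fext (zero_form A)) z [] = A (torus_mean R1 R2 z)"
proof -
  have "fco (fext (zero_form A)) z [] =
      A (\<Sum>b\<in>Basis. (((fst (pr z b) \<bullet> fst (pr z b)) / R1\<^sup>2) *\<^sub>R fst z, ((snd (pr z b) \<bullet> snd (pr z b)) / R2\<^sup>2) *\<^sub>R snd z))"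
    unfolding fco_def covd_fext_linear[OF A z] linear_sum[OF A] by (simp add: sum_negf)
  also have "(\<Sum>b\<in>Basis. (((fst (pr z b) \<bullet> fst (pr z b)) / R1\<^sup>2) *\<^sub>R fst z, ((snd (pr z b) \<bullet> snd (pr z b)) / R2\<^sup>2) *\<^sub>R snd z)) =
      torus_mean R1 R2 z"
    by (rule prod_eqI) (simp_all add: fst_sum snd_sum torus_mean_eq trace_pr[OF z]
        flip: scaleR_sum_left sum_divide_distrib)
  finally show ?thesis .
qed

text \<open>The Hessian is symmetric in its two arguments, so its alternation vanishes in degree
  two, and there is nothing in other degrees.\<close>

lemma fext_fext_linear:
  fixes A :: "'a \<times> 'b \<Rightarrow> 'a \<times> 'b"
  assumes A: "linear A" and z: "z \<in> M"
  shows "fext (fext (zero_form A)) z vs = 0"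
proof -
  have zero: "covd (fext (zero_form A)) z u ws = 0" if "length ws \<noteq> 1" for u ws
  proof -
    have "covd (fext (zero_form A)) z u ws = pder (\<lambda>y. 0) z u"
      unfolding covd_def using that by (intro pder_cong[OF z]) (auto simp: fext_zero_form split: list.splits)
    then show ?thesis by (simp add: pder_const[OF z])
  qed
  show ?thesis
  proof (cases "length vs = 2")
    case True
    then obtain u v where vs: "vs = [u, v]" by (auto simp: length_Suc_conv numeral_2_eq_2)
    show ?thesis
      by (simp add: vs fext_def[of "fext _"] covd_fext_linear[OF A z] 
          inner_commute[of "fst (pr z v)" "fst (pr z u)"] inner_commute[of "snd (pr z v)" "snd (pr z u)"])
  next
    case False
    then show ?thesis
      unfolding fext_def[of "fext _"] asum_eq_sum by (intro sum.neutral) (auto intro!: zero)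
  qed
qed

lemma linear_nu: "linear nu"
  by (rule linearI) (simp_all add: nu_def algebra_simps)

lemma embedding_eq: "clifford_embedding = (\<lambda>z :: 'a \<times> 'b. z)"
  by (auto simp: clifford_embedding_def)

lemma norm_M: "z \<in> M \<Longrightarrow> norm z = 1"
  using inner_M[of z] unit by (simp add: norm_eq_1 inner_prod_def)

sublocale normal_eigenmap M "torus_proj R1 R2" vol "torus_mean R1 R2" clifford_embedding nu kap mu rho "p + q"
proof
  show "smooth_on_set M clifford_embedding"
    unfolding embedding_eq by (rule smooth_on_set_id)
  show "norm (clifford_embedding z) = 1" if "z \<in> M" for z
    using norm_M[OF that] by (simp add: embedding_eq)
  show "smooth_on_set M nu"
    unfolding nu_def[abs_def]
    by (intro smooth_on_set_Pair smooth_on_set_scaleR smooth_on_set_fst smooth_on_set_snd smooth_on_set_id smooth_on_set_const)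
  fix z assume z: "z \<in> M"
  have unit': "R2\<^sup>2 + R1\<^sup>2 = 1" using unit by simp
  \<comment> \<open>The Laplacian of the position has the coefficients p / R1^2 and q / R2^2 on the
    two factors. Rewriting them in terms of \<open>nu\<close> and the position uses that the squared
    radii add up to one.\<close>
  have e1: "kap * R2\<^sup>2 + (p + q) = p / R1\<^sup>2" "kap * - R1\<^sup>2 + (p + q) = q / R2\<^sup>2"
  proof -
    have "kap * R2\<^sup>2 + (p + q) = p / R1\<^sup>2 * (R2\<^sup>2 + R1\<^sup>2)" "kap * - R1\<^sup>2 + (p + q) = q / R2\<^sup>2 * (R2\<^sup>2 + R1\<^sup>2)"
      using R0 by (simp_all add: kap_def field_simps)
    then show "kap * R2\<^sup>2 + (p + q) = p / R1\<^sup>2" "kap * - R1\<^sup>2 + (p + q) = q / R2\<^sup>2"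
      unfolding unit' by simp_all
  qed
  have gen: "(y * a + x * b) * y + (a - b) * (x * y) = y * a * (y + x)"
    "(y * a + x * b) * - x + (a - b) * (x * y) = - x * b * (y + x)" for a b x y :: real
    by (simp_all add: algebra_simps)
  have e2: "mu * R2\<^sup>2 + kap * rho = R2\<^sup>2 * (p / R1\<^sup>2)" "mu * - R1\<^sup>2 + kap * rho = - R1\<^sup>2 * (q / R2\<^sup>2)"
    unfolding mu_def kap_def rho_def gen unit' by simp_all
  have "fco (fext (zero_form clifford_embedding)) z [] = torus_mean R1 R2 z"
    using fco_fext_linear[OF linear_ident z] by (simp add: embedding_eq)
  also have "\<dots> = kap *\<^sub>R nu z + (p + q) *\<^sub>R clifford_embedding z"
    by (rule prod_eqI) (simp_all only: nu_def torus_mean_eq embedding_eq fst_conv snd_conv fst_add snd_add fst_scaleR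
        snd_scaleR scaleR_scaleR e1 scaleR_add_left[symmetric])
  finally show "fco (fext (zero_form clifford_embedding)) z [] = kap *\<^sub>R nu z + (p + q) *\<^sub>R clifford_embedding z" .
  have "fco (fext (zero_form nu)) z [] = nu (torus_mean R1 R2 z)"
    by (rule fco_fext_linear[OF linear_nu z])
  also have "\<dots> = mu *\<^sub>R nu z + (kap * rho) *\<^sub>R clifford_embedding z"
    by (rule prod_eqI) (simp_all only: nu_def torus_mean_eq embedding_eq fst_conv snd_conv fst_add snd_add fst_scaleR
        snd_scaleR scaleR_scaleR e2 scaleR_add_left[symmetric])
  finally show "fco (fext (zero_form nu)) z [] = mu *\<^sub>R nu z + (kap * rho) *\<^sub>R clifford_embedding z" .
  show "fext (fext (zero_form nu)) z vs = 0" for vs by (rule fext_fext_linear[OF linear_nu z])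
  show "nu z \<bullet> clifford_embedding z = 0"
    using inner_M[OF z] by (simp add: nu_def embedding_eq inner_prod_def)
  show "pder nu z u \<bullet> clifford_embedding z = 0" for u
    using pr_orthogonal[OF z] by (simp add: pder_linear[OF linear_nu z] nu_def embedding_eq inner_prod_def)
qed

lemma isometric_immersion: "isometric_immersion M N clifford_embedding"
proof -
  have "dir_deriv M clifford_embedding z v = v" if "v \<in> tangent_space M z" for z v
    unfolding embedding_eq by (rule dir_deriv_eq[OF has_derivative_ident that])
  then show ?thesis
    unfolding isometric_immersion_def smooth_map_def
    using smooth_phi norm_phi by auto
qed

lemma nu_nonzero: "z \<in> M \<Longrightarrow> nu z \<noteq> 0"
  using inner_M(1)[of z] R0 by (auto simp: nu_def prod_eq_iff)

lemma nproj_mean: "z \<in> M \<Longrightarrow> nproj z (torus_mean R1 R2 z) = kap *\<^sub>R nu z"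
  using lap_phi[of z] nu_phi[of z] norm_M[of z] fco_fext_linear[OF linear_ident, of z]
  by (simp add: embedding_eq nproj_def inner_add_left dot_square_norm)

lemma harmonic_iff: "harmonic_map M vol N clifford_embedding \<longleftrightarrow> kap = 0"
proof -
  have "tension M vol N clifford_embedding z = - kap *\<^sub>R nu z" if "z \<in> M" for z
    using tension_eq[OF that] es_even[OF that, of 0 "[]"] by (simp add: zero_form_def)
  moreover have "smooth_map M N clifford_embedding"
    using isometric_immersion unfolding isometric_immersion_def by blast
  ultimately show ?thesis
    unfolding harmonic_map_def using M_nonempty nu_nonzero by auto
qed

lemma mean_curvature_eq:
  assumes z: "z \<in> M"
  shows "mean_curvature M N clifford_embedding z =
    - (kap / real (length (orthonormal_frame M z))) *\<^sub>R nu z"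
proof -
  let ?es = "orthonormal_frame M z"
  note fr = orthonormal_frame_props[OF z]
  have tan: "e \<in> tangent_space M z" if "e \<in> set ?es" for e
    using that fr(4) span_base by blast
  have "(\<Sum>e\<leftarrow>?es. second_fundamental_form M N clifford_embedding z e e) =
      (\<Sum>e\<in>set ?es. second_fundamental_form M N clifford_embedding z e e)"
    by (rule sum_list_distinct_conv_sum_set[OF fr(1)])
  also have "\<dots> = (\<Sum>e\<in>set ?es. nproj z (- ((fst e \<bullet> fst e / R1\<^sup>2) *\<^sub>R fst z, (snd e \<bullet> snd e / R2\<^sup>2) *\<^sub>R snd z)))"
  proof (intro sum.cong refl)
    fix e assume "e \<in> set ?es"
    then have e: "e \<in> tangent_space M z" by (rule tan)
    have "second_fundamental_form M N clifford_embedding z e e =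
        nproj z (covd (fext (zero_form clifford_embedding)) z e [e])"
      unfolding second_fundamental_form_def
      using cov_deriv_eq[OF map_differential_represents z e, of "[e]"] e by (simp add: embedding_eq)
    then show "second_fundamental_form M N clifford_embedding z e e =
        nproj z (- ((fst e \<bullet> fst e / R1\<^sup>2) *\<^sub>R fst z, (snd e \<bullet> snd e / R2\<^sup>2) *\<^sub>R snd z))"
      using covd_fext_linear[OF linear_ident z, of e e] by (simp add: embedding_eq P_eq[OF z e])
  qed
  also have "\<dots> = nproj z (- (\<Sum>e\<in>set ?es. ((fst e \<bullet> fst e / R1\<^sup>2) *\<^sub>R fst z, (snd e \<bullet> snd e / R2\<^sup>2) *\<^sub>R snd z)))"
    by (simp only: linear_sum[OF linear_nproj] sum_negf[symmetric])
  also have "(\<Sum>e\<in>set ?es. ((fst e \<bullet> fst e / R1\<^sup>2) *\<^sub>R fst z, (snd e \<bullet> snd e / R2\<^sup>2) *\<^sub>R snd z)) = torus_mean R1 R2 z"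
  proof -
    have "(\<Sum>e\<in>set ?es. fst e \<bullet> fst e) = p" "(\<Sum>e\<in>set ?es. snd e \<bullet> snd e) = q"
      using trace_pr[OF z]
        sum_orthonormal_Basis[OF linear_fst linear_fst finite_set fr(2,3) P_orthonormal_frame[OF z]]
        sum_orthonormal_Basis[OF linear_snd linear_snd finite_set fr(2,3) P_orthonormal_frame[OF z]] by simp_all
    then show ?thesis
      by (intro prod_eqI) (simp_all add: fst_sum snd_sum torus_mean_eq flip: scaleR_sum_left sum_divide_distrib)
  qed
  finally show ?thesis
    unfolding mean_curvature_def by (simp add: linear_neg[OF linear_nproj] nproj_mean[OF z])
qed

lemma minimal_iff:
  assumes "DIM('a) \<ge> 2"
  shows "minimal_submanifold M N clifford_embedding \<longleftrightarrow> kap = 0"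
proof -
  \<comment> \<open>With an empty frame the mean curvature would vanish through division by zero.
    The trace of the projection on the first factor is p > 0, which excludes this.\<close>
  have "orthonormal_frame M z \<noteq> []" if z: "z \<in> M" for z
  proof
    assume "orthonormal_frame M z = []"
    then have "pr z b = 0" for b using P_orthonormal_frame[OF z, of b] by simp
    then have "p = 0" using trace_pr(1)[OF z] by simp
    with assms show False by (simp add: p_eq)
  qed
  then show ?thesis
    unfolding minimal_submanifold_def
    using isometric_immersion M_nonempty nu_nonzero by (auto simp: mean_curvature_eq)
qed

section \<open>The first variation on the torus and a test variation\<close>

lemma ES_energy_variation:
  assumes eps: "\<epsilon> > 0" and var: "smooth_variation M N clifford_embedding \<epsilon> \<Phi>"
  shows "((\<lambda>s. ES_energy M vol N r (\<Phi> s)) has_real_derivative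
    kap * (\<integral>z. nu z \<bullet> vector_derivative (\<lambda>s. \<Phi> s z) (at 0) \<partial>vol) *
    (mu ^ Suc (r - 2) - (p + q) * mu ^ (r - 2) - real (r - 2) * mu ^ (r - 2 - 1) * kap\<^sup>2 * rho)) (at 0)"
proof -
  let ?I = "{-\<epsilon><..<\<epsilon>}"
  have sm: "smooth_on_set (?I \<times> M) (\<lambda>z. \<Phi> (fst z) (snd z))"
    and im: "(\<lambda>z. \<Phi> (fst z) (snd z)) ` (?I \<times> M) \<subseteq> sphere 0 1"
    and init: "\<And>z. z \<in> M \<Longrightarrow> \<Phi> 0 z = clifford_embedding z"
    using var unfolding smooth_variation_def smooth_map_def by (simp_all add: case_prod_unfold)
  have norm: "norm (\<Phi> s z) = 1" if "s \<in> ?I" "z \<in> M" for s z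
    using im that by (force simp: image_subset_iff)
  have V: "((\<lambda>s. \<Phi> s z) has_vector_derivative vector_derivative (\<lambda>s. \<Phi> s z) (at 0)) (at 0)" if "z \<in> M" for z
    by (rule smooth_has_vector_derivative[OF sm eps that])
  have energy: "ES_energy M vol N r (\<Phi> s) =
      1 / 2 * (\<integral>x. form_ip (es (\<Phi> s) (r - 2) x) (es (\<Phi> s) (r - 2) x) \<partial>vol)" if s: "s \<in> ?I" for s
  proof -
    have "sphere_map M (torus_proj R1 R2) vol (torus_mean R1 R2) (\<Phi> s)"
      by (intro sphere_map.intro sphere_map_axioms.intro closed_submanifold_axioms smooth_slice[OF sm s] norm[OF s])
    from sphere_map.ES_energy_eq[OF this] show ?thesis .
  qed
  have "((\<lambda>s. 1 / 2 * (\<integral>x. form_ip (es (\<Phi> s) (r - 2) x) (es (\<Phi> s) (r - 2) x) \<partial>vol)) has_real_derivative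
    kap * normal_part (\<lambda>z. vector_derivative (\<lambda>s. \<Phi> s z) (at 0)) *
    (mu ^ Suc (r - 2) - (p + q) * mu ^ (r - 2) - real (r - 2) * mu ^ (r - 2 - 1) * kap\<^sup>2 * rho)) (at 0)"
    by (rule energy_first_variation[OF eps sm norm init V])
  then show ?thesis
    unfolding normal_part_def
    by (rule has_field_derivative_transform_within_open[where S = ?I]) (use eps energy in auto)
qed

text \<open>Every point moves along the great circle in the direction of the unit normal ((R2 / R1)
  x, -(R1 / R2) y), so the images are parallel tori.\<close>

definition test_variation :: "real \<Rightarrow> 'a \<times> 'b \<Rightarrow> 'a \<times> 'b" where
  "test_variation s z = ((cos s + sin s * (R2 / R1)) *\<^sub>R fst z, (cos s - sin s * (R1 / R2)) *\<^sub>R snd z)"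

lemma smooth_variation_test: "smooth_variation M N clifford_embedding 1 test_variation"
proof -
  let ?S = "{-1<..<1::real} \<times> M"
  have "smooth_on_set ?S (\<lambda>y. test_variation (fst y) (snd y))"
    unfolding test_variation_def
    by (intro smooth_on_set_Pair smooth_on_set_scaleR smooth_on_set_add smooth_on_set_diff smooth_on_set_mult
        smooth_cos_sin_fst smooth_on_set_const smooth_on_set_fst smooth_on_set_snd smooth_on_set_id)
  moreover have "norm (test_variation s z) = 1" if z: "z \<in> M" for s z
  proof -
    have a: "(cos s + sin s * (R2 / R1)) * R1 = cos s * R1 + sin s * R2"
      "(cos s - sin s * (R1 / R2)) * R2 = cos s * R2 - sin s * R1" using R0 by (simp_all add: field_simps)
    have "test_variation s z \<bullet> test_variation s z =
        ((cos s + sin s * (R2 / R1)) * R1)\<^sup>2 + ((cos s - sin s * (R1 / R2)) * R2)\<^sup>2"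
      by (simp add: test_variation_def inner_prod_def inner_M[OF z] power2_eq_square mult_ac)
    also have "\<dots> = ((sin s)\<^sup>2 + (cos s)\<^sup>2) * (R1\<^sup>2 + R2\<^sup>2)"
    proof -
      have "(x * R1 + y * R2)\<^sup>2 + (x * R2 - y * R1)\<^sup>2 = (y\<^sup>2 + x\<^sup>2) * (R1\<^sup>2 + R2\<^sup>2)" for x y
        by (simp add: power2_eq_square algebra_simps)
      then show ?thesis unfolding a .
    qed
    finally show ?thesis using unit by (simp add: norm_eq_1)
  qed
  ultimately show ?thesis
    unfolding smooth_variation_def smooth_map_def
    by (auto simp: case_prod_unfold test_variation_def embedding_eq)
qed

lemma test_variation_derivative:
  "vector_derivative (\<lambda>s. test_variation s z) (at 0) = ((R2 / R1) *\<^sub>R fst z, - (R1 / R2) *\<^sub>R snd z)"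
proof (rule vector_derivative_at)
  have "((\<lambda>s. (cos s + sin s * a) *\<^sub>R x) has_vector_derivative a *\<^sub>R x) (at 0)" for a and x :: "'c::euclidean_space"
    unfolding has_vector_derivative_def by (auto intro!: derivative_eq_intros)
  from has_vector_derivative_Pair[OF this[of "R2 / R1" "fst z"] this[of "- (R1 / R2)" "snd z"]]
  show "((\<lambda>s. test_variation s z) has_vector_derivative ((R2 / R1) *\<^sub>R fst z, - (R1 / R2) *\<^sub>R snd z)) (at 0)"
    by (simp add: test_variation_def)
qed

lemma integral_test_variation:
  "(\<integral>z. nu z \<bullet> vector_derivative (\<lambda>s. test_variation s z) (at 0) \<partial>vol) \<noteq> 0"
proof
  assume 0: "(\<integral>z. nu z \<bullet> vector_derivative (\<lambda>s. test_variation s z) (at 0) \<partial>vol) = 0"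
  have "nu z \<bullet> vector_derivative (\<lambda>s. test_variation s z) (at 0) = R1 * R2" if "z \<in> M" for z
  proof -
    have "nu z \<bullet> vector_derivative (\<lambda>s. test_variation s z) (at 0) =
        R2\<^sup>2 * (R2 / R1 * R1\<^sup>2) + R1\<^sup>2 * (R1 / R2 * R2\<^sup>2)"
      by (simp add: test_variation_derivative nu_def inner_prod_def inner_M[OF that] mult_ac)
    also have "\<dots> = R1 * R2 * (R1\<^sup>2 + R2\<^sup>2)" using R0 by (simp add: power2_eq_square algebra_simps)
    finally show ?thesis by (simp add: unit)
  qed
  then have "(\<integral>z. R1 * R2 \<partial>vol) = 0"
    using 0 integral_cong_M[of "\<lambda>z. nu z \<bullet> vector_derivative (\<lambda>s. test_variation s z) (at 0)" "\<lambda>z. R1 * R2"] by simp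
  moreover obtain z where "z \<in> M" using M_nonempty by blast
  ultimately have "R1 * R2 = 0"
    using R1 R2 by (intro integral_eq_0_imp[of "\<lambda>z. R1 * R2" z]) auto
  then show False using R0 by simp
qed

text \<open>The first variation depends on the variation field only through its integral against
  \<open>nu\<close>. This is nonzero for \<open>test_variation\<close>, so that one variation
  decides.\<close>

lemma ES_harmonic_iff:
  "ES_harmonic_map M vol N r clifford_embedding \<longleftrightarrow>
    kap * (mu ^ Suc (r - 2) - (p + q) * mu ^ (r - 2) - real (r - 2) * mu ^ (r - 2 - 1) * kap\<^sup>2 * rho) = 0"
  (is "_ \<longleftrightarrow> kap * ?e = 0")
proof
  assume "ES_harmonic_map M vol N r clifford_embedding"
  then have "((\<lambda>s. ES_energy M vol N r (test_variation s)) has_real_derivative 0) (at 0)"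
    using smooth_variation_test zero_less_one unfolding ES_harmonic_map_def by blast
  from DERIV_unique[OF this ES_energy_variation[OF zero_less_one smooth_variation_test]]
  show "kap * ?e = 0" using integral_test_variation by auto
next
  assume "kap * ?e = 0"
  then have zero: "kap * a * ?e = 0" for a by auto
  show "ES_harmonic_map M vol N r clifford_embedding"
    unfolding ES_harmonic_map_def
  proof (intro conjI allI impI)
    show "smooth_map M N clifford_embedding"
      using isometric_immersion unfolding isometric_immersion_def by blast
    fix \<epsilon> :: real and \<Phi> assume "\<epsilon> > 0" "smooth_variation M N clifford_embedding \<epsilon> \<Phi>"
    from ES_energy_variation[OF this, of r]
    show "((\<lambda>s. ES_energy M vol N r (\<Phi> s)) has_real_derivative 0) (at 0)" by (simp only: zero)
  qed
qed

end

section \<open>From the constants of the torus to the polynomial in the squared radius\<close>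

theorem theorem2p2:
  fixes r p q :: nat and R1 R2 :: real
    and i :: "(real ^ 'm) \<times> (real ^ 'n) \<Rightarrow> (real ^ 'm) \<times> (real ^ 'n)"
  assumes "r \<ge> 2" and "p \<ge> 1" and "q \<ge> 1"
    and "CARD('m) = p + 1" and "CARD('n) = q + 1"
    and "R1 > 0" and "R2 > 0" and "R1\<^sup>2 + R2\<^sup>2 = 1"
    and "i = clifford_embedding"
  shows "(minimal_submanifold (clifford_torus R1 R2) (sphere 0 1) i \<longleftrightarrow>
            R1\<^sup>2 = real p / real (p + q) \<and> R2\<^sup>2 = real q / real (p + q)) \<and>
         (proper_ES_harmonic_submanifold
              (clifford_torus R1 R2) (clifford_volume R1 R2) (sphere 0 1) r i \<longleftrightarrow>
            \<not> (R1\<^sup>2 = real p / real (p + q) \<and> R2\<^sup>2 = real q / real (p + q)) \<and>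
            (r = 2 \<and> p \<noteq> q \<and> R1\<^sup>2 = 1 / 2 \<and> R2\<^sup>2 = 1 / 2 \<or>
             r \<ge> 3 \<and>
             poly [: - real p,
                     2 * real p + real r * real p,
                     real q - real p - real r * (real q + 2 * real p),
                     real r * (real p + real q) :] (R1\<^sup>2) = 0))"
proof -
  interpret T: clifford R1 R2 "real p" "real q" "clifford_torus R1 R2 :: ((real ^ 'm) \<times> (real ^ 'n)) set"
    by unfold_locales (use assms in auto)
  have dim: "DIM(real ^ 'm) \<ge> 2" using assms by simp
  define t where "t = R1\<^sup>2"
  define u where "u = R2\<^sup>2"
  have t: "t > 0" "u > 0" "u = 1 - t" using assms by (auto simp: t_def u_def)
  define P Q where "P = real p" and "Q = real q"
  have PQ: "P > 0" "Q > 0" using assms by (auto simp: P_def Q_def)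
  define \<kappa> where "\<kappa> = P / t - Q / u"
  define \<mu> where "\<mu> = u * (P / t) + t * (Q / u)"
  define k where "k = r - 2"
  have \<mu>: "\<mu> > 0" unfolding \<mu>_def using t PQ by (intro add_pos_pos mult_pos_pos divide_pos_pos) auto
  \<comment> \<open>Multiplication by t u, which is not zero, turns \<kappa> and \<mu> into
    polynomials in t.\<close>
  have \<kappa>_eq: "\<kappa> * (t * u) = P - (P + Q) * t"
    unfolding \<kappa>_def using t(1,2) by (simp add: field_simps) (simp add: t(3) algebra_simps)
  have \<mu>_eq: "\<mu> * (t * u) = P - 2 * P * t + (P + Q) * t\<^sup>2"
    unfolding \<mu>_def using t(1,2) by (simp add: field_simps power2_eq_square) (simp add: t(3) algebra_simps)
  have tu: "t * u \<noteq> 0" using t by simp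
  have "\<kappa> = 0 \<longleftrightarrow> P - (P + Q) * t = 0" using \<kappa>_eq tu by (metis mult_eq_0_iff)
  also have "\<dots> \<longleftrightarrow> t = P / (P + Q)" using PQ by (auto simp: field_simps)
  also have "\<dots> \<longleftrightarrow> t = P / (P + Q) \<and> u = Q / (P + Q)"
  proof -
    have "1 - P / (P + Q) = Q / (P + Q)" using PQ by (simp add: field_simps)
    then show ?thesis by (auto simp: t(3))
  qed
  finally have kap0: "\<kappa> = 0 \<longleftrightarrow> R1\<^sup>2 = real p / real (p + q) \<and> R2\<^sup>2 = real q / real (p + q)"
    by (simp add: t_def u_def P_def Q_def)
  have minimal: "minimal_submanifold (clifford_torus R1 R2) (sphere 0 1) i \<longleftrightarrow> \<kappa> = 0"
    using T.minimal_iff dim assms(9) by (simp add: \<kappa>_def T.kap_def P_def Q_def t_def u_def)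
  define e where "e = \<mu> ^ Suc k - (P + Q) * \<mu> ^ k - real k * \<mu> ^ (k - 1) * \<kappa>\<^sup>2 * (t * u)"
  have proper: "proper_ES_harmonic_submanifold (clifford_torus R1 R2) (clifford_volume R1 R2) (sphere 0 1) r i \<longleftrightarrow>
      \<kappa> \<noteq> 0 \<and> e = 0"
    unfolding proper_ES_harmonic_submanifold_def proper_ES_harmonic_map_def
    using T.isometric_immersion T.harmonic_iff T.ES_harmonic_iff[of r] assms(9)
    by (auto simp: T.kap_def T.mu_def T.rho_def \<kappa>_def \<mu>_def e_def P_def Q_def t_def u_def k_def)
  have "e = 0 \<longleftrightarrow> (r = 2 \<and> p \<noteq> q \<and> R1\<^sup>2 = 1 / 2 \<and> R2\<^sup>2 = 1 / 2 \<or>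
      r \<ge> 3 \<and> poly [: - real p, 2 * real p + real r * real p,
        real q - real p - real r * (real q + 2 * real p), real r * (real p + real q) :] (R1\<^sup>2) = 0)"
    if \<kappa>: "\<kappa> \<noteq> 0"
  proof (cases "r = 2")
    case True
    \<comment> \<open>For r = 2 the last term of \<open>e\<close> has the factor k = 0, and the rest
      is a multiple of \<kappa>, which is not zero here.\<close>
    have "(\<mu> - (P + Q)) * (t * u) = (1 - 2 * t) * (\<kappa> * (t * u))"
      unfolding left_diff_distrib \<mu>_eq \<kappa>_eq unfolding t(3) by (simp add: algebra_simps power2_eq_square)
    then have "\<mu> - (P + Q) = (1 - 2 * t) * \<kappa>" using tu by simp
    then have "e = 0 \<longleftrightarrow> t = 1 / 2" using \<kappa> True by (auto simp: e_def k_def)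
    \<comment> \<open>At equal radii \<kappa> is a multiple of P - Q, so its being nonzero forces p
      and q to differ.\<close>
    moreover have "p \<noteq> q" if "t = 1 / 2" using \<kappa> that t(3) by (auto simp: \<kappa>_def P_def Q_def)
    ultimately show ?thesis using True t(3) by (auto simp: t_def u_def)
  next
    case False
    then have r: "r \<ge> 3" "k = Suc (k - 1)" "real r = real k + 2" using assms(1) by (auto simp: k_def)
    let ?p = "poly [: - real p, 2 * real p + real r * real p,
        real q - real p - real r * (real q + 2 * real p), real r * (real p + real q) :] (R1\<^sup>2)"
    have "\<mu> ^ Suc k = \<mu> ^ (k - 1) * \<mu>\<^sup>2" "\<mu> ^ k = \<mu> ^ (k - 1) * \<mu>"
      by (subst r(2), simp add: power2_eq_square mult_ac)+
    then have "e = \<mu> ^ (k - 1) * (\<mu>\<^sup>2 - (P + Q) * \<mu> - real k * \<kappa>\<^sup>2 * (t * u))"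
      by (simp add: e_def algebra_simps)
    then have "e = 0 \<longleftrightarrow> \<mu>\<^sup>2 - (P + Q) * \<mu> - real k * \<kappa>\<^sup>2 * (t * u) = 0" using \<mu> by simp
    also have "\<dots> \<longleftrightarrow> (\<mu>\<^sup>2 - (P + Q) * \<mu> - real k * \<kappa>\<^sup>2 * (t * u)) * (t * u)\<^sup>2 = 0" using tu by simp
    also have "(\<mu>\<^sup>2 - (P + Q) * \<mu> - real k * \<kappa>\<^sup>2 * (t * u)) * (t * u)\<^sup>2 =
        (\<mu> * (t * u))\<^sup>2 - (P + Q) * (t * u) * (\<mu> * (t * u)) - real k * (t * u) * (\<kappa> * (t * u))\<^sup>2"
      by (simp add: algebra_simps power2_eq_square)
    \<comment> \<open>The cleared expression is divisible by the numerator of \<kappa>, which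
      vanishes only in the minimal case; the cofactor is minus the polynomial of the
      theorem.\<close>
    also have "\<dots> = - ((\<kappa> * (t * u)) * ?p)"
    proof -
      have pe: "?p = - P + t * ((2 * P + (real k + 2) * P) +
          t * ((Q - P - (real k + 2) * (Q + 2 * P)) + t * ((real k + 2) * (P + Q))))"
        by (simp add: P_def Q_def r(3) t_def)
      show ?thesis
        unfolding \<mu>_eq \<kappa>_eq pe unfolding t(3) by (simp add: algebra_simps power2_eq_square)
    qed
    also have "\<dots> = 0 \<longleftrightarrow> ?p = 0" using \<kappa> tu by simp
    finally show ?thesis using r(1) False by simp
  qed
  then show ?thesis using minimal proper kap0 by blast
qed

end
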